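(* Let $p\in[0,1]$, $\lambda>0$ and $\mu>0$. Consider $N\ge 2$ servers with service rate $\mu$ that are independently and uniformly distributed in $[0,1]$ and receive exogenous arrivals at rate $\lambda$ following the $(1,p)$-NNS strategy, and let $\mathcal{O}_N$ be the fraction of overloaded servers. (i) If $\frac{1}{1+p}<\frac{\lambda}{\mu}\le 1$, then, as $N\to\infty$, $$\mathcal{O}_N\to\frac14\ \text{ almost surely,}\qquad\text{and}\qquad\sqrt{N}\,\big(\mathcal{O}_N-\mathbb{E}\,\mathcal{O}_N\big)\to\mathcal{N}\Big(0,\frac{19}{240}\Big)\ \text{ in distribution.}$$ (ii) If $\frac{\lambda}{\mu}\le\frac{1}{1+p}$, then $\mathcal{O}_N=0$ almost surely for all $N$.
   Context: Servers: $X_1,X_2,\dots$ are i.i.d. uniformly distributed on $[0,1]$; the system with $N$ servers has server $i$ (with its own infinite-capacity queue) at $X_i$, $1\le i\le N$. Almost surely all inter-server distances are distinct, so each server has a unique nearest neighbour among the other $N-1$ servers. Arrivals: customers arrive at each queue $i$ according to a stationary arrival process of exogenous rate (intensity) $\lambda$, the processes being mutually independent; each server works at service rate $\mu$. Customers make independent decisions. Under the $(1,p)$-NNS (nearest neighbour shift) strategy, a customer arriving at queue $i$ joins queue $i$ with probability $1-p$, and joins the queue of the nearest neighbour of $i$ with probability $p$. The effective arrival rate $\lambda_{\text{eff}}(i)$ is the rate at which customers join queue $i$, i.e. the sum over all $j\in\{1,\dots,N\}$ of $\lambda$ times the probability that a customer arriving at queue $j$ joins queue $i$. Server $i$ is overloaded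 if $\lambda_{\text{eff}}(i)>\mu$, and $$\mathcal{O}_N=\frac1N\big|\{i:\lambda_{\text{eff}}(i)>\mu\}\big|,$$ a random variable whose randomness comes from the server locations only. $\mathcal{N}(0,\sigma^2)$ is the normal distribution with mean $0$ and variance $\sigma^2$. *)

theory Defs
  imports "HOL-Probability.Probability"
begin

text \<open>Servers are numbered \<open>1, \<dots>, N\<close>, server \<open>i\<close> being located at \<open>x i\<close>.  If several other
  servers are equally close, or if \<open>N \<le> 1\<close>, the value below is an arbitrary choice; for \<open>N \<ge> 2\<close>
  and i.i.d. uniform locations ties have probability zero.\<close>

definition nearest_neighbour :: "(nat \<Rightarrow> real) \<Rightarrow> nat \<Rightarrow> nat \<Rightarrow> nat" where
  "nearest_neighbour x N i = arg_min_on (\<lambda>j. dist (x i) (x j)) ({1..N} - {i})"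

text \<open>The \<open>(1,p)\<close>-NNS strategy: the (random) queue joined by a customer arriving at queue \<open>j\<close>.\<close>

definition nns_choice :: "real \<Rightarrow> (nat \<Rightarrow> real) \<Rightarrow> nat \<Rightarrow> nat \<Rightarrow> nat pmf" where
  "nns_choice p x N j =
     map_pmf (\<lambda>shift. if shift then nearest_neighbour x N j else j) (bernoulli_pmf p)"

definition effective_rate :: "real \<Rightarrow> real \<Rightarrow> (nat \<Rightarrow> real) \<Rightarrow> nat \<Rightarrow> nat \<Rightarrow> real" where
  "effective_rate lam p x N i = (\<Sum>j\<in>{1..N}. lam * pmf (nns_choice p x N j) i)"

definition overloaded_fraction :: "real \<Rightarrow> real \<Rightarrow> real \<Rightarrow> (nat \<Rightarrow> real) \<Rightarrow> nat \<Rightarrow> real" where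
  "overloaded_fraction lam mu p x N =
     real (card {i \<in> {1..N}. effective_rate lam p x N i > mu}) / real N"

end

theory Submission
  imports Defs "HOL-Combinatorics.Permutations" "HOL-Real_Asymp.Real_Asymp"
begin

text \<open>A server that is the nearest neighbour of \<open>j\<close> others receives customers at rate
  \<open>lam * (1 - p + p * j)\<close>, and on a line \<open>j \<le> 2\<close>.  Hence nobody is overloaded when
  \<open>lam * (1 + p) \<le> mu\<close>, which is the second claim, and under the load condition of the first claim
  the overloaded servers are exactly those with \<open>j = 2\<close>.  With the servers ranked from left to right,
  the two end ones have \<open>j \<le> 1\<close>, and any other has \<open>j = 2\<close> iff the gap to its left is shorter than
  the gap before that and the gap to its right is shorter than the gap after that, where a comparison
  with a gap beyond the ends counts as true (\<open>in_degree_eq_2_iff\<close>).  The number of overloaded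
  servers therefore depends only on the relative order of the \<open>N - 1\<close> gaps.

  The gaps between uniform points are dependent, but their relative order is a uniformly random
  permutation: reflecting one point in the midpoint of its two neighbours preserves Lebesgue measure
  and swaps two adjacent gaps (\<open>prob_spacing_order_transpose\<close>), and adjacent transpositions generate
  the symmetric group.  The order of \<open>N - 1\<close> of the independent locations themselves is uniform as
  well.  So for each \<open>N\<close> the number of overloaded servers has the law of the same statistic evaluated at
  \<open>X 1, \<dots>, X (N - 1)\<close> (\<open>distr_overloaded_fraction\<close>).  Up to a bounded boundary term the latter is a
  sum of indicators \<open>valley_ind k\<close> of the events that \<open>X k > X (k + 1)\<close> and \<open>X (k + 2) < X (k + 3)\<close>,
  a stationary sequence whose members are independent as soon as their indices differ by more than 3.

  An ascending run of \<open>r + 1\<close> values has probability \<open>1 / (r + 1)!\<close>, from which every moment follows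
  by inclusion and exclusion: the indicators have mean \<open>1 / 4\<close>, variance \<open>3 / 16\<close>, and covariances
  \<open>- 1 / 80\<close>, \<open>- 1 / 16\<close> and \<open>1 / 48\<close> at distances 1, 2 and 3.  The asymptotic variance is
  \<open>3 / 16 + 2 * (- 1 / 80 - 1 / 16 + 1 / 48) = 19 / 240\<close>.

  Both limit theorems are proved for sums of bounded, stationary, \<open>m\<close>-dependent variables.  For the
  strong law, Hoeffding's inequality on each residue class modulo \<open>m + 1\<close> makes the probabilities of
  deviations summable; this is a statement about the law of each single term, so it transfers to the
  overloaded fractions, and the Borel--Cantelli lemma applies to them although their joint law in
  different \<open>N\<close> is not that of the sums.  For the central limit theorem, the sum is cut into independent long
  blocks of length \<open>L\<close> separated by short blocks of length \<open>m\<close>: the classical theorem applies to the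
  long blocks, the short ones contribute an error of order \<open>1 / sqrt L\<close> uniformly in the number of
  summands, and letting \<open>L\<close> tend to infinity in the characteristic functions gives the limit.\<close>

section \<open>Sorting permutations\<close>

lemma sum_of_bool_eq_card:
  "finite A \<Longrightarrow> (\<Sum>i\<in>A. of_bool (P i)) = real (card {i \<in> A. P i})"
  by (simp add: of_bool_def sum.If_cases Int_def)

lemma permutes_in_range: "\<sigma> permutes {1..n} \<Longrightarrow> i \<in> {1..n} \<Longrightarrow> \<sigma> i \<in> {1..n}"
  by (simp only: permutes_in_image)

text \<open>The permutation that lists the indices \<open>1, \<dots>, n\<close> in increasing order of their values under \<open>d\<close>.
  It exists exactly when these values are distinct, and it encodes their relative order.\<close>

definition sorts :: "(nat \<Rightarrow> nat) \<Rightarrow> nat \<Rightarrow> (nat \<Rightarrow> real) \<Rightarrow> bool" where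
  "sorts \<pi> n d \<longleftrightarrow> \<pi> permutes {1..n} \<and> (\<forall>k\<in>{1..<n}. d (\<pi> k) < d (\<pi> (Suc k)))"

lemma sorts_permutes: "sorts \<pi> n d \<Longrightarrow> \<pi> permutes {1..n}"
  by (simp add: sorts_def)

lemma sorts_less:
  assumes "sorts \<pi> n d" "i \<in> {1..n}" "j \<in> {1..n}" "i < j"
  shows "d (\<pi> i) < d (\<pi> j)"
proof -
  have "i + Suc m \<le> n \<Longrightarrow> d (\<pi> i) < d (\<pi> (i + Suc m))" for m
  proof (induction m)
    case 0
    then show ?case
      using assms by (auto simp: sorts_def)
  next
    case (Suc m)
    then have "d (\<pi> i) < d (\<pi> (i + Suc m))" by simp
    also have "\<dots> < d (\<pi> (Suc (i + Suc m)))"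
      using assms Suc.prems by (auto simp: sorts_def)
    finally show ?case by simp
  qed
  from this[of "j - Suc i"] show ?thesis
    using assms by auto
qed

lemma sorts_less_iff:
  assumes "sorts \<pi> n d" "i \<in> {1..n}" "j \<in> {1..n}"
  shows "d (\<pi> i) < d (\<pi> j) \<longleftrightarrow> i < j"
  using sorts_less[OF assms] sorts_less[OF assms(1) assms(3) assms(2)]
  by (metis less_asym nat_neq_iff order_less_irrefl)

lemma sorts_exists:
  assumes "inj_on d {1..n}"
  shows "\<exists>\<pi>. sorts \<pi> n d"
proof -
  define xs where "xs = sort_key d [1..<Suc n]"
  have xs: "distinct xs" "set xs = {1..n}" "length xs = n" "sorted (map d xs)"
    by (auto simp: xs_def)
  have dist: "distinct (map d xs)"
    using assms xs by (simp add: distinct_map)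
  define \<pi> where "\<pi> = (\<lambda>k. if k \<in> {1..n} then xs ! (k - 1) else k)"
  have "bij_betw \<pi> {1..n} {1..n}"
  proof (rule bij_betw_imageI)
    show "inj_on \<pi> {1..n}"
      using xs by (auto simp: inj_on_def \<pi>_def nth_eq_iff_index_eq)
    have "\<pi> ` {1..n} = (\<lambda>k. xs ! k) ` ((\<lambda>k. k - 1) ` {1..n})"
      by (auto simp: \<pi>_def image_image)
    also have "(\<lambda>k. k - 1) ` {1..n} = {..<n}"
      by (force simp: image_iff intro: bexI[of _ "Suc _"])
    also have "(\<lambda>k. xs ! k) ` {..<n} = {1..n}"
      using xs by (metis nth_image lessThan_atLeast0 order_refl take_all)
    finally show "\<pi> ` {1..n} = {1..n}" .
  qed
  then have "\<pi> permutes {1..n}"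
    by (rule bij_imp_permutes) (auto simp: \<pi>_def)
  moreover have "d (\<pi> k) < d (\<pi> (Suc k))" if "k \<in> {1..<n}" for k
    using sorted_wrt_nth_less[of "(<)" "map d xs" "k - 1" k] dist xs that
    by (auto simp: \<pi>_def strict_sorted_iff)
  ultimately show ?thesis
    unfolding sorts_def by blast
qed

text \<open>The rank of an entry can be read off from \<open>d\<close> alone, which makes the sorting permutation unique.\<close>

lemma sorts_rank:
  assumes "sorts \<pi> n d" "k \<in> {1..n}"
  shows "card {j \<in> {1..n}. d j < d (\<pi> k)} = k - 1"
proof -
  have bij: "bij_betw \<pi> {1..n} {1..n}"
    using assms(1) by (simp add: sorts_def permutes_imp_bij)
  have "{j \<in> {1..n}. d j < d (\<pi> k)} = \<pi> ` {1..<k}"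
  proof (intro equalityI subsetI)
    fix j assume j: "j \<in> {j \<in> {1..n}. d j < d (\<pi> k)}"
    then have "j \<in> \<pi> ` {1..n}"
      using bij by (simp only: bij_betw_def mem_Collect_eq)
    then obtain i where "i \<in> {1..n}" "j = \<pi> i" by blast
    then show "j \<in> \<pi> ` {1..<k}"
      using j sorts_less_iff[OF assms(1) _ assms(2)] by auto
  next
    fix j assume "j \<in> \<pi> ` {1..<k}"
    then show "j \<in> {j \<in> {1..n}. d j < d (\<pi> k)}"
      using assms sorts_less[OF assms(1) _ assms(2)] bij by (auto simp: bij_betw_def)
  qed
  also have "card \<dots> = k - 1"
    using bij assms(2) by (subst card_image) (auto simp: bij_betw_def intro: inj_on_subset)
  finally show ?thesis .
qed

lemma sorts_unique:
  assumes "sorts \<pi> n d" "sorts \<rho> n d"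
  shows "\<pi> = \<rho>"
proof
  fix k
  show "\<pi> k = \<rho> k"
  proof (cases "k \<in> {1..n}")
    case True
    then have "\<pi> k \<in> \<rho> ` {1..n}"
      using assms by (metis permutes_image permutes_in_image sorts_permutes)
    then obtain l where l: "l \<in> {1..n}" "\<pi> k = \<rho> l" by auto
    then have "k - 1 = l - 1"
      using sorts_rank[OF assms(1) True] sorts_rank[OF assms(2) l(1)] by simp
    with l True show ?thesis by (cases k; cases l) auto
  next
    case False
    then show ?thesis
      using assms by (metis permutes_not_in sorts_permutes)
  qed
qed

lemma sorts_inj_on: "sorts \<pi> n d \<Longrightarrow> inj_on d {1..n}"
proof (rule inj_onI)
  fix i j assume \<pi>: "sorts \<pi> n d" and ij: "i \<in> {1..n}" "j \<in> {1..n}" "d i = d j"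
  have "\<pi> ` {1..n} = {1..n}" by (rule permutes_image[OF sorts_permutes[OF \<pi>]])
  then have "i \<in> \<pi> ` {1..n}" "j \<in> \<pi> ` {1..n}" using ij by simp_all
  then obtain k l where kl: "k \<in> {1..n}" "l \<in> {1..n}" "i = \<pi> k" "j = \<pi> l" by blast
  have "\<not> k < l" "\<not> l < k"
    using sorts_less_iff[OF \<pi> kl(1,2)] sorts_less_iff[OF \<pi> kl(2,1)] ij(3) kl(3,4) by simp_all
  then show "i = j" using kl(3,4) by simp
qed

lemma sorts_inv_less_iff:
  assumes "sorts \<pi> n d" "i \<in> {1..n}" "j \<in> {1..n}"
  shows "inv \<pi> i < inv \<pi> j \<longleftrightarrow> d i < d j"
proof -
  have perm: "\<pi> permutes {1..n}" by (rule sorts_permutes[OF assms(1)])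
  have "inv \<pi> i \<in> {1..n}" "inv \<pi> j \<in> {1..n}"
    using assms(2,3) permutes_in_range[OF permutes_inv[OF perm]] by simp_all
  from sorts_less_iff[OF assms(1) this] show ?thesis
    by (simp add: permutes_inverses[OF perm])
qed

lemma sorts_cong:
  assumes "\<And>i. i \<in> {1..n} \<Longrightarrow> d i = e i"
  shows "sorts \<pi> n d \<longleftrightarrow> sorts \<pi> n e"
proof (cases "\<pi> permutes {1..n}")
  case True
  have "d (\<pi> i) = e (\<pi> i)" if "i \<in> {1..n}" for i
    by (rule assms[OF permutes_in_range[OF True that]])
  then show ?thesis by (simp add: sorts_def)
qed (simp add: sorts_def)

text \<open>Swapping two entries of \<open>d\<close> acts on sorting permutations by multiplication from the left; this is how
  a symmetry of the gaps becomes a symmetry of the law of their order.\<close>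

lemma sorts_transpose:
  assumes "\<pi> permutes {1..n}" "k \<in> {1..<n}"
  shows "sorts (Transposition.transpose k (Suc k) \<circ> \<pi>) n d \<longleftrightarrow>
         sorts \<pi> n (d \<circ> Transposition.transpose k (Suc k))"
proof -
  have "Transposition.transpose k (Suc k) \<circ> \<pi> permutes {1..n}"
    using assms by (intro permutes_compose permutes_swap_id) auto
  with assms(1) show ?thesis by (simp add: sorts_def)
qed

section \<open>Overloaded servers and the order of the spacings\<close>

definition spacing :: "(nat \<Rightarrow> real) \<Rightarrow> (nat \<Rightarrow> nat) \<Rightarrow> nat \<Rightarrow> real" where
  "spacing x \<sigma> k = x (\<sigma> (Suc k)) - x (\<sigma> k)"

text \<open>With \<open>d k\<close> the distance between the points of rank \<open>k\<close> and \<open>k + 1\<close>, these are the ranks that are the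
  nearest neighbour of the points on both sides.  The end points \<open>1\<close> and \<open>n + 1\<close> have only one
  neighbour; they always point inwards, whence the two degenerate disjuncts.  All comparisons are
  written with \<open><\<close>, so that the set visibly depends on the strict order relation of the values only.\<close>

definition popular_ranks :: "nat \<Rightarrow> (nat \<Rightarrow> real) \<Rightarrow> nat set" where
  "popular_ranks n d =
     {k \<in> {2..n}. (k = 2 \<or> \<not> d (k - 2) < d (k - 1)) \<and> (k = n \<or> d k < d (Suc k))}"

text \<open>The inverse of the sorting permutation assigns to each index its rank, and hence can replace the values
  in every statistic of their order.\<close>

lemma popular_ranks_sorts:
  assumes "sorts \<pi> n d"
  shows "popular_ranks n d = popular_ranks n (\<lambda>i. real (inv \<pi> i))"
  unfolding popular_ranks_def
proof (intro Collect_cong conj_cong refl)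
  fix k assume k: "k \<in> {2..n}"
  show "k = n \<or> d k < d (Suc k) \<longleftrightarrow> k = n \<or> real (inv \<pi> k) < real (inv \<pi> (Suc k))"
  proof (cases "k = n")
    case False
    with k have "k \<in> {1..n}" "Suc k \<in> {1..n}" by auto
    from sorts_inv_less_iff[OF assms this] show ?thesis by simp
  qed simp
  show "k = 2 \<or> \<not> d (k - 2) < d (k - 1) \<longleftrightarrow> k = 2 \<or> \<not> real (inv \<pi> (k - 2)) < real (inv \<pi> (k - 1))"
  proof (cases "k = 2")
    case False
    with k have "k - 2 \<in> {1..n}" "k - 1 \<in> {1..n}" by auto
    from sorts_inv_less_iff[OF assms this] show ?thesis by simp
  qed simp
qed

lemma nearest_neighbour_minimal:
  assumes "i \<in> {1..N}" "2 \<le> N"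
  shows "nearest_neighbour x N i \<in> {1..N} - {i}"
    and "j \<in> {1..N} - {i} \<Longrightarrow>
           dist (x i) (x (nearest_neighbour x N i)) \<le> dist (x i) (x j)"
proof -
  have "card ({1..N} - {i}) \<noteq> 0" using assms by simp
  then have ne: "{1..N} - {i} \<noteq> {}" by (metis card.empty)
  show "nearest_neighbour x N i \<in> {1..N} - {i}"
    unfolding nearest_neighbour_def by (rule arg_min_if_finite) (use ne in auto)
  show "dist (x i) (x (nearest_neighbour x N i)) \<le> dist (x i) (x j)"
    if "j \<in> {1..N} - {i}"
    unfolding nearest_neighbour_def by (rule arg_min_least) (use ne that in auto)
qed

text \<open>A point that is not next in rank has another point strictly in between, which is closer.\<close>

lemma nearest_neighbour_adjacent:
  assumes \<sigma>: "sorts \<sigma> N x" and k: "k \<in> {1..N}" and l: "l \<in> {1..N}" and N: "2 \<le> N"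
    and nn: "nearest_neighbour x N (\<sigma> k) = \<sigma> l"
  shows "l = Suc k \<or> k = Suc l"
proof (rule ccontr)
  assume not_adj: "\<not> ?thesis"
  have perm: "\<sigma> permutes {1..N}" by (rule sorts_permutes[OF \<sigma>])
  have in_range: "\<sigma> m \<in> {1..N} \<longleftrightarrow> m \<in> {1..N}" for m
    by (rule permutes_in_image[OF perm])
  have inj: "\<sigma> m = \<sigma> m' \<longleftrightarrow> m = m'" for m m'
    using permutes_inj[OF perm] by (auto dest: injD)
  have "l \<noteq> k"
    using nearest_neighbour_minimal(1)[of "\<sigma> k" N x] in_range k N nn by auto
  have le: "dist (x (\<sigma> k)) (x (\<sigma> l)) \<le> dist (x (\<sigma> k)) (x (\<sigma> m))"
    if "m \<in> {1..N}" "m \<noteq> k" for m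
    using nearest_neighbour_minimal(2)[of "\<sigma> k" N "\<sigma> m" x] in_range inj k N nn that by auto
  show False
  proof (cases "k < l")
    case True
    then have "Suc k < l" using not_adj by simp
    then have "x (\<sigma> k) < x (\<sigma> (Suc k))" "x (\<sigma> (Suc k)) < x (\<sigma> l)"
      using k l by (auto intro!: sorts_less[OF \<sigma>])
    with le[of "Suc k"] \<open>Suc k < l\<close> l show False by (simp add: dist_real_def)
  next
    case False
    then have "l < k - 1" using not_adj \<open>l \<noteq> k\<close> by simp
    then have "x (\<sigma> (k - 1)) < x (\<sigma> k)" "x (\<sigma> l) < x (\<sigma> (k - 1))"
      using k l by (auto intro!: sorts_less[OF \<sigma>])
    moreover have "k - 1 \<in> {1..N}" "k - 1 \<noteq> k"
      using k \<open>l < k - 1\<close> by auto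
    ultimately show False
      using le[of "k - 1"] by (simp add: dist_real_def)
  qed
qed

lemma nearest_neighbour_cases:
  assumes \<sigma>: "sorts \<sigma> N x" and k: "k \<in> {1..N}" and N: "2 \<le> N"
  shows "(nearest_neighbour x N (\<sigma> k) = \<sigma> (Suc k) \<and> k < N) \<or>
         (nearest_neighbour x N (\<sigma> k) = \<sigma> (k - 1) \<and> 1 < k)"
proof -
  have perm: "\<sigma> permutes {1..N}" by (rule sorts_permutes[OF \<sigma>])
  have "nearest_neighbour x N (\<sigma> k) \<in> {1..N}"
    using nearest_neighbour_minimal(1)[of "\<sigma> k" N x] permutes_in_image[OF perm] k N by auto
  then obtain l where l: "l \<in> {1..N}" "nearest_neighbour x N (\<sigma> k) = \<sigma> l"
    using permutes_image[OF perm] by (metis image_iff)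
  from nearest_neighbour_adjacent[OF \<sigma> k l(1) N l(2)] l k show ?thesis by auto
qed

lemma nearest_neighbour_right_iff:
  assumes \<sigma>: "sorts \<sigma> N x" and k: "k \<in> {1..<N}"
    and gaps: "k \<noteq> 1 \<Longrightarrow> spacing x \<sigma> (k - 1) \<noteq> spacing x \<sigma> k"
  shows "nearest_neighbour x N (\<sigma> k) = \<sigma> (Suc k) \<longleftrightarrow>
           k = 1 \<or> \<not> spacing x \<sigma> (k - 1) < spacing x \<sigma> k"
proof -
  have perm: "\<sigma> permutes {1..N}" by (rule sorts_permutes[OF \<sigma>])
  have in_range: "\<sigma> m \<in> {1..N} \<longleftrightarrow> m \<in> {1..N}" for m
    by (rule permutes_in_image[OF perm])
  have inj: "\<sigma> m = \<sigma> m' \<longleftrightarrow> m = m'" for m m'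
    using permutes_inj[OF perm] by (auto dest: injD)
  show ?thesis
  proof (cases "k = 1")
    case True
    then show ?thesis
      using nearest_neighbour_cases[OF \<sigma>, of k] k by auto
  next
    case False
    have kN: "k \<in> {1..N}" "2 \<le> N" using k by auto
    have le: "dist (x (\<sigma> k)) (x (nearest_neighbour x N (\<sigma> k))) \<le> dist (x (\<sigma> k)) (x (\<sigma> m))"
      if "m \<in> {1..N}" "m \<noteq> k" for m
      using nearest_neighbour_minimal(2)[of "\<sigma> k" N "\<sigma> m" x] in_range inj k that by auto
    have ord: "x (\<sigma> (k - 1)) < x (\<sigma> k)" "x (\<sigma> k) < x (\<sigma> (Suc k))"
      using k False by (auto intro!: sorts_less[OF \<sigma>])
    have sp: "spacing x \<sigma> (k - Suc 0) = dist (x (\<sigma> k)) (x (\<sigma> (k - Suc 0)))"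
      "spacing x \<sigma> k = dist (x (\<sigma> k)) (x (\<sigma> (Suc k)))"
      using ord k by (auto simp: spacing_def dist_real_def)
    have "k - Suc 0 \<noteq> Suc k" "k - Suc 0 \<noteq> k" "Suc 0 \<le> k - Suc 0" "k - Suc 0 \<le> N"
      using k False by auto
    then show ?thesis
      using nearest_neighbour_cases[OF \<sigma> kN] le[of "k - 1"] le[of "Suc k"] k False gaps
      by (auto simp: sp inj)
  qed
qed

lemma nearest_neighbour_left_iff:
  assumes \<sigma>: "sorts \<sigma> N x" and k: "k \<in> {1..<N}"
    and gaps: "Suc k \<noteq> N \<Longrightarrow> spacing x \<sigma> k \<noteq> spacing x \<sigma> (Suc k)"
  shows "nearest_neighbour x N (\<sigma> (Suc k)) = \<sigma> k \<longleftrightarrow>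
           Suc k = N \<or> spacing x \<sigma> k < spacing x \<sigma> (Suc k)"
proof -
  have perm: "\<sigma> permutes {1..N}" by (rule sorts_permutes[OF \<sigma>])
  have inj: "\<sigma> m = \<sigma> m' \<longleftrightarrow> m = m'" for m m'
    using permutes_inj[OF perm] by (auto dest: injD)
  show ?thesis
  proof (cases "Suc k = N")
    case True
    then show ?thesis
      using nearest_neighbour_cases[OF \<sigma>, of "Suc k"] k by auto
  next
    case False
    then show ?thesis
      using nearest_neighbour_right_iff[OF \<sigma>, of "Suc k"]
        nearest_neighbour_cases[OF \<sigma>, of "Suc k"] k gaps
      by (auto simp: inj)
  qed
qed

definition in_degree :: "(nat \<Rightarrow> real) \<Rightarrow> nat \<Rightarrow> nat \<Rightarrow> nat" where
  "in_degree x N i = card {j \<in> {1..N}. nearest_neighbour x N j = i}"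

lemma pmf_nns_choice:
  assumes "0 \<le> p" "p \<le> 1"
  shows "pmf (nns_choice p x N j) i =
           (1 - p) * of_bool (j = i) + p * of_bool (nearest_neighbour x N j = i)"
proof -
  let ?f = "\<lambda>shift. if shift then nearest_neighbour x N j else j"
  have "?f -` {i} = (if nearest_neighbour x N j = i then {True} else {}) \<union>
                    (if j = i then {False} else {})"
    by (auto split: if_splits)
  moreover have "measure (bernoulli_pmf p) {False, True} = 1"
    using measure_pmf.prob_space[of "bernoulli_pmf p"] by (simp add: UNIV_bool insert_commute)
  ultimately show ?thesis
    using assms by (auto simp: nns_choice_def pmf_map measure_pmf_single)
qed

lemma effective_rate_in_degree:
  assumes "0 \<le> p" "p \<le> 1" "i \<in> {1..N}"
  shows "effective_rate lam p x N i = lam * (1 - p + p * real (in_degree x N i))"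
proof -
  have "(\<Sum>j\<in>{1..N}. of_bool (nearest_neighbour x N j = i) :: real) = in_degree x N i"
    unfolding in_degree_def by (rule sum_of_bool_eq_card) simp
  moreover have "(\<Sum>j\<in>{1..N}. of_bool (j = i) :: real) = 1"
    using assms(3) by (simp add: of_bool_def)
  ultimately show ?thesis
    unfolding effective_rate_def pmf_nns_choice[OF assms(1,2)]
    by (simp add: sum.distrib flip: sum_distrib_left)
qed

text \<open>Only the two points that are adjacent in rank can have a given point as their nearest neighbour.\<close>

lemma in_degree_rank:
  assumes \<sigma>: "sorts \<sigma> N x" and k: "k \<in> {1..N}" and N: "2 \<le> N"
  shows "in_degree x N (\<sigma> k) =
           of_bool (1 < k \<and> nearest_neighbour x N (\<sigma> (k - 1)) = \<sigma> k) +
           of_bool (k < N \<and> nearest_neighbour x N (\<sigma> (Suc k)) = \<sigma> k)"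
proof -
  have perm: "\<sigma> permutes {1..N}" by (rule sorts_permutes[OF \<sigma>])
  have inj: "\<sigma> m = \<sigma> m' \<longleftrightarrow> m = m'" for m m'
    using permutes_inj[OF perm] by (auto dest: injD)
  let ?L = "if 1 < k \<and> nearest_neighbour x N (\<sigma> (k - 1)) = \<sigma> k then {\<sigma> (k - 1)} else {}"
  let ?R = "if k < N \<and> nearest_neighbour x N (\<sigma> (Suc k)) = \<sigma> k then {\<sigma> (Suc k)} else {}"
  have "{j \<in> {1..N}. nearest_neighbour x N j = \<sigma> k} = ?L \<union> ?R"
  proof (intro equalityI subsetI)
    fix j assume j: "j \<in> {j \<in> {1..N}. nearest_neighbour x N j = \<sigma> k}"
    then obtain l where l: "l \<in> {1..N}" "j = \<sigma> l"
      using permutes_image[OF perm] by (metis (no_types, lifting) image_iff mem_Collect_eq)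
    with j nearest_neighbour_adjacent[OF \<sigma> l(1) k N] show "j \<in> ?L \<union> ?R"
      by (auto split: if_splits)
  next
    fix j assume "j \<in> ?L \<union> ?R"
    then show "j \<in> {j \<in> {1..N}. nearest_neighbour x N j = \<sigma> k}"
      using k permutes_in_image[OF perm, of "k - 1"] permutes_in_image[OF perm, of "Suc k"]
      by (auto split: if_splits)
  qed
  then show ?thesis
    by (auto simp: in_degree_def inj)
qed

lemma in_degree_le_2:
  assumes "inj_on x {1..N}" "i \<in> {1..N}" "2 \<le> N"
  shows "in_degree x N i \<le> 2"
proof -
  obtain \<sigma> where \<sigma>: "sorts \<sigma> N x" using sorts_exists[OF assms(1)] by auto
  then obtain k where "k \<in> {1..N}" "i = \<sigma> k"
    using permutes_image[OF sorts_permutes[OF \<sigma>]] assms(2) by (metis image_iff)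
  then show ?thesis
    using in_degree_rank[OF \<sigma>, of k] assms(3) by simp
qed

lemma in_degree_eq_2_iff:
  assumes \<sigma>: "sorts \<sigma> N x" and k: "k \<in> {1..N}" and N: "2 \<le> N"
    and gaps: "inj_on (spacing x \<sigma>) {1..N - 1}"
  shows "in_degree x N (\<sigma> k) = 2 \<longleftrightarrow> k \<in> popular_ranks (N - 1) (spacing x \<sigma>)"
proof (cases "k \<in> {2..N - 1}")
  case True
  have neq: "spacing x \<sigma> a \<noteq> spacing x \<sigma> b" if "a \<in> {1..N - 1}" "b \<in> {1..N - 1}" "a \<noteq> b" for a b
    using gaps that by (auto simp: inj_on_def)
  obtain m n where mn: "k = Suc (Suc m)" "N = Suc n"
    by (rule that[of "k - 2" "N - 1"]) (use True in auto)
  have L: "nearest_neighbour x N (\<sigma> (Suc m)) = \<sigma> k \<longleftrightarrow>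
             m = 0 \<or> \<not> spacing x \<sigma> m < spacing x \<sigma> (Suc m)"
    using nearest_neighbour_right_iff[OF \<sigma>, of "Suc m"] neq[of m "Suc m"] True
    by (auto simp: mn)
  have R: "nearest_neighbour x N (\<sigma> (Suc k)) = \<sigma> k \<longleftrightarrow>
             k = n \<or> spacing x \<sigma> k < spacing x \<sigma> (Suc k)"
    using nearest_neighbour_left_iff[OF \<sigma>, of k] neq[of k "Suc k"] True
    by (auto simp: mn)
  show ?thesis
    using in_degree_rank[OF \<sigma> k N] True L R by (auto simp: popular_ranks_def mn)
next
  case False
  then have "k = 1 \<or> k = N" using k by auto
  then show ?thesis
    using in_degree_rank[OF \<sigma> k N] False by (auto simp: popular_ranks_def)
qed

text \<open>In this regime the rates for in-degrees 0 and 1 are at most \<open>lam \<le> mu\<close>, whereas the rate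
  \<open>lam * (1 + p)\<close> for in-degree 2 exceeds \<open>mu\<close>.\<close>

lemma overloaded_fraction_popular:
  assumes p: "0 \<le> p" "p \<le> 1" and lam: "lam > 0" and mu: "mu > 0"
    and load: "1 / (1 + p) < lam / mu" "lam / mu \<le> 1"
    and N: "2 \<le> N" and \<sigma>: "sorts \<sigma> N x" and gaps: "inj_on (spacing x \<sigma>) {1..N - 1}"
  shows "overloaded_fraction lam mu p x N =
           real (card (popular_ranks (N - 1) (spacing x \<sigma>))) / real N"
proof -
  have perm: "\<sigma> permutes {1..N}" by (rule sorts_permutes[OF \<sigma>])
  have lo: "lam \<le> mu" and hi: "mu < lam * (1 + p)"
    using load mu p by (auto simp: field_simps)
  have over: "effective_rate lam p x N (\<sigma> k) > mu \<longleftrightarrow> k \<in> popular_ranks (N - 1) (spacing x \<sigma>)"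
    if k: "k \<in> {1..N}" for k
  proof -
    have rate: "effective_rate lam p x N (\<sigma> k) = lam * (1 - p + p * real (in_degree x N (\<sigma> k)))"
      using effective_rate_in_degree[OF p] permutes_in_image[OF perm] k by blast
    have "in_degree x N (\<sigma> k) \<le> 2"
      using in_degree_rank[OF \<sigma> k N] by simp
    then consider "in_degree x N (\<sigma> k) = 0" | "in_degree x N (\<sigma> k) = 1"
      | "in_degree x N (\<sigma> k) = 2" by linarith
    then have "effective_rate lam p x N (\<sigma> k) > mu \<longleftrightarrow> in_degree x N (\<sigma> k) = 2"
    proof cases
      case 1
      have "lam * (1 - p) \<le> lam * 1" using lam p by (intro mult_left_mono) auto
      then show ?thesis using 1 lo by (simp add: rate)
    qed (use lo hi in \<open>simp_all add: rate algebra_simps\<close>)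
    then show ?thesis using in_degree_eq_2_iff[OF \<sigma> k N gaps] by simp
  qed
  have "{i \<in> {1..N}. effective_rate lam p x N i > mu} = \<sigma> ` popular_ranks (N - 1) (spacing x \<sigma>)"
  proof (intro equalityI subsetI)
    fix i assume i: "i \<in> {i \<in> {1..N}. effective_rate lam p x N i > mu}"
    then obtain k where "k \<in> {1..N}" "i = \<sigma> k"
      using permutes_image[OF perm] by (metis (no_types, lifting) image_iff mem_Collect_eq)
    with i over show "i \<in> \<sigma> ` popular_ranks (N - 1) (spacing x \<sigma>)" by auto
  next
    fix i assume "i \<in> \<sigma> ` popular_ranks (N - 1) (spacing x \<sigma>)"
    then obtain k where k: "k \<in> popular_ranks (N - 1) (spacing x \<sigma>)" "i = \<sigma> k" by auto
    then have "k \<in> {1..N}" by (auto simp: popular_ranks_def)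
    with k over permutes_in_image[OF perm, of k]
    show "i \<in> {i \<in> {1..N}. effective_rate lam p x N i > mu}" by auto
  qed
  moreover have "card (\<sigma> ` popular_ranks (N - 1) (spacing x \<sigma>)) =
                 card (popular_ranks (N - 1) (spacing x \<sigma>))"
    using permutes_inj[OF perm] by (intro card_image) (auto intro: inj_on_subset)
  ultimately show ?thesis by (simp add: overloaded_fraction_def)
qed

lemma overloaded_fraction_eq_0:
  assumes p: "0 \<le> p" "p \<le> 1" and lam: "lam > 0" and mu: "mu > 0"
    and load: "lam / mu \<le> 1 / (1 + p)"
    and N: "2 \<le> N" and inj: "inj_on x {1..N}"
  shows "overloaded_fraction lam mu p x N = 0"
proof -
  have le: "lam * (1 + p) \<le> mu"
    using load mu p by (auto simp: field_simps)
  have "effective_rate lam p x N i \<le> mu" if i: "i \<in> {1..N}" for i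
  proof -
    have "effective_rate lam p x N i = lam * (1 - p + p * real (in_degree x N i))"
      by (rule effective_rate_in_degree[OF p i])
    also have "\<dots> \<le> lam * (1 - p + p * 2)"
      using in_degree_le_2[OF inj i N] lam p
      by (intro mult_left_mono add_left_mono) auto
    also have "\<dots> = lam * (1 + p)" by simp
    finally show ?thesis using le by linarith
  qed
  then have "{i \<in> {1..N}. effective_rate lam p x N i > mu} = {}" by (auto simp: not_less)
  then show ?thesis by (simp add: overloaded_fraction_def)
qed

section \<open>Equally likely orders\<close>

text \<open>The event \<open>A \<pi>\<close> stands for ``the relative order is \<open>\<pi>\<close>''.  The symmetry
  assumed is invariance under adjacent transpositions, the one that a single reflection of a point provides.\<close>

locale order_events = prob_space M for M :: "'a measure" +
  fixes n :: nat and A :: "(nat \<Rightarrow> nat) \<Rightarrow> 'a set"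
  assumes events: "\<And>\<pi>. \<pi> permutes {1..n} \<Longrightarrow> A \<pi> \<in> events"
    and disjoint: "\<And>\<pi> \<rho> \<omega>. \<omega> \<in> A \<pi> \<Longrightarrow> \<omega> \<in> A \<rho> \<Longrightarrow> \<pi> = \<rho>"
    and cover: "AE \<omega> in M. \<exists>\<pi>. \<pi> permutes {1..n} \<and> \<omega> \<in> A \<pi>"
    and swap: "\<And>\<pi> k. \<pi> permutes {1..n} \<Longrightarrow> k \<in> {1..<n} \<Longrightarrow>
                 prob (A (Transposition.transpose k (Suc k) \<circ> \<pi>)) = prob (A \<pi>)"
begin

lemma disjoint_family: "disjoint_family_on A S"
  unfolding disjoint_family_on_def by (blast dest: disjoint)

text \<open>Adjacent transpositions generate all transpositions, by conjugation.\<close>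

lemma prob_transpose:
  assumes "\<pi> permutes {1..n}" "1 \<le> a" "a < b" "b \<le> n"
  shows "prob (A (Transposition.transpose a b \<circ> \<pi>)) = prob (A \<pi>)"
  using assms(3,4,1)
proof (induction "b - Suc a" arbitrary: b \<pi>)
  case 0
  then have "b = Suc a" by simp
  with 0 assms(2) show ?case using swap[of \<pi> a] by (simp add: o_def)
next
  case (Suc m)
  have c: "b = Suc (b - 1)" "a < b - 1"
    using Suc.hyps(2) Suc.prems(1) by auto
  define c where "c = b - 1"
  note c = c[folded c_def]
  have perm_c: "Transposition.transpose c (Suc c) permutes {1..n}" "Transposition.transpose a c permutes {1..n}"
    using Suc.prems assms(2) c by (auto intro!: permutes_swap_id)
  \<comment> \<open>\<open>(a b) = (c b) (a c) (c b)\<close> with \<open>b = c + 1\<close>.\<close>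
  have eq: "Transposition.transpose a b \<circ> \<pi> =
        Transposition.transpose c (Suc c) \<circ> (Transposition.transpose a c \<circ> (Transposition.transpose c (Suc c) \<circ> \<pi>))"
  proof
    fix i
    have "b \<noteq> a" "c \<noteq> a" using c by auto
    from transpose_triple[OF this, of "\<pi> i"]
    show "(Transposition.transpose a b \<circ> \<pi>) i =
      (Transposition.transpose c (Suc c) \<circ> (Transposition.transpose a c \<circ> (Transposition.transpose c (Suc c) \<circ> \<pi>))) i"
      unfolding c(1) o_apply
      by (simp only: Transposition.transpose_commute[of c a]
          Transposition.transpose_commute[of "Suc c" a] Transposition.transpose_commute[of "Suc c" c])
  qed
  have "prob (A (Transposition.transpose a b \<circ> \<pi>)) = prob (A (Transposition.transpose a c \<circ> (Transposition.transpose c (Suc c) \<circ> \<pi>)))"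
    unfolding eq using Suc.prems assms(2) c perm_c by (intro swap permutes_compose) auto
  also have "\<dots> = prob (A (Transposition.transpose c (Suc c) \<circ> \<pi>))"
    using Suc.prems Suc.hyps(2) c perm_c by (intro Suc.hyps(1) permutes_compose) auto
  also have "\<dots> = prob (A \<pi>)"
    using Suc.prems assms(2) c by (intro swap) auto
  finally show ?case .
qed

text \<open>The \<open>n!\<close> events have the same probability, since transpositions generate the symmetric group, and
  they partition the space up to a null set.\<close>

lemma prob_order:
  assumes "\<pi> permutes {1..n}"
  shows "prob (A \<pi>) = 1 / fact n"
proof -
  have same: "prob (A \<rho>) = prob (A id)" if "\<rho> permutes {1..n}" for \<rho>
    using that finite_atLeastAtMost
  proof (induction rule: permutes_induct)
    case (swap a b \<rho>)
    show ?case
    proof (cases "a < b")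
      case True
      then show ?thesis using prob_transpose[of \<rho> a b] swap by (auto simp: o_def)
    next
      case False
      then show ?thesis
        using prob_transpose[of \<rho> b a] swap by (auto simp: o_def Transposition.transpose_commute)
    qed
  qed simp
  let ?S = "{\<rho>. \<rho> permutes {1..n}}"
  have fin: "finite ?S" by (simp add: finite_permutations)
  have "1 = prob (\<Union>\<rho>\<in>?S. A \<rho>)"
    using cover fin events by (intro prob_eq_1[THEN iffD2, symmetric] sets.finite_UN) auto
  also have "\<dots> = (\<Sum>\<rho>\<in>?S. prob (A \<rho>))"
    using fin events disjoint_family by (intro finite_measure_finite_Union) auto
  also have "\<dots> = (\<Sum>\<rho>\<in>?S. prob (A \<pi>))"
    by (intro sum.cong refl) (simp only: same[OF assms] mem_Collect_eq, rule same)
  also have "\<dots> = fact n * prob (A \<pi>)"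
    by (simp add: card_permutations[OF refl])
  finally show ?thesis by (simp add: field_simps)
qed

lemma prob_order_functional:
  assumes [measurable]: "Y \<in> borel_measurable M" "S \<in> sets borel"
    and Y: "\<And>\<pi> \<omega>. \<pi> permutes {1..n} \<Longrightarrow> \<omega> \<in> A \<pi> \<Longrightarrow> Y \<omega> = g \<pi>"
  shows "prob {\<omega> \<in> space M. Y \<omega> \<in> S} = card {\<pi>. \<pi> permutes {1..n} \<and> g \<pi> \<in> S} / fact n"
proof -
  let ?S = "{\<pi>. \<pi> permutes {1..n} \<and> g \<pi> \<in> S}"
  have fin: "finite ?S" by (rule finite_subset[OF _ finite_permutations[of "{1..n}"]]) auto
  have "prob {\<omega> \<in> space M. Y \<omega> \<in> S} = prob (\<Union>\<pi>\<in>?S. A \<pi>)"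
  proof (rule finite_measure_eq_AE)
    show "AE \<omega> in M. \<omega> \<in> {\<omega> \<in> space M. Y \<omega> \<in> S} \<longleftrightarrow> \<omega> \<in> (\<Union>\<pi>\<in>?S. A \<pi>)"
      using cover
    proof eventually_elim
      case (elim \<omega>)
      then obtain \<pi> where \<pi>: "\<pi> permutes {1..n}" "\<omega> \<in> A \<pi>" by auto
      then have "\<omega> \<in> space M" using events sets.sets_into_space by blast
      moreover have "\<omega> \<in> (\<Union>\<pi>\<in>?S. A \<pi>) \<longleftrightarrow> \<pi> \<in> ?S"
        using \<pi> by (blast dest: disjoint)
      moreover have "Y \<omega> = g \<pi>" by (rule Y[OF \<pi>])
      ultimately show ?case using \<pi>(1) by simp
    qed
    show "{\<omega> \<in> space M. Y \<omega> \<in> S} \<in> events" by measurable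
    show "(\<Union>\<pi>\<in>?S. A \<pi>) \<in> events"
      using fin events by (intro sets.finite_UN) auto
  qed
  also have "\<dots> = (\<Sum>\<pi>\<in>?S. prob (A \<pi>))"
    using fin events disjoint_family by (intro finite_measure_finite_Union) auto
  also have "\<dots> = (\<Sum>\<pi>\<in>?S. 1 / fact n)"
    by (intro sum.cong refl prob_order) simp
  finally show ?thesis by simp
qed

end

text \<open>Two statistics that are the same function of two uniformly random orders have the same law, whatever
  the joint law of these orders.\<close>

lemma distr_eq_order_functional:
  assumes "order_events M n A" "order_events M n B"
    and [measurable]: "Y \<in> borel_measurable M" "Z \<in> borel_measurable M"
    and Y: "\<And>\<pi> \<omega>. \<pi> permutes {1..n} \<Longrightarrow> \<omega> \<in> A \<pi> \<Longrightarrow> Y \<omega> = g \<pi>"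
    and Z: "\<And>\<pi> \<omega>. \<pi> permutes {1..n} \<Longrightarrow> \<omega> \<in> B \<pi> \<Longrightarrow> Z \<omega> = g \<pi>"
  shows "distr M borel Y = distr M borel (Z :: _ \<Rightarrow> real)"
proof (rule measure_eqI)
  interpret A: order_events M n A by fact
  interpret B: order_events M n B by fact
  fix S assume "S \<in> sets (distr M borel Y)"
  then have [measurable]: "S \<in> sets borel" by simp
  have "A.prob {\<omega> \<in> space M. Y \<omega> \<in> S} = card {\<pi>. \<pi> permutes {1..n} \<and> g \<pi> \<in> S} / fact n"
    by (rule A.prob_order_functional) (fact | rule Y)+
  also have "\<dots> = A.prob {\<omega> \<in> space M. Z \<omega> \<in> S}"
    by (rule B.prob_order_functional[symmetric]) (fact | rule Z)+
  finally have "A.prob {\<omega> \<in> space M. Y \<omega> \<in> S} = A.prob {\<omega> \<in> space M. Z \<omega> \<in> S}" .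
  then show "emeasure (distr M borel Y) S = emeasure (distr M borel Z) S"
    by (simp add: emeasure_distr A.emeasure_eq_measure vimage_def Int_def conj_commute)
qed simp

section \<open>Independent uniform locations\<close>

text \<open>This single condition excludes coinciding points (take \<open>b = c\<close>) as well as coinciding spacings: an
  equality of two spacings expresses the rightmost of the points concerned by others.\<close>

definition generic :: "(nat \<Rightarrow> real) \<Rightarrow> bool" where
  "generic x \<longleftrightarrow> (\<forall>i\<ge>1. \<forall>a\<ge>1. \<forall>b\<ge>1. \<forall>c\<ge>1. i \<notin> {a, b, c} \<longrightarrow> x i \<noteq> x a + x b - x c)"

lemma generic_inj_on:
  assumes "generic x"
  shows "inj_on x {1..N}"
proof (rule inj_onI, rule ccontr)
  fix i j assume "i \<in> {1..N}" "j \<in> {1..N}" "x i = x j" "i \<noteq> j"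
  with assms[unfolded generic_def, rule_format, of i j j j] show False by auto
qed

lemma generic_inj_on_spacing:
  assumes "generic x" and \<sigma>: "\<sigma> permutes {1..N}"
  shows "inj_on (spacing x \<sigma>) {1..N - 1}"
proof -
  have "spacing x \<sigma> k \<noteq> spacing x \<sigma> l" if kl: "k \<in> {1..N - 1}" "l \<in> {1..N - 1}" "k < l" for k l
  proof -
    have "\<sigma> (Suc l) \<notin> {\<sigma> l, \<sigma> (Suc k), \<sigma> k}"
      using kl by (simp add: inj_eq[OF permutes_inj[OF \<sigma>]])
    moreover have "1 \<le> \<sigma> i" if "i \<in> {1..N}" for i
      using permutes_in_range[OF \<sigma> that] by simp
    then have "1 \<le> \<sigma> (Suc l)" "1 \<le> \<sigma> l" "1 \<le> \<sigma> (Suc k)" "1 \<le> \<sigma> k"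
      using kl by auto
    ultimately have "x (\<sigma> (Suc l)) \<noteq> x (\<sigma> l) + x (\<sigma> (Suc k)) - x (\<sigma> k)"
      using assms(1) unfolding generic_def by blast
    then show ?thesis by (simp add: spacing_def)
  qed
  note neq = this
  show ?thesis
  proof (rule inj_onI, rule ccontr)
    fix k l assume kl: "k \<in> {1..N - 1}" "l \<in> {1..N - 1}" "spacing x \<sigma> k = spacing x \<sigma> l" "k \<noteq> l"
    then consider "k < l" | "l < k" by linarith
    then show False using neq[of k l] neq[of l k] kl by cases simp_all
  qed
qed

locale uniform_locations = prob_space M for M :: "'a measure" +
  fixes X :: "nat \<Rightarrow> 'a \<Rightarrow> real"
  assumes indep: "indep_vars (\<lambda>_. borel) X {1..}"
    and uniform: "\<And>i. 1 \<le> i \<Longrightarrow> distr M borel (X i) = uniform_measure lborel {0..1}"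
begin

lemma X_measurable[measurable]: "1 \<le> i \<Longrightarrow> X i \<in> borel_measurable M"
  using indep by (auto simp: indep_vars_def)

text \<open>The common source of exchangeability (\<open>f\<close> a permutation) and of stationarity (\<open>f\<close> a shift).\<close>

lemma distr_window:
  assumes "K \<noteq> {}" "inj_on f K" "f ` K \<subseteq> {1..}"
  shows "distr M (PiM K (\<lambda>_. borel)) (\<lambda>\<omega>. \<lambda>i\<in>K. X (f i) \<omega>) =
           PiM K (\<lambda>_. uniform_measure lborel {0..1})"
proof -
  have "indep_vars (\<lambda>j. PiM {f j} (\<lambda>_. borel)) (\<lambda>j \<omega>. \<lambda>i\<in>{f j}. X i \<omega>) K"
    using assms by (intro indep_vars_restrict[OF indep])
      (auto simp: disjoint_family_on_def inj_on_def)
  from indep_vars_compose2[OF this, where Y = "\<lambda>j g. g (f j)" and N = "\<lambda>_. borel"]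
  have "indep_vars (\<lambda>_. borel) (\<lambda>j \<omega>. X (f j) \<omega>) K" by simp
  moreover have "X (f i) \<in> borel_measurable M" if "i \<in> K" for i
    using that assms(3) by (intro X_measurable) auto
  ultimately have "distr M (PiM K (\<lambda>_. borel)) (\<lambda>\<omega>. \<lambda>i\<in>K. X (f i) \<omega>) =
      PiM K (\<lambda>i. distr M borel (X (f i)))"
    using indep_vars_iff_distr_eq_PiM'[OF assms(1), where M' = "\<lambda>_. borel" and X = "\<lambda>i. X (f i)"]
    by blast
  also have "\<dots> = PiM K (\<lambda>_. uniform_measure lborel {0..1})"
    using assms(3) by (intro PiM_cong) (auto intro!: uniform)
  finally show ?thesis .
qed

lemma prob_window:
  assumes "K \<noteq> {}" "inj_on f K" "f ` K \<subseteq> {1..}"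
    and Q: "Measurable.pred (PiM K (\<lambda>_. borel)) Q"
  shows "prob {\<omega> \<in> space M. Q (\<lambda>i\<in>K. X (f i) \<omega>)} =
           measure (PiM K (\<lambda>_. uniform_measure lborel {0..1})) {x \<in> space (PiM K (\<lambda>_. borel)). Q x}"
proof -
  have m: "(\<lambda>\<omega>. \<lambda>i\<in>K. X (f i) \<omega>) \<in> measurable M (PiM K (\<lambda>_. borel))"
    using assms(3) by (intro measurable_restrict X_measurable) auto
  have "measure (distr M (PiM K (\<lambda>_. borel)) (\<lambda>\<omega>. \<lambda>i\<in>K. X (f i) \<omega>))
          {x \<in> space (PiM K (\<lambda>_. borel)). Q x} =
        prob ((\<lambda>\<omega>. \<lambda>i\<in>K. X (f i) \<omega>) -` {x \<in> space (PiM K (\<lambda>_. borel)). Q x} \<inter> space M)"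
    using Q by (intro measure_distr[OF m]) auto
  also have "(\<lambda>\<omega>. \<lambda>i\<in>K. X (f i) \<omega>) -` {x \<in> space (PiM K (\<lambda>_. borel)). Q x} \<inter> space M =
             {\<omega> \<in> space M. Q (\<lambda>i\<in>K. X (f i) \<omega>)}"
    using measurable_space[OF m] by auto
  finally show ?thesis by (simp only: distr_window[OF assms(1-3)])
qed

lemma indep_windows:
  assumes "disjoint_family_on K J" "\<And>j. j \<in> J \<Longrightarrow> K j \<subseteq> {1..}"
    and F: "\<And>j. j \<in> J \<Longrightarrow> F j \<in> borel_measurable (PiM (K j) (\<lambda>_. borel))"
  shows "indep_vars (\<lambda>_. borel) (\<lambda>j \<omega>. F j (\<lambda>i\<in>K j. X i \<omega>)) J"
  by (intro indep_vars_compose2[OF indep_vars_restrict[OF indep assms(2,1)]] F)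

text \<open>Given the other locations involved, \<open>X i\<close> would have to hit a single point, which has Lebesgue measure zero.\<close>

lemma AE_generic: "AE \<omega> in M. generic (\<lambda>i. X i \<omega>)"
proof -
  have "AE \<omega> in M. X i \<omega> \<noteq> X a \<omega> + X b \<omega> - X c \<omega>"
    if "1 \<le> i" "1 \<le> a" "1 \<le> b" "1 \<le> c" "i \<notin> {a, b, c}" for i a b c
  proof -
    let ?V = "\<lambda>\<omega>. X a \<omega> + X b \<omega> - X c \<omega>"
    have [measurable]: "X i \<in> borel_measurable M" "?V \<in> borel_measurable M"
      using that by auto
    have "indep_var (PiM {i} (\<lambda>_. borel)) (\<lambda>\<omega>. \<lambda>k\<in>{i}. X k \<omega>)
                    (PiM {a, b, c} (\<lambda>_. borel)) (\<lambda>\<omega>. \<lambda>k\<in>{a, b, c}. X k \<omega>)"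
      using that by (intro indep_var_restrict[OF indep]) auto
    from indep_var_compose[OF this, of "\<lambda>x. x i" borel "\<lambda>x. x a + x b - x c" borel]
    have "indep_var borel (X i) borel ?V" by (simp add: comp_def)
    then have pair: "distr M (borel \<Otimes>\<^sub>M borel) (\<lambda>\<omega>. (X i \<omega>, ?V \<omega>)) =
        distr M borel (X i) \<Otimes>\<^sub>M distr M borel ?V"
      by (simp add: indep_var_distribution_eq)
    interpret D1: prob_space "distr M borel (X i)" by (rule prob_space_distr) simp
    interpret D2: prob_space "distr M borel ?V" by (rule prob_space_distr) simp
    interpret P: pair_sigma_finite "distr M borel (X i)" "distr M borel ?V" ..
    let ?D = "{z :: real \<times> real. fst z = snd z}"
    have D: "?D \<in> sets (borel \<Otimes>\<^sub>M borel)"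
    proof -
      have "{z \<in> space (borel \<Otimes>\<^sub>M borel). fst z = (snd z :: real)} \<in> sets (borel \<Otimes>\<^sub>M borel)"
        by measurable
      then show ?thesis by (simp add: space_pair_measure)
    qed
    have "emeasure M {\<omega> \<in> space M. X i \<omega> = ?V \<omega>} =
          emeasure (distr M (borel \<Otimes>\<^sub>M borel) (\<lambda>\<omega>. (X i \<omega>, ?V \<omega>))) ?D"
      using D by (subst emeasure_distr) (auto intro!: arg_cong[of _ _ "emeasure M"])
    also have "\<dots> = (\<integral>\<^sup>+ v. emeasure (distr M borel (X i)) ((\<lambda>u. (u, v)) -` ?D) \<partial>distr M borel ?V)"
      unfolding pair by (rule P.emeasure_pair_measure_alt2) (use D in simp)
    also have "\<dots> = (\<integral>\<^sup>+ v. 0 \<partial>distr M borel ?V)"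
    proof (rule nn_integral_cong)
      fix v :: real
      have "(\<lambda>u. (u, v)) -` ?D = {v}" by auto
      moreover have "emeasure lborel ({0..1} \<inter> {v}) = 0"
        by (rule emeasure_lborel_countable) (auto intro: countable_subset)
      ultimately show "emeasure (distr M borel (X i)) ((\<lambda>u. (u, v)) -` ?D) = 0"
        by (simp add: uniform[OF that(1)])
    qed
    finally have "emeasure M {\<omega> \<in> space M. X i \<omega> = ?V \<omega>} = 0" by simp
    then show ?thesis by (subst AE_iff_measurable[OF _ refl]) auto
  qed
  then have "AE \<omega> in M. \<forall>i a b c. 1 \<le> i \<longrightarrow> 1 \<le> a \<longrightarrow> 1 \<le> b \<longrightarrow> 1 \<le> c \<longrightarrow> i \<notin> {a, b, c} \<longrightarrow>
      X i \<omega> \<noteq> X a \<omega> + X b \<omega> - X c \<omega>"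
    by (simp only: AE_all_countable AE_impI) (auto intro!: AE_I2)
  then show ?thesis by (simp add: generic_def) 
qed

end

section \<open>The order of the spacings is uniform\<close>

text \<open>Reflection in the midpoint of \<open>a\<close> and \<open>b\<close> preserves Lebesgue measure; the functions vanish outside
  \<open>{a<..<b}\<close>, so the cut-off at the end points of the unit interval is not felt.\<close>

lemma nn_integral_uniform_reflect:
  fixes h :: "real \<Rightarrow> ennreal"
  assumes [measurable]: "h \<in> borel_measurable borel" "h' \<in> borel_measurable borel"
    and ab: "0 \<le> a" "b \<le> 1"
    and supp: "\<And>u. h u \<noteq> 0 \<Longrightarrow> a < u \<and> u < b" "\<And>u. h' u \<noteq> 0 \<Longrightarrow> a < u \<and> u < b"
    and refl: "\<And>u. a < u \<Longrightarrow> u < b \<Longrightarrow> h (a + b - u) = h' u"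
  shows "(\<integral>\<^sup>+u. h u \<partial>uniform_measure lborel {0..1::real}) = (\<integral>\<^sup>+u. h' u \<partial>uniform_measure lborel {0..1})"
proof -
  have restrict: "(\<integral>\<^sup>+u. k u \<partial>uniform_measure lborel {0..1::real}) = (\<integral>\<^sup>+u. k u \<partial>lborel)"
    if [measurable]: "k \<in> borel_measurable borel" and k: "\<And>u. k u \<noteq> 0 \<Longrightarrow> a < u \<and> u < b"
    for k :: "real \<Rightarrow> ennreal"
  proof -
    have "(\<integral>\<^sup>+u. k u \<partial>uniform_measure lborel {0..1::real}) =
          (\<integral>\<^sup>+u. k u * indicator {0..1} u \<partial>lborel)"
      by (subst nn_integral_uniform_measure) (auto simp: divide_ennreal_def)
    also have "\<dots> = (\<integral>\<^sup>+u. k u \<partial>lborel)"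
    proof (rule nn_integral_cong)
      fix u
      show "k u * indicator {0..1} u = k u"
        using k[of u] ab by (cases "k u = 0") auto
    qed
    finally show ?thesis .
  qed
  have "(\<integral>\<^sup>+u. h u \<partial>uniform_measure lborel {0..1}) = (\<integral>\<^sup>+u. h u \<partial>lborel)"
    by (rule restrict) (rule assms(1), erule supp(1))
  also have "\<dots> = (\<integral>\<^sup>+u. h (a + b - u) \<partial>lborel)"
    using nn_integral_real_affine[of h "-1" "a + b"] by simp
  also have "\<dots> = (\<integral>\<^sup>+u. h' u \<partial>lborel)"
  proof (rule nn_integral_cong)
    fix u
    show "h (a + b - u) = h' u"
    proof (cases "a < u \<and> u < b")
      case False
      then have "h (a + b - u) = 0" "h' u = 0"
        using supp(1)[of "a + b - u"] supp(2)[of u] by auto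
      then show ?thesis by simp
    qed (simp add: refl)
  qed
  also have "\<dots> = (\<integral>\<^sup>+u. h' u \<partial>uniform_measure lborel {0..1})"
    by (rule restrict[symmetric]) (rule assms(2), erule supp(2))
  finally show ?thesis .
qed

text \<open>By Fubini's theorem the reflection can be performed in coordinate \<open>j\<close> with all the others fixed.\<close>

lemma measure_PiM_uniform_reflect:
  fixes E F :: "('i \<Rightarrow> real) set"
  defines "P \<equiv> \<lambda>J. PiM J (\<lambda>_. uniform_measure lborel {0..1::real})"
  assumes I: "finite I" "j \<in> I" "a \<in> I - {j}" "b \<in> I - {j}"
    and E: "E \<in> sets (P I)" and F: "F \<in> sets (P I)"
    and E_between: "\<And>x. x \<in> E \<Longrightarrow> x a < x j \<and> x j < x b"
    and F_between: "\<And>x. x \<in> F \<Longrightarrow> x a < x j \<and> x j < x b"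
    and refl: "\<And>x. x \<in> space (P I) \<Longrightarrow> x a < x j \<Longrightarrow> x j < x b \<Longrightarrow>
                 x(j := x a + x b - x j) \<in> E \<longleftrightarrow> x \<in> F"
  shows "measure (P I) E = measure (P I) F"
proof -
  have U: "prob_space (uniform_measure lborel {0..1::real})"
    by (rule prob_space_uniform_measure) auto
  interpret product_prob_space "\<lambda>_ :: 'i. uniform_measure lborel {0..1::real}"
    by (intro product_prob_spaceI U)
  define J where "J = I - {j}"
  have J: "I = insert j J" "finite J" "j \<notin> J" "a \<in> J" "b \<in> J"
    using I by (auto simp: J_def)
  have AE01: "AE z in P J. z i \<in> {0..1}" if "i \<in> J" for i
    unfolding P_def
    by (rule AE_PiM_component[OF U that]) (auto intro!: AE_uniform_measureI)
  have fib: "(\<lambda>u. indicator G (z(j := u)) :: ennreal) \<in> borel_measurable borel"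
    if "G \<in> sets (P I)" "z \<in> space (P J)" for G z
  proof -
    have "(\<lambda>u. z(j := u)) \<in> measurable (uniform_measure lborel {0..1::real}) (P I)"
      using that(2) unfolding P_def J(1)
      by (intro measurable_fun_upd[where J = J]) auto
    then have "(\<lambda>u. z(j := u)) \<in> measurable borel (P I)"
      by (simp add: measurable_def)
    from measurable_comp[OF this borel_measurable_indicator[OF that(1)]]
    show ?thesis by (simp add: comp_def)
  qed
  have fubini: "emeasure (P I) G =
      (\<integral>\<^sup>+z. (\<integral>\<^sup>+u. indicator G (z(j := u)) \<partial>uniform_measure lborel {0..1}) \<partial>P J)"
    if "G \<in> sets (P I)" for G
    using that J product_nn_integral_insert[of J j "indicator G"]
    by (simp add: P_def flip: nn_integral_indicator)
  have "emeasure (P I) E = emeasure (P I) F"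
    unfolding fubini[OF E] fubini[OF F]
  proof (rule nn_integral_cong_AE)
    show "AE z in P J. (\<integral>\<^sup>+u. indicator E (z(j := u)) \<partial>uniform_measure lborel {0..1}) =
                       (\<integral>\<^sup>+u. indicator F (z(j := u)) \<partial>uniform_measure lborel {0..1})"
      using AE01[OF J(4)] AE01[OF J(5)] AE_space
    proof eventually_elim
      case (elim z)
      have neq: "a \<noteq> j" "b \<noteq> j" using I by auto
      show ?case
      proof (rule nn_integral_uniform_reflect[where a = "z a" and b = "z b"])
        show "(\<lambda>u. indicator E (z(j := u)) :: ennreal) \<in> borel_measurable borel"
          "(\<lambda>u. indicator F (z(j := u)) :: ennreal) \<in> borel_measurable borel"
          using fib E F elim(3) by auto
        show "z a < u \<and> u < z b" if "(indicator E (z(j := u)) :: ennreal) \<noteq> 0" for u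
          using that E_between[of "z(j := u)"] neq by (auto split: split_indicator_asm)
        show "z a < u \<and> u < z b" if "(indicator F (z(j := u)) :: ennreal) \<noteq> 0" for u
          using that F_between[of "z(j := u)"] neq by (auto split: split_indicator_asm)
        fix u assume u: "z a < u" "u < z b"
        have "z(j := u) \<in> space (P I)"
          using elim(3) J by (auto simp: P_def space_PiM PiE_def extensional_def)
        from refl[OF this] u neq
        show "(indicator E (z(j := z a + z b - u)) :: ennreal) = indicator F (z(j := u))"
          by (simp add: indicator_def)
      qed (use elim in auto)
    qed
  qed
  then show ?thesis by (simp add: measure_def)
qed

lemma sorts_iff_spacing_pos:
  "sorts \<sigma> N x \<longleftrightarrow> \<sigma> permutes {1..N} \<and> (\<forall>k\<in>{1..N - 1}. 0 < spacing x \<sigma> k)"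
proof -
  have "{1..<N} = {1..N - 1}" by auto
  then show ?thesis by (simp add: sorts_def spacing_def)
qed

text \<open>Reflecting the middle one of three consecutive points in the midpoint of the outer two exchanges the
  two spacings that it separates and leaves all others unchanged.\<close>

lemma spacing_reflect:
  assumes \<sigma>: "\<sigma> permutes {1..N}" and k: "k \<in> {1..<N - 1}" and i: "i \<in> {1..N - 1}"
  defines "j \<equiv> \<sigma> (Suc k)"
  shows "spacing (x(j := x (\<sigma> k) + x (\<sigma> (Suc (Suc k))) - x j)) \<sigma> i =
         spacing x \<sigma> (Transposition.transpose k (Suc k) i)"
proof -
  have inj: "\<sigma> a = \<sigma> b \<longleftrightarrow> a = b" for a b
    using permutes_inj[OF \<sigma>] by (auto dest: injD)
  consider "i = k" | "i = Suc k" | "i \<noteq> k" "i \<noteq> Suc k" by blast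
  then show ?thesis
    by cases (auto simp: spacing_def j_def inj Transposition.transpose_def)
qed

text \<open>The joint event of the order \<open>\<sigma>\<close> of the points and the order \<open>\<pi>\<close> of their spacings.  Fixing \<open>\<sigma>\<close> makes
  the point to be reflected a fixed coordinate.\<close>

definition spacing_order :: "nat \<Rightarrow> (nat \<Rightarrow> nat) \<Rightarrow> (nat \<Rightarrow> nat) \<Rightarrow> (nat \<Rightarrow> real) \<Rightarrow> bool" where
  "spacing_order N \<sigma> \<pi> x \<longleftrightarrow> sorts \<sigma> N x \<and> sorts \<pi> (N - 1) (spacing x \<sigma>)"

lemma spacing_order_reflect:
  assumes \<sigma>: "\<sigma> permutes {1..N}" and \<pi>: "\<pi> permutes {1..N - 1}" and k: "k \<in> {1..<N - 1}"
  defines "j \<equiv> \<sigma> (Suc k)"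
  shows "spacing_order N \<sigma> \<pi> (x(j := x (\<sigma> k) + x (\<sigma> (Suc (Suc k))) - x j)) \<longleftrightarrow>
         spacing_order N \<sigma> (Transposition.transpose k (Suc k) \<circ> \<pi>) x"
proof -
  let ?y = "x(j := x (\<sigma> k) + x (\<sigma> (Suc (Suc k))) - x j)"
  let ?t = "Transposition.transpose k (Suc k)"
  have t: "?t permutes {1..N - 1}" using k by (intro permutes_swap_id) auto
  have sp: "spacing ?y \<sigma> i = (spacing x \<sigma> \<circ> ?t) i" if "i \<in> {1..N - 1}" for i
    using spacing_reflect[OF \<sigma> k that] by (simp add: j_def)
  have "(\<forall>i\<in>{1..N - 1}. 0 < spacing ?y \<sigma> i) \<longleftrightarrow> (\<forall>i\<in>?t ` {1..N - 1}. 0 < spacing x \<sigma> i)"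
    using sp by simp
  also have "?t ` {1..N - 1} = {1..N - 1}" by (rule permutes_image[OF t])
  finally have "sorts \<sigma> N ?y \<longleftrightarrow> sorts \<sigma> N x"
    by (simp only: sorts_iff_spacing_pos)
  moreover have "sorts \<pi> (N - 1) (spacing ?y \<sigma>) \<longleftrightarrow> sorts \<pi> (N - 1) (spacing x \<sigma> \<circ> ?t)"
    by (rule sorts_cong) (rule sp)
  moreover have "sorts (?t \<circ> \<pi>) (N - 1) (spacing x \<sigma>) \<longleftrightarrow> sorts \<pi> (N - 1) (spacing x \<sigma> \<circ> ?t)"
    by (rule sorts_transpose[OF \<pi> k])
  ultimately show ?thesis by (simp only: spacing_order_def)
qed

lemma pred_sorts:
  assumes "\<And>i. i \<in> {1..n} \<Longrightarrow> (\<lambda>\<omega>. D \<omega> i) \<in> borel_measurable M"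
  shows "Measurable.pred M (\<lambda>\<omega>. sorts \<pi> n (D \<omega>))"
proof (cases "\<pi> permutes {1..n}")
  case True
  have [measurable]: "Measurable.pred M (\<lambda>\<omega>. D \<omega> (\<pi> k) < D \<omega> (\<pi> (Suc k)))" if "k \<in> {1..<n}" for k
  proof -
    have [measurable]: "(\<lambda>\<omega>. D \<omega> (\<pi> k)) \<in> borel_measurable M" "(\<lambda>\<omega>. D \<omega> (\<pi> (Suc k))) \<in> borel_measurable M"
      using that permutes_in_range[OF True] by (auto intro!: assms)
    show ?thesis by measurable
  qed
  show ?thesis
    using True unfolding sorts_def by simp
qed (simp add: sorts_def)

section \<open>Measurability\<close>

lemma measurable_real_card:
  assumes "finite I" and "\<And>i. i \<in> I \<Longrightarrow> Measurable.pred M (P i)"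
  shows "(\<lambda>\<omega>. real (card {i \<in> I. P i \<omega>})) \<in> borel_measurable M"
proof -
  have "real (card {i \<in> I. P i \<omega>}) = (\<Sum>i\<in>I. of_bool (P i \<omega>))" for \<omega>
    by (rule sum_of_bool_eq_card[OF assms(1), symmetric])
  moreover have "(\<lambda>\<omega>. of_bool (P i \<omega>) :: real) \<in> borel_measurable M" if "i \<in> I" for i
  proof -
    have [measurable]: "Measurable.pred M (P i)" by (rule assms(2)[OF that])
    have "(\<lambda>\<omega>. if P i \<omega> then 1 else 0 :: real) \<in> borel_measurable M" by measurable
    then show ?thesis by (simp add: of_bool_def)
  qed
  ultimately show ?thesis by (simp only: borel_measurable_sum)
qed

lemma arg_min_on_eq_SOME: "arg_min_on f S = (SOME j. j \<in> {j \<in> S. \<forall>k\<in>S. \<not> f k < f j})"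
  unfolding arg_min_on_def arg_min_def is_arg_min_def
  by (rule arg_cong[where f = Eps]) auto

text \<open>Ties are broken by an unspecified choice, but this choice is a function of the set of minimisers,
  which takes only finitely many values.\<close>

lemma measurable_nearest_neighbour:
  assumes x: "\<And>i. i \<in> {1..N} \<Longrightarrow> (\<lambda>\<omega>. x i \<omega>) \<in> borel_measurable M" and i: "i \<in> {1..N}"
  shows "(\<lambda>\<omega>. nearest_neighbour (\<lambda>i. x i \<omega>) N i) \<in> measurable M (count_space UNIV)"
proof -
  define S where "S = {1..N} - {i}"
  define Q where "Q j \<omega> \<longleftrightarrow> (\<forall>k\<in>S. \<not> dist (x i \<omega>) (x k \<omega>) < dist (x i \<omega>) (x j \<omega>))" for j \<omega>
  define m where "m \<omega> = {j \<in> S. Q j \<omega>}" for \<omega>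
  have fin: "finite S" by (simp add: S_def)
  have nn: "nearest_neighbour (\<lambda>i. x i \<omega>) N i = (SOME j. j \<in> m \<omega>)" for \<omega>
    unfolding nearest_neighbour_def m_def Q_def S_def by (rule arg_min_on_eq_SOME)
  have Q: "Measurable.pred M (Q j)" if "j \<in> S" for j
    unfolding Q_def
  proof (rule pred_intros_finite(3)[OF fin])
    fix k assume "k \<in> S"
    then have [measurable]: "x i \<in> borel_measurable M" "x j \<in> borel_measurable M"
      "x k \<in> borel_measurable M"
      using x i that by (simp_all add: S_def)
    show "Measurable.pred M (\<lambda>\<omega>. \<not> dist (x i \<omega>) (x k \<omega>) < dist (x i \<omega>) (x j \<omega>))"
      by measurable
  qed
  have "m \<in> measurable M (count_space (Pow S))"
  proof (subst measurable_count_space_eq2)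
    show "finite (Pow S)" using fin by simp
    have "m -` {B} \<inter> space M \<in> sets M" if "B \<in> Pow S" for B
    proof -
      have "m \<omega> = B \<longleftrightarrow> (\<forall>j\<in>S. (j \<in> B) = Q j \<omega>)" for \<omega>
        using that unfolding m_def by blast
      then have "m -` {B} \<inter> space M = {\<omega> \<in> space M. \<forall>j\<in>S. (j \<in> B) = Q j \<omega>}"
        by blast
      moreover have "Measurable.pred M (\<lambda>\<omega>. \<forall>j\<in>S. (j \<in> B) = Q j \<omega>)"
      proof (rule pred_intros_finite(3)[OF fin])
        fix j assume "j \<in> S"
        from Q[OF this] show "Measurable.pred M (\<lambda>\<omega>. (j \<in> B) = Q j \<omega>)"
          by (cases "j \<in> B") simp_all
      qed
      moreover from this have "{\<omega> \<in> space M. \<forall>j\<in>S. (j \<in> B) = Q j \<omega>} \<in> sets M" by (simp add: pred_def)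
      ultimately show ?thesis by (simp only:)
    qed
    then show "m \<in> space M \<rightarrow> Pow S \<and> (\<forall>B\<in>Pow S. m -` {B} \<inter> space M \<in> sets M)"
      by (auto simp: m_def)
  qed
  then have "(\<lambda>\<omega>. SOME j. j \<in> m \<omega>) \<in> measurable M (count_space UNIV)"
    by (rule measurable_compose) simp
  then show ?thesis by (simp add: nn)
qed

lemma measurable_overloaded_fraction:
  assumes x: "\<And>i. i \<in> {1..N} \<Longrightarrow> (\<lambda>\<omega>. x i \<omega>) \<in> borel_measurable M"
  shows "(\<lambda>\<omega>. overloaded_fraction lam mu p (\<lambda>i. x i \<omega>) N) \<in> borel_measurable M"
proof -
  have rate [measurable]:
    "(\<lambda>\<omega>. effective_rate lam p (\<lambda>i. x i \<omega>) N i) \<in> borel_measurable M" for i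
    unfolding effective_rate_def
  proof (intro borel_measurable_sum borel_measurable_times borel_measurable_const)
    fix j assume "j \<in> {1..N}"
    then have "(\<lambda>\<omega>. nearest_neighbour (\<lambda>i. x i \<omega>) N j) \<in> measurable M (count_space UNIV)"
      by (intro measurable_nearest_neighbour x)
    then show "(\<lambda>\<omega>. pmf (nns_choice p (\<lambda>i. x i \<omega>) N j) i) \<in> borel_measurable M"
      unfolding nns_choice_def
      by (rule measurable_compose) (rule borel_measurable_count_space)
  qed
  have "(\<lambda>\<omega>. real (card {i \<in> {1..N}. effective_rate lam p (\<lambda>i. x i \<omega>) N i > mu}))
      \<in> borel_measurable M"
  proof (rule measurable_real_card)
    fix i
    show "Measurable.pred M (\<lambda>\<omega>. mu < effective_rate lam p (\<lambda>i. x i \<omega>) N i)"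
      by measurable
  qed simp
  then show ?thesis
    unfolding overloaded_fraction_def by (rule borel_measurable_divide) (rule borel_measurable_const)
qed

lemma measurable_card_popular_ranks:
  assumes D: "\<And>i. i \<in> {1..n} \<Longrightarrow> (\<lambda>\<omega>. D \<omega> i) \<in> borel_measurable M"
  shows "(\<lambda>\<omega>. real (card (popular_ranks n (D \<omega>)))) \<in> borel_measurable M"
  unfolding popular_ranks_def
proof (rule measurable_real_card)
  fix k assume k: "k \<in> {2..n}"
  have [measurable]: "(\<lambda>\<omega>. D \<omega> k) \<in> borel_measurable M" using k by (intro D) auto
    have "Measurable.pred M (\<lambda>\<omega>. k = 2 \<or> \<not> D \<omega> (k - 2) < D \<omega> (k - 1))"
    proof (cases "k = 2")
      case False
      then have [measurable]: "(\<lambda>\<omega>. D \<omega> (k - 2)) \<in> borel_measurable M"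
        "(\<lambda>\<omega>. D \<omega> (k - 1)) \<in> borel_measurable M"
        using k by (auto intro!: D)
      show ?thesis by measurable
    qed simp
    moreover have "Measurable.pred M (\<lambda>\<omega>. k = n \<or> D \<omega> k < D \<omega> (Suc k))"
    proof (cases "k = n")
      case False
      then have [measurable]: "(\<lambda>\<omega>. D \<omega> (Suc k)) \<in> borel_measurable M"
        using k by (auto intro!: D)
      show ?thesis by measurable
    qed simp
    ultimately show "Measurable.pred M (\<lambda>\<omega>.
        (k = 2 \<or> \<not> D \<omega> (k - 2) < D \<omega> (k - 1)) \<and> (k = n \<or> D \<omega> k < D \<omega> (Suc k)))"
      by (rule pred_intros_logic)
qed simp

context uniform_locations
begin

lemma events_sorts:
  "(\<And>i. i \<in> {1..n} \<Longrightarrow> (\<lambda>\<omega>. D \<omega> i) \<in> borel_measurable M) \<Longrightarrow>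
     {\<omega> \<in> space M. sorts \<pi> n (D \<omega>)} \<in> events"
  using pred_sorts[of n D M \<pi>] by simp

lemma order_events_locations: "order_events M n (\<lambda>\<pi>. {\<omega> \<in> space M. sorts \<pi> n (\<lambda>i. X i \<omega>)})"
proof unfold_locales
  show "{\<omega> \<in> space M. sorts \<pi> n (\<lambda>i. X i \<omega>)} \<in> events" for \<pi>
    by (rule events_sorts) (auto intro: X_measurable)
  show "\<pi> = \<rho>" if "\<omega> \<in> {\<omega> \<in> space M. sorts \<pi> n (\<lambda>i. X i \<omega>)}"
    "\<omega> \<in> {\<omega> \<in> space M. sorts \<rho> n (\<lambda>i. X i \<omega>)}" for \<pi> \<rho> \<omega>
    using that by (auto intro: sorts_unique)
  show "AE \<omega> in M. \<exists>\<pi>. \<pi> permutes {1..n} \<and> \<omega> \<in> {\<omega> \<in> space M. sorts \<pi> n (\<lambda>i. X i \<omega>)}"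
    using AE_generic AE_space
  proof eventually_elim
    case (elim \<omega>)
    from sorts_exists[OF generic_inj_on[OF elim(1)], of n] obtain \<pi>
      where "sorts \<pi> n (\<lambda>i. X i \<omega>)" by blast
    with elim(2) show ?case by (blast dest: sorts_permutes)
  qed
  fix \<pi> k assume \<pi>: "\<pi> permutes {1..n}" and k: "k \<in> {1..<n}"
  let ?t = "Transposition.transpose k (Suc k)"
  have t: "?t permutes {1..n}" using k by (intro permutes_swap_id) auto
  have Q: "Measurable.pred (PiM {1..n} (\<lambda>_. borel)) (\<lambda>x. sorts \<pi> n x)"
    by (rule pred_sorts) simp
  have ne: "{1..n} \<noteq> {}" using k by auto
  have "prob {\<omega> \<in> space M. sorts (?t \<circ> \<pi>) n (\<lambda>i. X i \<omega>)} =
        prob {\<omega> \<in> space M. sorts \<pi> n (\<lambda>i\<in>{1..n}. X (?t i) \<omega>)}"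
  proof -
    have "sorts (?t \<circ> \<pi>) n (\<lambda>i. X i \<omega>) \<longleftrightarrow> sorts \<pi> n (\<lambda>i\<in>{1..n}. X (?t i) \<omega>)" for \<omega>
      unfolding sorts_transpose[OF \<pi> k] by (rule sorts_cong) simp
    then show ?thesis by simp
  qed
  also have "\<dots> = prob {\<omega> \<in> space M. sorts \<pi> n (\<lambda>i\<in>{1..n}. X i \<omega>)}"
    using prob_window[OF ne _ _ Q, of ?t] prob_window[OF ne _ _ Q, of "\<lambda>i. i"]
      permutes_inj_on[OF t] permutes_image[OF t] by simp
  also have "\<dots> = prob {\<omega> \<in> space M. sorts \<pi> n (\<lambda>i. X i \<omega>)}"
  proof -
    have "sorts \<pi> n (\<lambda>i\<in>{1..n}. X i \<omega>) \<longleftrightarrow> sorts \<pi> n (\<lambda>i. X i \<omega>)" for \<omega>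
      by (rule sorts_cong) simp
    then show ?thesis by simp
  qed
  finally show "prob {\<omega> \<in> space M. sorts (?t \<circ> \<pi>) n (\<lambda>i. X i \<omega>)} =
      prob {\<omega> \<in> space M. sorts \<pi> n (\<lambda>i. X i \<omega>)}" .
qed

end

lemma spacing_order_cong:
  assumes \<sigma>: "\<sigma> permutes {1..N}" and "\<And>i. i \<in> {1..N} \<Longrightarrow> x i = y i"
  shows "spacing_order N \<sigma> \<pi> x \<longleftrightarrow> spacing_order N \<sigma> \<pi> y"
proof -
  have eq: "x (\<sigma> i) = y (\<sigma> i)" if "i \<in> {1..N}" for i
    by (rule assms(2)[OF permutes_in_range[OF \<sigma> that]])
  have "sorts \<pi> (N - 1) (spacing x \<sigma>) \<longleftrightarrow> sorts \<pi> (N - 1) (spacing y \<sigma>)"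
  proof (rule sorts_cong)
    fix i assume "i \<in> {1..N - 1}"
    then have "i \<in> {1..N}" "Suc i \<in> {1..N}" by auto
    then show "spacing x \<sigma> i = spacing y \<sigma> i" by (simp only: spacing_def eq)
  qed
  with sorts_cong[OF assms(2)] show ?thesis by (simp only: spacing_order_def)
qed

lemma pred_spacing_order:
  assumes D: "\<And>i. i \<in> {1..N} \<Longrightarrow> (\<lambda>\<omega>. D \<omega> i) \<in> borel_measurable M"
  shows "Measurable.pred M (\<lambda>\<omega>. spacing_order N \<sigma> \<pi> (D \<omega>))"
proof (cases "\<sigma> permutes {1..N}")
  case True
  have "Measurable.pred M (\<lambda>\<omega>. sorts \<pi> (N - 1) (spacing (D \<omega>) \<sigma>))"
  proof (rule pred_sorts)
    fix i assume "i \<in> {1..N - 1}"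
    then have [measurable]: "(\<lambda>\<omega>. D \<omega> (\<sigma> (Suc i))) \<in> borel_measurable M"
      "(\<lambda>\<omega>. D \<omega> (\<sigma> i)) \<in> borel_measurable M"
      by (auto intro!: D permutes_in_range[OF True])
    show "(\<lambda>\<omega>. spacing (D \<omega>) \<sigma> i) \<in> borel_measurable M"
      unfolding spacing_def by measurable
  qed
  with pred_sorts[OF D] show ?thesis
    unfolding spacing_order_def by (intro pred_intros_logic)
next
  case False
  then show ?thesis by (simp add: spacing_order_def sorts_def)
qed

context uniform_locations
begin

text \<open>The reflection keeps the order of the points and swaps the spacings \<open>k\<close> and \<open>k + 1\<close>.\<close>

lemma prob_spacing_order_transpose:
  assumes \<sigma>: "\<sigma> permutes {1..N}" and \<pi>: "\<pi> permutes {1..N - 1}" and k: "k \<in> {1..<N - 1}"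
  shows "prob {\<omega> \<in> space M. spacing_order N \<sigma> (Transposition.transpose k (Suc k) \<circ> \<pi>) (\<lambda>i. X i \<omega>)} =
         prob {\<omega> \<in> space M. spacing_order N \<sigma> \<pi> (\<lambda>i. X i \<omega>)}"
proof -
  let ?I = "{1..N}"
  let ?P = "PiM ?I (\<lambda>_. uniform_measure lborel {0..1::real})"
  let ?B = "PiM ?I (\<lambda>_. borel :: real measure)"
  let ?t = "Transposition.transpose k (Suc k)"
  have ne: "?I \<noteq> {}" using k by auto
  have sets: "sets ?P = sets ?B" by (intro sets_PiM_cong) auto
  have pred: "Measurable.pred ?B (spacing_order N \<sigma> \<rho>)" for \<rho>
    by (rule pred_spacing_order) simp
  have law: "prob {\<omega> \<in> space M. spacing_order N \<sigma> \<rho> (\<lambda>i. X i \<omega>)} =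
             measure ?P {x \<in> space ?B. spacing_order N \<sigma> \<rho> x}" for \<rho>
  proof -
    have "spacing_order N \<sigma> \<rho> (\<lambda>i. X i \<omega>) \<longleftrightarrow> spacing_order N \<sigma> \<rho> (\<lambda>i\<in>?I. X i \<omega>)" for \<omega>
      by (rule spacing_order_cong[OF \<sigma>]) simp
    then show ?thesis using prob_window[OF ne _ _ pred, of "\<lambda>i. i" \<rho>] by simp
  qed
  have between: "x (\<sigma> k) < x (\<sigma> (Suc k)) \<and> x (\<sigma> (Suc k)) < x (\<sigma> (Suc (Suc k)))"
    if "spacing_order N \<sigma> \<rho> x" for \<rho> x
    using that k by (auto simp: spacing_order_def sorts_def)
  have inj: "\<sigma> a = \<sigma> b \<longleftrightarrow> a = b" for a b
    using permutes_inj[OF \<sigma>] by (auto dest: injD)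
  have range: "\<sigma> (Suc k) \<in> ?I" "\<sigma> k \<in> ?I" "\<sigma> (Suc (Suc k)) \<in> ?I"
    using k by (auto intro!: permutes_in_range[OF \<sigma>, simplified])
  have "measure ?P {x \<in> space ?B. spacing_order N \<sigma> \<pi> x} =
        measure ?P {x \<in> space ?B. spacing_order N \<sigma> (?t \<circ> \<pi>) x}"
  proof (rule measure_PiM_uniform_reflect)
    show "finite ?I" "\<sigma> (Suc k) \<in> ?I" "\<sigma> k \<in> ?I - {\<sigma> (Suc k)}" "\<sigma> (Suc (Suc k)) \<in> ?I - {\<sigma> (Suc k)}"
      using range by (simp_all add: inj)
    show "{x \<in> space ?B. spacing_order N \<sigma> \<pi> x} \<in> sets ?P"
      "{x \<in> space ?B. spacing_order N \<sigma> (?t \<circ> \<pi>) x} \<in> sets ?P"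
      unfolding sets using pred by simp_all
    show "x (\<sigma> k) < x (\<sigma> (Suc k)) \<and> x (\<sigma> (Suc k)) < x (\<sigma> (Suc (Suc k)))"
      if "x \<in> {x \<in> space ?B. spacing_order N \<sigma> \<pi> x}" for x
      using that by (blast dest: between)
    show "x (\<sigma> k) < x (\<sigma> (Suc k)) \<and> x (\<sigma> (Suc k)) < x (\<sigma> (Suc (Suc k)))"
      if "x \<in> {x \<in> space ?B. spacing_order N \<sigma> (?t \<circ> \<pi>) x}" for x
      using that by (blast dest: between)
    fix x assume x: "x \<in> space ?P"
    have "x(\<sigma> (Suc k) := c) \<in> space ?B" for c
      using x range by (auto simp: space_PiM PiE_def extensional_def)
    moreover have "x \<in> space ?B" using x by (simp add: space_PiM)
    ultimately show "x(\<sigma> (Suc k) := x (\<sigma> k) + x (\<sigma> (Suc (Suc k))) - x (\<sigma> (Suc k)))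
          \<in> {x \<in> space ?B. spacing_order N \<sigma> \<pi> x} \<longleftrightarrow>
        x \<in> {x \<in> space ?B. spacing_order N \<sigma> (?t \<circ> \<pi>) x}"
      using spacing_order_reflect[OF \<sigma> \<pi> k, of x] by (simp only: mem_Collect_eq simp_thms)
  qed
  then show ?thesis by (simp only: law)
qed

lemma order_events_spacings:
  "order_events M (N - 1) (\<lambda>\<pi>. {\<omega> \<in> space M. \<exists>\<sigma>. spacing_order N \<sigma> \<pi> (\<lambda>i. X i \<omega>)})"
proof unfold_locales
  let ?S = "{\<sigma>. \<sigma> permutes {1..N}}"
  have fin: "finite ?S" by (simp add: finite_permutations)
  have ev: "{\<omega> \<in> space M. spacing_order N \<sigma> \<pi> (\<lambda>i. X i \<omega>)} \<in> events" for \<sigma> \<pi>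
    using pred_spacing_order[of N "\<lambda>\<omega> i. X i \<omega>" M \<sigma> \<pi>] X_measurable by simp
  have un: "{\<omega> \<in> space M. \<exists>\<sigma>. spacing_order N \<sigma> \<pi> (\<lambda>i. X i \<omega>)} =
      (\<Union>\<sigma>\<in>?S. {\<omega> \<in> space M. spacing_order N \<sigma> \<pi> (\<lambda>i. X i \<omega>)})" for \<pi>
    unfolding spacing_order_def by (blast dest: sorts_permutes)
  show "{\<omega> \<in> space M. \<exists>\<sigma>. spacing_order N \<sigma> \<pi> (\<lambda>i. X i \<omega>)} \<in> events" for \<pi>
    unfolding un using fin ev by (intro sets.finite_UN) auto
  show "\<pi> = \<rho>" if "\<omega> \<in> {\<omega> \<in> space M. \<exists>\<sigma>. spacing_order N \<sigma> \<pi> (\<lambda>i. X i \<omega>)}"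
    "\<omega> \<in> {\<omega> \<in> space M. \<exists>\<sigma>. spacing_order N \<sigma> \<rho> (\<lambda>i. X i \<omega>)}" for \<pi> \<rho> \<omega>
  proof -
    from that obtain \<sigma> \<sigma>' where *: "spacing_order N \<sigma> \<pi> (\<lambda>i. X i \<omega>)"
      "spacing_order N \<sigma>' \<rho> (\<lambda>i. X i \<omega>)" by blast
    then have "\<sigma> = \<sigma>'" unfolding spacing_order_def by (blast intro: sorts_unique)
    with * show ?thesis unfolding spacing_order_def by (blast intro: sorts_unique)
  qed
  show "AE \<omega> in M. \<exists>\<pi>. \<pi> permutes {1..N - 1} \<and>
      \<omega> \<in> {\<omega> \<in> space M. \<exists>\<sigma>. spacing_order N \<sigma> \<pi> (\<lambda>i. X i \<omega>)}"
    using AE_generic AE_space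
  proof eventually_elim
    case (elim \<omega>)
    from sorts_exists[OF generic_inj_on[OF elim(1)], of N] obtain \<sigma>
      where \<sigma>: "sorts \<sigma> N (\<lambda>i. X i \<omega>)" by blast
    from sorts_exists[OF generic_inj_on_spacing[OF elim(1) sorts_permutes[OF \<sigma>]]] obtain \<pi>
      where \<pi>: "sorts \<pi> (N - 1) (spacing (\<lambda>i. X i \<omega>) \<sigma>)" by blast
    with \<sigma> elim(2) show ?case unfolding spacing_order_def by (blast dest: sorts_permutes)
  qed
  fix \<pi> k assume \<pi>: "\<pi> permutes {1..N - 1}" and k: "k \<in> {1..<N - 1}"
  have sum: "prob {\<omega> \<in> space M. \<exists>\<sigma>. spacing_order N \<sigma> \<rho> (\<lambda>i. X i \<omega>)} =
      (\<Sum>\<sigma>\<in>?S. prob {\<omega> \<in> space M. spacing_order N \<sigma> \<rho> (\<lambda>i. X i \<omega>)})" for \<rho>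
    unfolding un
  proof (rule finite_measure_finite_Union[OF fin])
    show "disjoint_family_on (\<lambda>\<sigma>. {\<omega> \<in> space M. spacing_order N \<sigma> \<rho> (\<lambda>i. X i \<omega>)}) ?S"
      unfolding disjoint_family_on_def spacing_order_def by (blast intro: sorts_unique)
  qed (use ev in blast)
  show "prob {\<omega> \<in> space M. \<exists>\<sigma>. spacing_order N \<sigma> (Transposition.transpose k (Suc k) \<circ> \<pi>) (\<lambda>i. X i \<omega>)} =
        prob {\<omega> \<in> space M. \<exists>\<sigma>. spacing_order N \<sigma> \<pi> (\<lambda>i. X i \<omega>)}"
    unfolding sum
    by (intro sum.cong refl prob_spacing_order_transpose[OF _ \<pi> k]) simp
qed

text \<open>The bridge from geometry to independence: on the left the statistic \<open>popular_ranks\<close> is evaluated at the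
  dependent spacings of \<open>N\<close> points, on the right at \<open>N - 1\<close> independent locations.  Both orders are
  uniform.  The identity concerns one \<open>N\<close> at a time, not the joint law in \<open>N\<close>.\<close>

lemma distr_overloaded_fraction:
  assumes p: "0 \<le> p" "p \<le> 1" and lam: "lam > 0" and mu: "mu > 0"
    and load: "1 / (1 + p) < lam / mu" "lam / mu \<le> 1" and N: "2 \<le> N"
  shows "distr M borel (\<lambda>\<omega>. overloaded_fraction lam mu p (\<lambda>i. X i \<omega>) N) =
         distr M borel (\<lambda>\<omega>. real (card (popular_ranks (N - 1) (\<lambda>i. X i \<omega>))) / real N)"
proof (rule distr_eq_order_functional[OF order_events_spacings order_events_locations,
      where g = "\<lambda>\<pi>. real (card (popular_ranks (N - 1) (\<lambda>i. real (inv \<pi> i)))) / real N"])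
  show "(\<lambda>\<omega>. overloaded_fraction lam mu p (\<lambda>i. X i \<omega>) N) \<in> borel_measurable M"
    by (rule measurable_overloaded_fraction) simp
  show "(\<lambda>\<omega>. real (card (popular_ranks (N - 1) (\<lambda>i. X i \<omega>))) / real N) \<in> borel_measurable M"
    by (intro borel_measurable_divide borel_measurable_const measurable_card_popular_ranks) simp
  fix \<pi> \<omega>
  show "overloaded_fraction lam mu p (\<lambda>i. X i \<omega>) N =
      real (card (popular_ranks (N - 1) (\<lambda>i. real (inv \<pi> i)))) / real N"
    if "\<omega> \<in> {\<omega> \<in> space M. \<exists>\<sigma>. spacing_order N \<sigma> \<pi> (\<lambda>i. X i \<omega>)}"
  proof -
    from that obtain \<sigma> where \<sigma>: "sorts \<sigma> N (\<lambda>i. X i \<omega>)"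
      and \<pi>: "sorts \<pi> (N - 1) (spacing (\<lambda>i. X i \<omega>) \<sigma>)"
      unfolding spacing_order_def by blast
    show ?thesis
      unfolding overloaded_fraction_popular[OF p lam mu load N \<sigma> sorts_inj_on[OF \<pi>]]
      by (simp only: popular_ranks_sorts[OF \<pi>])
  qed
  show "real (card (popular_ranks (N - 1) (\<lambda>i. X i \<omega>))) / real N =
      real (card (popular_ranks (N - 1) (\<lambda>i. real (inv \<pi> i)))) / real N"
    if "\<omega> \<in> {\<omega> \<in> space M. sorts \<pi> (N - 1) (\<lambda>i. X i \<omega>)}"
    using popular_ranks_sorts[of \<pi> "N - 1" "\<lambda>i. X i \<omega>"] that by simp
qed

lemma prob_sorts_locations:
  "\<pi> permutes {1..n} \<Longrightarrow> prob {\<omega> \<in> space M. sorts \<pi> n (\<lambda>i. X i \<omega>)} = 1 / fact n"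
  by (rule order_events.prob_order[OF order_events_locations])

end

context prob_space
begin

lemma expectation_abs_le_sqrt:
  fixes Y :: "'a \<Rightarrow> real"
  assumes "Y \<in> borel_measurable M" "integrable M (\<lambda>\<omega>. (Y \<omega>)\<^sup>2)"
  shows "expectation (\<lambda>\<omega>. \<bar>Y \<omega>\<bar>) \<le> sqrt (expectation (\<lambda>\<omega>. (Y \<omega>)\<^sup>2))"
proof (rule real_le_rsqrt)
  have int: "integrable M (\<lambda>\<omega>. \<bar>Y \<omega>\<bar>)"
    using square_integrable_imp_integrable[OF assms] by (rule integrable_abs)
  have "0 \<le> variance (\<lambda>\<omega>. \<bar>Y \<omega>\<bar>)" by (rule variance_positive)
  also have "\<dots> = expectation (\<lambda>\<omega>. (Y \<omega>)\<^sup>2) - (expectation (\<lambda>\<omega>. \<bar>Y \<omega>\<bar>))\<^sup>2"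
    using assms(2) int by (subst variance_eq) simp_all
  finally show "(expectation (\<lambda>\<omega>. \<bar>Y \<omega>\<bar>))\<^sup>2 \<le> expectation (\<lambda>\<omega>. (Y \<omega>)\<^sup>2)" by simp
qed

lemma integrable_bounded:
  fixes Y :: "'a \<Rightarrow> real"
  assumes "Y \<in> borel_measurable M" "\<And>\<omega>. \<omega> \<in> space M \<Longrightarrow> \<bar>Y \<omega>\<bar> \<le> B"
  shows "integrable M Y"
  using assms by (intro integrable_const_bound[where B = B] AE_I2) auto

lemma second_moment_sum_le:
  fixes G :: "nat \<Rightarrow> 'a \<Rightarrow> real"
  assumes [measurable]: "\<And>j. G j \<in> borel_measurable M"
    and bound: "\<And>j \<omega>. \<omega> \<in> space M \<Longrightarrow> \<bar>G j \<omega>\<bar> \<le> d"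
    and uncorrelated: "\<And>i j. i < j \<Longrightarrow> expectation (\<lambda>\<omega>. G i \<omega> * G j \<omega>) = 0"
  shows "expectation (\<lambda>\<omega>. (\<Sum>j<q. G j \<omega>)\<^sup>2) \<le> real q * d\<^sup>2"
proof (induction q)
  case (Suc q)
  have sum_bound: "\<bar>\<Sum>j<q. G j \<omega>\<bar> \<le> real q * d" if "\<omega> \<in> space M" for \<omega>
  proof -
    have "\<bar>\<Sum>j<q. G j \<omega>\<bar> \<le> (\<Sum>j<q. \<bar>G j \<omega>\<bar>)" by (rule sum_abs)
    also have "\<dots> \<le> real (card {..<q}) * d" by (rule sum_bounded_above) (rule bound[OF that])
    finally show ?thesis by simp
  qed
  have sq: "(Y \<omega>)\<^sup>2 \<le> B\<^sup>2" if "\<bar>Y \<omega>\<bar> \<le> B" for Y :: "'a \<Rightarrow> real" and \<omega> B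
    using that by (metis abs_ge_zero power2_abs power_mono)
  have int1: "integrable M (\<lambda>\<omega>. (\<Sum>j<q. G j \<omega>)\<^sup>2)"
    by (rule integrable_bounded[where B = "(real q * d)\<^sup>2"]) (use sum_bound sq in auto)
  have int2: "integrable M (\<lambda>\<omega>. (G q \<omega>)\<^sup>2)"
    by (rule integrable_bounded[where B = "d\<^sup>2"]) (use bound sq in auto)
  have int3: "integrable M (\<lambda>\<omega>. G j \<omega> * G q \<omega>)" for j
  proof (rule integrable_bounded[where B = "d * d"])
    fix \<omega> assume "\<omega> \<in> space M"
    then show "\<bar>G j \<omega> * G q \<omega>\<bar> \<le> d * d"
      unfolding abs_mult using bound[of \<omega> j] bound[of \<omega> q] by (intro mult_mono) auto
  qed measurable
  have "expectation (\<lambda>\<omega>. (\<Sum>j<Suc q. G j \<omega>)\<^sup>2) =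
        expectation (\<lambda>\<omega>. (\<Sum>j<q. G j \<omega>)\<^sup>2 + (G q \<omega>)\<^sup>2 + 2 * (\<Sum>j<q. G j \<omega> * G q \<omega>))"
    by (simp add: power2_sum sum_distrib_right mult.assoc)
  also have "\<dots> = expectation (\<lambda>\<omega>. (\<Sum>j<q. G j \<omega>)\<^sup>2) + expectation (\<lambda>\<omega>. (G q \<omega>)\<^sup>2) +
      2 * (\<Sum>j<q. expectation (\<lambda>\<omega>. G j \<omega> * G q \<omega>))"
    using int1 int2 int3 by simp
  also have "(\<Sum>j<q. expectation (\<lambda>\<omega>. G j \<omega> * G q \<omega>)) = 0"
    using uncorrelated by simp
  also have "expectation (\<lambda>\<omega>. (G q \<omega>)\<^sup>2) \<le> expectation (\<lambda>\<omega>. d\<^sup>2)"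
    using int2 bound sq by (intro integral_mono) auto
  finally show ?case using Suc.IH by (simp add: prob_space algebra_simps)
qed simp

text \<open>Since \<open>x \<mapsto> exp (\<i> * x)\<close> is 1-Lipschitz, closeness in mean controls characteristic functions.\<close>

lemma char_distr_diff_le:
  fixes Y Y' :: "'a \<Rightarrow> real"
  assumes [measurable]: "Y \<in> borel_measurable M" "Y' \<in> borel_measurable M"
    and int: "integrable M (\<lambda>\<omega>. Y \<omega> - Y' \<omega>)"
  shows "cmod (char (distr M borel Y) t - char (distr M borel Y') t) \<le>
           \<bar>t\<bar> * expectation (\<lambda>\<omega>. \<bar>Y \<omega> - Y' \<omega>\<bar>)"
proof -
  have iexp: "cmod (iexp a - iexp b) \<le> \<bar>a - b\<bar>" for a b :: real
  proof -
    have "iexp a - iexp b = iexp b * (iexp (a - b) - 1)"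
      by (simp add: algebra_simps flip: exp_add)
    then have "cmod (iexp a - iexp b) = cmod (iexp (a - b) - 1)"
      by (simp add: norm_mult)
    also have "\<dots> \<le> \<bar>a - b\<bar>"
      using iexp_approx1[of "a - b" 0] by simp
    finally show ?thesis .
  qed
  have "char (distr M borel Y) t - char (distr M borel Y') t =
        (CLINT \<omega>|M. iexp (t * Y \<omega>)) - (CLINT \<omega>|M. iexp (t * Y' \<omega>))"
    by (simp add: char_def integral_distr)
  also have "\<dots> = (CLINT \<omega>|M. iexp (t * Y \<omega>) - iexp (t * Y' \<omega>))"
    by (rule Bochner_Integration.integral_diff[symmetric]) (rule integrable_iexp; simp)+
  also have "cmod \<dots> \<le> (LINT \<omega>|M. cmod (iexp (t * Y \<omega>) - iexp (t * Y' \<omega>)))"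
    by (rule integral_norm_bound)
  also have "\<dots> \<le> (LINT \<omega>|M. \<bar>t\<bar> * \<bar>Y \<omega> - Y' \<omega>\<bar>)"
  proof (rule integral_mono)
    show "integrable M (\<lambda>\<omega>. cmod (iexp (t * Y \<omega>) - iexp (t * Y' \<omega>)))"
      by (intro integrable_norm Bochner_Integration.integrable_diff) (rule integrable_iexp; simp)+
    show "integrable M (\<lambda>\<omega>. \<bar>t\<bar> * \<bar>Y \<omega> - Y' \<omega>\<bar>)" using int by simp
    show "cmod (iexp (t * Y \<omega>) - iexp (t * Y' \<omega>)) \<le> \<bar>t\<bar> * \<bar>Y \<omega> - Y' \<omega>\<bar>" for \<omega>
      using iexp[of "t * Y \<omega>" "t * Y' \<omega>"] by (simp add: abs_mult flip: right_diff_distrib)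
  qed
  finally show ?thesis by simp
qed

end

lemma (in prob_space) char_distr:
  "Y \<in> borel_measurable M \<Longrightarrow> char (distr M borel Y) t = (CLINT \<omega>|M. iexp (t * Y \<omega>))"
  by (simp add: char_def integral_distr)

lemma (in prob_space) AE_tendsto_0_if_summable:
  fixes V :: "nat \<Rightarrow> 'a \<Rightarrow> real"
  assumes [measurable]: "\<And>n. V n \<in> borel_measurable M"
    and sum: "\<And>\<epsilon>. 0 < \<epsilon> \<Longrightarrow> summable (\<lambda>n. prob {\<omega> \<in> space M. \<epsilon> \<le> \<bar>V n \<omega>\<bar>})"
  shows "AE \<omega> in M. (\<lambda>n. V n \<omega>) \<longlonglongrightarrow> 0"
proof -
  have "AE \<omega> in M. eventually (\<lambda>n. \<bar>V n \<omega>\<bar> < 1 / Suc i) sequentially" for i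
  proof -
    have "AE \<omega> in M. eventually (\<lambda>n. \<omega> \<in> space M - {\<omega> \<in> space M. 1 / Suc i \<le> \<bar>V n \<omega>\<bar>}) sequentially"
      by (rule borel_cantelli_AE1) (auto intro!: sum simp: emeasure_eq_measure)
    then show ?thesis
    proof eventually_elim
      case (elim \<omega>)
      then show ?case by eventually_elim auto
    qed
  qed
  then have "AE \<omega> in M. \<forall>i. eventually (\<lambda>n. \<bar>V n \<omega>\<bar> < 1 / Suc i) sequentially"
    by (simp only: AE_all_countable) simp
  then show ?thesis
  proof eventually_elim
    case (elim \<omega>)
    show ?case
      unfolding tendsto_iff
    proof (intro allI impI)
      fix \<epsilon> :: real assume "0 < \<epsilon>"
      then obtain i where i: "1 / real (Suc i) < \<epsilon>" by (rule nat_approx_posE)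
      from elim[rule_format, of i] show "eventually (\<lambda>n. dist (V n \<omega>) 0 < \<epsilon>) sequentially"
        by eventually_elim (use i in simp)
    qed
  qed
qed

lemma char_normal_distribution:
  assumes "0 < \<sigma>"
  shows "char (density lborel (normal_density 0 \<sigma>)) t = complex_of_real (exp (- (t\<^sup>2 * \<sigma>\<^sup>2) / 2))"
proof -
  interpret prob_space std_normal_distribution
    by (rule prob_space_normal_density) simp
  have "distributed std_normal_distribution lborel (\<lambda>x. x) std_normal_density"
    by (auto simp: distributed_def distr_id2)
  from normal_density_affine[OF this _ less_imp_neq[OF assms, symmetric], of 0]
  have "distributed std_normal_distribution lborel (\<lambda>x. \<sigma> * x) (normal_density 0 \<sigma>)"
    using assms by simp
  then have "density lborel (normal_density 0 \<sigma>) = distr std_normal_distribution lborel (\<lambda>x. \<sigma> * x)"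
    by (simp add: distributed_def)
  then have "char (density lborel (normal_density 0 \<sigma>)) t = char std_normal_distribution (t * \<sigma>)"
    by (simp add: char_def integral_distr mult.assoc)
  then show ?thesis by (simp add: char_std_normal_distribution power_mult_distrib)
qed

lemma filterlim_div_at_top:
  assumes "0 < (b::nat)"
  shows "filterlim (\<lambda>n. n div b) at_top sequentially"
  unfolding filterlim_at_top
proof
  fix z
  show "eventually (\<lambda>n. z \<le> n div b) sequentially"
    using eventually_ge_at_top[of "z * b"]
    by eventually_elim (use assms div_le_mono[of "z * b" _ b] in simp)
qed

lemma tendsto_div_over_self:
  assumes "0 < (b::nat)"
  shows "(\<lambda>n. real (n div b) / real n) \<longlonglongrightarrow> 1 / real b"
proof (rule real_tendsto_sandwich)
  show "eventually (\<lambda>n. 1 / real b - 1 / real n \<le> real (n div b) / real n) sequentially"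
    using eventually_gt_at_top[of 0]
  proof eventually_elim
    case (elim n)
    have "n = n div b * b + n mod b" by simp
    also have "\<dots> \<le> n div b * b + b" using assms by (intro add_left_mono) simp
    finally have "real n \<le> real (n div b * b + b)" by (simp only: of_nat_le_iff)
    then have "real n / b - 1 \<le> real (n div b)" using assms by (simp add: field_simps)
    then have "(real n / b - 1) / n \<le> real (n div b) / n" by (intro divide_right_mono) auto
    then show ?case using elim assms by (simp add: field_simps)
  qed
  show "eventually (\<lambda>n. real (n div b) / real n \<le> 1 / real b) sequentially"
    using eventually_gt_at_top[of 0]
  proof eventually_elim
    case (elim n)
    have "n div b * b \<le> n" by simp
    then have "real (n div b) * real b \<le> real n" by (simp only: flip: of_nat_mult)
    then show ?case using elim assms by (simp add: field_simps)
  qed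
  show "(\<lambda>n. 1 / real b - 1 / real n) \<longlonglongrightarrow> 1 / real b"
    using tendsto_diff[OF tendsto_const lim_1_over_n, of "1 / real b"] by simp
qed simp

section \<open>Limit theorems for m-dependent sequences\<close>

text \<open>Bounded centred variables for which sums over blocks of indices more than \<open>m\<close> apart are independent
  and the law of a block sum is invariant under shifts.  Independence and stationarity are stated for
  sums, the form in which the limit theorems use them.\<close>

locale m_dependent = prob_space M for M :: "'a measure" +
  fixes Z :: "nat \<Rightarrow> 'a \<Rightarrow> real" and m :: nat and c :: real
  assumes Z_measurable [measurable]: "\<And>k. Z k \<in> borel_measurable M"
    and Z_bound: "\<And>k \<omega>. \<omega> \<in> space M \<Longrightarrow> \<bar>Z k \<omega>\<bar> \<le> c"
    and c_pos: "0 < c"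
    and Z_mean: "\<And>k. expectation (Z k) = 0"
    and indep_blocks: "\<And>K :: nat \<Rightarrow> nat set. (\<And>j. finite (K j)) \<Longrightarrow>
      (\<And>i j a b. i < j \<Longrightarrow> a \<in> K i \<Longrightarrow> b \<in> K j \<Longrightarrow> a + m < b) \<Longrightarrow>
      indep_vars (\<lambda>_. borel) (\<lambda>j \<omega>. \<Sum>k\<in>K j. Z k \<omega>) UNIV"
    and stationary: "\<And>s L. distr M borel (\<lambda>\<omega>. \<Sum>k<L. Z (s + k) \<omega>) =
      distr M borel (\<lambda>\<omega>. \<Sum>k<L. Z k \<omega>)"
begin

definition block_sum :: "nat set \<Rightarrow> 'a \<Rightarrow> real" where
  "block_sum K \<omega> = (\<Sum>k\<in>K. Z k \<omega>)"

lemma block_sum_measurable [measurable]: "block_sum K \<in> borel_measurable M"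
  unfolding block_sum_def by measurable

lemma block_sum_bound:
  assumes "\<omega> \<in> space M"
  shows "\<bar>block_sum K \<omega>\<bar> \<le> real (card K) * c"
proof -
  have "\<bar>block_sum K \<omega>\<bar> \<le> (\<Sum>k\<in>K. \<bar>Z k \<omega>\<bar>)" unfolding block_sum_def by (rule sum_abs)
  also have "\<dots> \<le> real (card K) * c" by (rule sum_bounded_above) (rule Z_bound[OF assms])
  finally show ?thesis .
qed

lemma integrable_Z: "integrable M (Z k)"
  by (rule integrable_bounded[OF Z_measurable Z_bound])

lemma block_sum_mean: "expectation (block_sum K) = 0"
  unfolding block_sum_def using integrable_Z Z_mean by simp

lemma integrable_block_sum: "integrable M (block_sum K)"
  by (rule integrable_bounded[OF block_sum_measurable block_sum_bound])

lemma block_sum_uncorrelated: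
  fixes K :: "nat \<Rightarrow> nat set"
  assumes "\<And>j. finite (K j)" "\<And>i j a b. i < j \<Longrightarrow> a \<in> K i \<Longrightarrow> b \<in> K j \<Longrightarrow> a + m < b"
    and "i < j"
  shows "expectation (\<lambda>\<omega>. block_sum (K i) \<omega> * block_sum (K j) \<omega>) = 0"
proof -
  have "indep_vars (\<lambda>_. borel) (\<lambda>j. block_sum (K j)) UNIV"
    unfolding block_sum_def
    by (rule indep_blocks[where K = K]) (rule assms(1), rule assms(2), assumption+)
  then have "indep_vars (\<lambda>_. borel) (\<lambda>j. block_sum (K j)) {i, j}"
    by (rule indep_vars_subset) simp
  then have "expectation (\<lambda>\<omega>. \<Prod>l\<in>{i, j}. block_sum (K l) \<omega>) =
             (\<Prod>l\<in>{i, j}. expectation (block_sum (K l)))"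
    by (intro indep_vars_lebesgue_integral integrable_block_sum) simp
  then show ?thesis using assms(3) by (simp add: block_sum_mean)
qed

definition second_moment :: "nat \<Rightarrow> real" where
  "second_moment L = expectation (\<lambda>\<omega>. (block_sum {..<L} \<omega>)\<^sup>2)"

lemma block_sum_shift: "block_sum {s..<s + L} \<omega> = (\<Sum>k<L. Z (s + k) \<omega>)"
  by (simp add: block_sum_def sum.atLeastLessThan_shift_0 atLeast0LessThan)

lemma distr_block_sum: "distr M borel (block_sum {s..<s + L}) = distr M borel (block_sum {..<L})"
proof -
  have "block_sum {s..<s + L} = (\<lambda>\<omega>. \<Sum>k<L. Z (s + k) \<omega>)"
    by (rule ext) (rule block_sum_shift)
  then show ?thesis using stationary[where L = L and s = s] by (simp add: block_sum_def[abs_def])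
qed

text \<open>Long blocks of length \<open>L\<close>, short blocks of length \<open>l\<close> that keep them apart, and an incomplete rest.\<close>

lemma block_sum_split:
  assumes "0 < b" "b = L + l"
  shows "block_sum {..<n} \<omega> =
    (\<Sum>j<n div b. block_sum {j * b..<j * b + L} \<omega>) +
    (\<Sum>j<n div b. block_sum {j * b + L..<j * b + L + l} \<omega>) +
    block_sum {n div b * b..<n} \<omega>"
proof -
  let ?q = "n div b"
  have le: "?q * b \<le> n" by simp
  have "block_sum ({..<?q * b} \<union> {?q * b..<n}) \<omega> = block_sum {..<?q * b} \<omega> + block_sum {?q * b..<n} \<omega>"
    unfolding block_sum_def by (rule sum.union_disjoint) auto
  then have "block_sum {..<n} \<omega> = block_sum {..<?q * b} \<omega> + block_sum {?q * b..<n} \<omega>"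
    by (simp only: ivl_disj_un_one(2)[OF le])
  also have "block_sum {..<?q * b} \<omega> = (\<Sum>j<?q. block_sum {j * b..<j * b + b} \<omega>)"
    unfolding block_sum_def by (rule sum.nat_group[symmetric])
  also have "\<dots> = (\<Sum>j<?q. block_sum {j * b..<j * b + L} \<omega> + block_sum {j * b + L..<j * b + L + l} \<omega>)"
    unfolding block_sum_def assms(2) by (intro sum.cong refl) (simp add: sum.atLeastLessThan_concat add.assoc)
  finally show ?thesis by (simp add: sum.distrib)
qed

lemma block_gap:
  assumes "i < j" "a < i * b + s + l" "j * b + s \<le> a'" "l + m < b + 1"
  shows "a + m < (a'::nat)"
proof -
  have "Suc i * b \<le> j * b" using assms(1) by (intro mult_le_mono1) simp
  with assms show ?thesis by simp
qed

text \<open>Separated block sums are uncorrelated, so their sum grows only like the square root of their number.\<close>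

lemma expectation_abs_block_sums_le:
  assumes "l + m \<le> b"
  shows "expectation (\<lambda>\<omega>. \<bar>\<Sum>j<q. block_sum {j * b + s..<j * b + s + l} \<omega>\<bar>) \<le> real l * c * sqrt (real q)"
proof -
  let ?G = "\<lambda>j. block_sum {j * b + s..<j * b + s + l}"
  have bound: "\<bar>?G j \<omega>\<bar> \<le> real l * c" if "\<omega> \<in> space M" for j \<omega>
    using block_sum_bound[OF that, of "{j * b + s..<j * b + s + l}"] by simp
  have "expectation (\<lambda>\<omega>. (\<Sum>j<q. ?G j \<omega>)\<^sup>2) \<le> real q * (real l * c)\<^sup>2"
  proof (rule second_moment_sum_le)
    show "expectation (\<lambda>\<omega>. ?G i \<omega> * ?G j \<omega>) = 0" if "i < j" for i j
    proof (rule block_sum_uncorrelated[OF _ _ that])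
      fix i j a a' assume "i < j" "a \<in> {i * b + s..<i * b + s + l}" "a' \<in> {j * b + s..<j * b + s + l}"
      then show "a + m < a'" using assms by (intro block_gap[of i j a b s l a']) auto
    qed simp
  qed (use bound in auto)
  then have le: "sqrt (expectation (\<lambda>\<omega>. (\<Sum>j<q. ?G j \<omega>)\<^sup>2)) \<le> sqrt (real q * (real l * c)\<^sup>2)"
    by (rule real_sqrt_le_mono)
  have "expectation (\<lambda>\<omega>. \<bar>\<Sum>j<q. ?G j \<omega>\<bar>) \<le> sqrt (expectation (\<lambda>\<omega>. (\<Sum>j<q. ?G j \<omega>)\<^sup>2))"
  proof (rule expectation_abs_le_sqrt)
    have sum_bound: "\<bar>\<Sum>j<q. ?G j \<omega>\<bar> \<le> real q * (real l * c)" if "\<omega> \<in> space M" for \<omega>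
    proof -
      have "\<bar>\<Sum>j<q. ?G j \<omega>\<bar> \<le> (\<Sum>j<q. \<bar>?G j \<omega>\<bar>)" by (rule sum_abs)
      also have "\<dots> \<le> real (card {..<q}) * (real l * c)"
        by (rule sum_bounded_above) (rule bound[OF that])
      finally show ?thesis by simp
    qed
    show "integrable M (\<lambda>\<omega>. (\<Sum>j<q. ?G j \<omega>)\<^sup>2)"
    proof (rule integrable_bounded)
      fix \<omega> assume "\<omega> \<in> space M"
      from power_mono[OF sum_bound[OF this], of 2]
      show "\<bar>(\<Sum>j<q. ?G j \<omega>)\<^sup>2\<bar> \<le> (real q * (real l * c))\<^sup>2" by simp
    qed measurable
  qed measurable
  also note le
  also have "sqrt (real q * (real l * c)\<^sup>2) = real l * c * sqrt (real q)"
    using c_pos by (simp add: real_sqrt_mult)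
  finally show ?thesis .
qed

text \<open>The classical central limit theorem for the long blocks, rescaled to the number \<open>q * b\<close> of
  indices covered.\<close>

lemma char_block_sums_tendsto:
  assumes pos: "0 < second_moment L" and b: "L + m \<le> b" "0 < b"
  shows "(\<lambda>q. char (distr M borel
            (\<lambda>\<omega>. (\<Sum>j<q. block_sum {j * b..<j * b + L} \<omega>) / sqrt (real q * real b))) t)
         \<longlonglongrightarrow> complex_of_real (exp (- (t\<^sup>2 * (second_moment L / b)) / 2))"
proof -
  let ?W = "\<lambda>j. block_sum {j * b..<j * b + L}"
  let ?s = "sqrt (second_moment L)"
  have square: "integrable M (\<lambda>\<omega>. (block_sum K \<omega>)\<^sup>2)" for K
  proof (rule integrable_bounded)
    fix \<omega> assume "\<omega> \<in> space M"
    from power_mono[OF block_sum_bound[OF this], of K 2]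
    show "\<bar>(block_sum K \<omega>)\<^sup>2\<bar> \<le> (real (card K) * c)\<^sup>2" by simp
  qed measurable
  have "weak_conv_m (\<lambda>q. distr M borel (\<lambda>\<omega>. (\<Sum>j<q. ?W j \<omega>) / sqrt (real q * ?s\<^sup>2)))
          std_normal_distribution"
  proof (rule central_limit_theorem_zero_mean)
    show "indep_vars (\<lambda>_. borel) ?W UNIV"
      unfolding block_sum_def
    proof (rule indep_blocks)
      fix i j a a' assume "i < j" "a \<in> {i * b..<i * b + L}" "a' \<in> {j * b..<j * b + L}"
      then show "a + m < a'" using b by (intro block_gap[of i j a b 0 L a']) auto
    qed simp
    show "expectation (?W j) = 0" for j by (rule block_sum_mean)
    show "0 < ?s" using pos by simp
    show "integrable M (\<lambda>\<omega>. (?W j \<omega>)\<^sup>2)" for j by (rule square)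
    show "distr M borel (?W j) = distr M borel (block_sum {..<L})" for j by (rule distr_block_sum)
    show "variance (?W j) = ?s\<^sup>2" for j
    proof -
      have "expectation (\<lambda>\<omega>. (?W j \<omega>)\<^sup>2) = (\<integral>x. x\<^sup>2 \<partial>distr M borel (?W j))"
        by (simp add: integral_distr)
      also have "\<dots> = (\<integral>x. x\<^sup>2 \<partial>distr M borel (block_sum {..<L}))" by (simp only: distr_block_sum)
      also have "\<dots> = second_moment L" by (simp add: second_moment_def integral_distr)
      finally show ?thesis using pos by (simp add: block_sum_mean)
    qed
  qed
  then have "(\<lambda>q. char (distr M borel (\<lambda>\<omega>. (\<Sum>j<q. ?W j \<omega>) / sqrt (real q * ?s\<^sup>2))) (t * ?s / sqrt b))
      \<longlonglongrightarrow> char std_normal_distribution (t * ?s / sqrt b)"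
    by (intro levy_continuity1 real_dist_normal_dist real_distribution_distr) measurable
  moreover have "char (distr M borel (\<lambda>\<omega>. (\<Sum>j<q. ?W j \<omega>) / sqrt (real q * ?s\<^sup>2))) (t * ?s / sqrt b) =
      char (distr M borel (\<lambda>\<omega>. (\<Sum>j<q. ?W j \<omega>) / sqrt (real q * real b))) t" for q
  proof -
    have W1: "(\<lambda>\<omega>. (\<Sum>j<q. ?W j \<omega>) / sqrt (real q * ?s\<^sup>2)) \<in> borel_measurable M"
      and W2: "(\<lambda>\<omega>. (\<Sum>j<q. ?W j \<omega>) / sqrt (real q * real b)) \<in> borel_measurable M"
      by measurable
    have "(t * ?s / sqrt b) * (x / sqrt (real q * ?s\<^sup>2)) = t * (x / sqrt (real q * real b))" for x
      using pos b by (simp add: real_sqrt_mult)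
    then show ?thesis by (simp only: char_distr[OF W1] char_distr[OF W2])
  qed
  moreover have "char std_normal_distribution (t * ?s / sqrt b) =
      complex_of_real (exp (- (t\<^sup>2 * (second_moment L / b)) / 2))"
    using pos b by (simp add: char_std_normal_distribution power_mult_distrib power_divide)
  ultimately show ?thesis by simp
qed

end

context m_dependent
begin

text \<open>The distance in mean between the normalised sum and the normalised sum over the long blocks.  The three
  terms of the bound come from the perturbation \<open>B\<close> and the incomplete rest, from the short blocks
  separating the long ones, and from normalising with \<open>q * b\<close> in place of \<open>n\<close>.  As \<open>n\<close> tends to
  infinity only the second one survives, with limit \<open>m * c / sqrt b\<close>.\<close>

lemma expectation_block_approximation:
  fixes Y :: "'a \<Rightarrow> real"
  assumes [measurable]: "Y \<in> borel_measurable M"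
    and Y: "\<And>\<omega>. \<omega> \<in> space M \<Longrightarrow> \<bar>Y \<omega> - block_sum {..<n} \<omega>\<bar> \<le> B"
    and L: "m \<le> L" "0 < L" and n: "L + m \<le> n"
  defines "b \<equiv> L + m"
  defines "q \<equiv> n div b"
  defines "W \<equiv> \<lambda>\<omega>. \<Sum>j<q. block_sum {j * b..<j * b + L} \<omega>"
  shows "integrable M (\<lambda>\<omega>. Y \<omega> / sqrt n - W \<omega> / sqrt (real q * real b))"
    and "expectation (\<lambda>\<omega>. \<bar>Y \<omega> / sqrt n - W \<omega> / sqrt (real q * real b)\<bar>) \<le>
      (B + c * b) * (1 / sqrt n) + m * c * sqrt (real q / n) +
      L * c * (1 / sqrt b - sqrt (real q / n))"
proof -
  define G where "G = (\<lambda>\<omega>. \<Sum>j<q. block_sum {j * b + L..<j * b + L + m} \<omega>)"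
  define R where "R = block_sum {q * b..<n}"
  have b: "0 < b" using L by (simp add: b_def)
  have q: "0 < q" using n b unfolding q_def b_def by (simp add: div_greater_zero_iff)
  have qb: "q * b \<le> n" by (simp add: q_def)
  have n0: "0 < n" using q qb b by (metis less_le_trans nat_0_less_mult_iff)
  have [measurable]: "W \<in> borel_measurable M" "G \<in> borel_measurable M" "R \<in> borel_measurable M"
    unfolding W_def G_def R_def by measurable
  have intW: "integrable M W" unfolding W_def by (intro Bochner_Integration.integrable_sum integrable_block_sum)
  have intG: "integrable M G" unfolding G_def by (intro Bochner_Integration.integrable_sum integrable_block_sum)
  have split: "block_sum {..<n} \<omega> = W \<omega> + G \<omega> + R \<omega>" for \<omega>
    using block_sum_split[OF b, of L m n \<omega>] by (simp add: b_def W_def G_def R_def q_def)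
  have R: "\<bar>R \<omega>\<bar> \<le> c * b" if "\<omega> \<in> space M" for \<omega>
  proof -
    have "n = q * b + n mod b" by (simp add: q_def)
    moreover have "n mod b < b" using b by simp
    ultimately have "n - q * b \<le> b" by linarith
    have "\<bar>R \<omega>\<bar> \<le> real (card {q * b..<n}) * c"
      unfolding R_def by (rule block_sum_bound[OF that])
    also have "\<dots> \<le> real b * c"
      using \<open>n - q * b \<le> b\<close> c_pos by (intro mult_right_mono) simp_all
    finally show ?thesis by (simp add: mult.commute)
  qed
  have scale: "0 \<le> 1 / sqrt (real q * real b) - 1 / sqrt n"
  proof -
    have "real q * real b \<le> real n" using qb by (simp only: flip: of_nat_mult of_nat_le_iff)
    then have "sqrt (real q * real b) \<le> sqrt n" by simp
    moreover have "0 < sqrt (real q * real b)" using q b by simp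
    ultimately show ?thesis by (simp add: frac_le)
  qed
  have nn: "0 \<le> 1 / sqrt n" by simp
  let ?d = "1 / sqrt (real q * real b) - 1 / sqrt n"
  let ?D = "\<lambda>\<omega>. Y \<omega> / sqrt n - W \<omega> / sqrt (real q * real b)"
  have pt: "\<bar>?D \<omega>\<bar> \<le> (B + c * b) * (1 / sqrt n) + \<bar>G \<omega>\<bar> * (1 / sqrt n) + \<bar>W \<omega>\<bar> * ?d"
    if \<omega>: "\<omega> \<in> space M" for \<omega>
  proof -
    have "?D \<omega> = (Y \<omega> - block_sum {..<n} \<omega> + R \<omega>) * (1 / sqrt n) + G \<omega> * (1 / sqrt n) - W \<omega> * ?d"
      unfolding split by (simp add: algebra_simps add_divide_distrib diff_divide_distrib)
    also have "\<bar>\<dots>\<bar> \<le> \<bar>Y \<omega> - block_sum {..<n} \<omega> + R \<omega>\<bar> * (1 / sqrt n) + \<bar>G \<omega>\<bar> * (1 / sqrt n) + \<bar>W \<omega>\<bar> * ?d"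
    proof -
      have "\<bar>u + v - w\<bar> \<le> \<bar>u\<bar> + \<bar>v\<bar> + \<bar>w\<bar>" for u v w :: real by linarith
      from this[of "(Y \<omega> - block_sum {..<n} \<omega> + R \<omega>) * (1 / sqrt n)" "G \<omega> * (1 / sqrt n)" "W \<omega> * ?d"]
      show ?thesis using scale by (simp only: abs_mult abs_of_nonneg) simp
    qed
    also have "\<dots> \<le> (B + c * b) * (1 / sqrt n) + \<bar>G \<omega>\<bar> * (1 / sqrt n) + \<bar>W \<omega>\<bar> * ?d"
    proof (intro add_mono mult_right_mono order_refl)
      show "\<bar>Y \<omega> - block_sum {..<n} \<omega> + R \<omega>\<bar> \<le> B + c * b"
        using Y[OF \<omega>] R[OF \<omega>] by linarith
    qed (rule order_refl nn scale of_nat_0_le_iff)+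
    finally show ?thesis .
  qed
  have int: "integrable M (\<lambda>\<omega>. (B + c * b) * (1 / sqrt n) + \<bar>G \<omega>\<bar> * (1 / sqrt n) + \<bar>W \<omega>\<bar> * ?d)"
    using intG intW by (intro Bochner_Integration.integrable_add integrable_mult_left integrable_abs) auto
  show intD: "integrable M ?D"
  proof (rule Bochner_Integration.integrable_bound[OF int])
    show "AE \<omega> in M. norm (?D \<omega>) \<le> norm ((B + c * b) * (1 / sqrt n) + \<bar>G \<omega>\<bar> * (1 / sqrt n) + \<bar>W \<omega>\<bar> * ?d)"
    proof (rule AE_I2)
      fix \<omega> assume "\<omega> \<in> space M"
      from pt[OF this] show "norm (?D \<omega>) \<le> norm ((B + c * b) * (1 / sqrt n) + \<bar>G \<omega>\<bar> * (1 / sqrt n) + \<bar>W \<omega>\<bar> * ?d)"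
        unfolding real_norm_def by linarith
    qed
  qed measurable
  have "expectation (\<lambda>\<omega>. \<bar>?D \<omega>\<bar>) \<le>
      expectation (\<lambda>\<omega>. (B + c * b) * (1 / sqrt n) + \<bar>G \<omega>\<bar> * (1 / sqrt n) + \<bar>W \<omega>\<bar> * ?d)"
    by (rule integral_mono[OF integrable_abs[OF intD] int pt])
  also have "\<dots> = (B + c * b) * (1 / sqrt n) + expectation (\<lambda>\<omega>. \<bar>G \<omega>\<bar>) * (1 / sqrt n) +
      expectation (\<lambda>\<omega>. \<bar>W \<omega>\<bar>) * ?d"
  proof -
    have 1: "integrable M (\<lambda>\<omega>. \<bar>G \<omega>\<bar> * (1 / sqrt n))" "integrable M (\<lambda>\<omega>. \<bar>W \<omega>\<bar> * ?d)"
      using intG intW by (intro integrable_mult_left integrable_abs; simp)+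
    have 2: "integrable M (\<lambda>\<omega>. (B + c * b) * (1 / sqrt n) + \<bar>G \<omega>\<bar> * (1 / sqrt n))"
      by (intro Bochner_Integration.integrable_add 1) simp
    show ?thesis
      by (subst Bochner_Integration.integral_add[OF 2 1(2)], subst Bochner_Integration.integral_add[OF _ 1(1)])
        (simp_all only: integral_mult_left_zero integrable_const lebesgue_integral_const prob_space scaleR_one measure_def[symmetric])
  qed
  also have "\<dots> \<le> (B + c * b) * (1 / sqrt n) + (m * c * sqrt q) * (1 / sqrt n) + (L * c * sqrt q) * ?d"
  proof (intro add_mono mult_right_mono order_refl)
    show "expectation (\<lambda>\<omega>. \<bar>G \<omega>\<bar>) \<le> m * c * sqrt q"
      unfolding G_def using L by (intro expectation_abs_block_sums_le) (simp add: b_def)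
    show "expectation (\<lambda>\<omega>. \<bar>W \<omega>\<bar>) \<le> L * c * sqrt q"
      using expectation_abs_block_sums_le[of L b 0 q] by (simp add: W_def b_def)
  qed (rule order_refl nn scale of_nat_0_le_iff)+
  also have "(m * c * sqrt q) * (1 / sqrt n) = m * c * sqrt (real q / n)"
    by (simp add: real_sqrt_divide)
  also have "(L * c * sqrt q) * ?d = L * c * (1 / sqrt b - sqrt (real q / n))"
  proof -
    have "(L * c * sqrt q) * ?d = L * c * (sqrt q * (1 / sqrt (real q * real b)) - sqrt q * (1 / sqrt n))"
      by (simp only: right_diff_distrib mult.assoc)
    also have "sqrt q * (1 / sqrt (real q * real b)) = 1 / sqrt b" using q by (simp add: real_sqrt_mult)
    also have "sqrt q * (1 / sqrt n) = sqrt (real q / n)" by (simp add: real_sqrt_divide)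
    finally show ?thesis .
  qed
  finally show "expectation (\<lambda>\<omega>. \<bar>?D \<omega>\<bar>) \<le> (B + c * b) * (1 / sqrt n) + m * c * sqrt (real q / n) +
      L * c * (1 / sqrt b - sqrt (real q / n))" .
qed

lemma char_near_block_limit:
  fixes Y :: "nat \<Rightarrow> 'a \<Rightarrow> real"
  assumes [measurable]: "\<And>n. Y n \<in> borel_measurable M"
    and Y: "\<And>n \<omega>. \<omega> \<in> space M \<Longrightarrow> \<bar>Y n \<omega> - block_sum {..<n} \<omega>\<bar> \<le> B"
    and L: "m \<le> L" "0 < L" "0 < second_moment L"
    and a: "\<bar>t\<bar> * (m * c / sqrt (L + m)) +
        cmod (complex_of_real (exp (- (t\<^sup>2 * (second_moment L / (L + m))) / 2)) - z) < \<epsilon>"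
  shows "eventually (\<lambda>n. cmod (char (distr M borel (\<lambda>\<omega>. Y n \<omega> / sqrt n)) t - z) < \<epsilon>) sequentially"
proof -
  define b where "b = L + m"
  have b: "0 < b" using L by (simp add: b_def)
  let ?z = "complex_of_real (exp (- (t\<^sup>2 * (second_moment L / b)) / 2))"
  let ?W = "\<lambda>q. distr M borel (\<lambda>\<omega>. (\<Sum>j<q. block_sum {j * b..<j * b + L} \<omega>) / sqrt (real q * real b))"
  let ?e = "\<lambda>n. (B + c * b) * (1 / sqrt n) + m * c * sqrt (real (n div b) / n) +
      L * c * (1 / sqrt b - sqrt (real (n div b) / n))"
  have sq: "(\<lambda>n. sqrt (real (n div b) / n)) \<longlonglongrightarrow> 1 / sqrt b"
    using tendsto_real_sqrt[OF tendsto_div_over_self[OF b]] by (simp add: real_sqrt_divide)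
  have "(\<lambda>n. 1 / sqrt (real n)) \<longlonglongrightarrow> 0"
    using tendsto_real_sqrt[OF lim_1_over_n] by (simp add: real_sqrt_divide)
  then have "?e \<longlonglongrightarrow> (B + c * b) * 0 + m * c * (1 / sqrt b) + L * c * (1 / sqrt b - 1 / sqrt b)"
    by (intro tendsto_intros sq)
  then have "?e \<longlonglongrightarrow> m * c / sqrt b" by simp
  moreover have "(\<lambda>n. char (?W (n div b)) t) \<longlonglongrightarrow> ?z"
    by (rule filterlim_compose[OF char_block_sums_tendsto filterlim_div_at_top[OF b]])
      (use L b in \<open>simp_all add: b_def\<close>)
  ultimately have "(\<lambda>n. \<bar>t\<bar> * ?e n + cmod (char (?W (n div b)) t - z)) \<longlonglongrightarrow>
      \<bar>t\<bar> * (m * c / sqrt b) + cmod (?z - z)"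
    by (intro tendsto_intros)
  moreover have "\<bar>t\<bar> * (m * c / sqrt b) + cmod (?z - z) < \<epsilon>"
    using a by (simp add: b_def)
  ultimately have "eventually (\<lambda>n. \<bar>t\<bar> * ?e n + cmod (char (?W (n div b)) t - z) < \<epsilon>) sequentially"
    by (rule order_tendstoD(2))
  then show ?thesis
    using eventually_ge_at_top[of b]
  proof eventually_elim
    case (elim n)
    let ?Y = "distr M borel (\<lambda>\<omega>. Y n \<omega> / sqrt n)"
    have approx: "expectation (\<lambda>\<omega>. \<bar>Y n \<omega> / sqrt n -
        (\<Sum>j<n div b. block_sum {j * b..<j * b + L} \<omega>) / sqrt (real (n div b) * real b)\<bar>) \<le> ?e n"
      "integrable M (\<lambda>\<omega>. Y n \<omega> / sqrt n -
        (\<Sum>j<n div b. block_sum {j * b..<j * b + L} \<omega>) / sqrt (real (n div b) * real b))"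
      using expectation_block_approximation[of "Y n" n B L] Y L(1,2) elim(2)
      by (simp_all add: b_def)
    have "cmod (char ?Y t - char (?W (n div b)) t) \<le> \<bar>t\<bar> * ?e n"
      using char_distr_diff_le[OF _ _ approx(2), of t] mult_left_mono[OF approx(1), of "\<bar>t\<bar>"]
      by (simp del: times_divide_eq_right)
    moreover have "cmod (char ?Y t - z) \<le>
        cmod (char ?Y t - char (?W (n div b)) t) + cmod (char (?W (n div b)) t - z)"
      using norm_triangle_ineq[of "char ?Y t - char (?W (n div b)) t" "char (?W (n div b)) t - z"] by simp
    ultimately show ?case using elim(1) by linarith
  qed
qed

text \<open>The block length \<open>L\<close> is sent to infinity after \<open>n\<close>: the variance of the blocks per index tends to \<open>v\<close>
  and the contribution of the short blocks vanishes.\<close>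

theorem central_limit_theorem_m_dependent:
  fixes Y :: "nat \<Rightarrow> 'a \<Rightarrow> real"
  assumes [measurable]: "\<And>n. Y n \<in> borel_measurable M"
    and Y: "\<And>n \<omega>. \<omega> \<in> space M \<Longrightarrow> \<bar>Y n \<omega> - block_sum {..<n} \<omega>\<bar> \<le> B"
    and v: "0 < v" "(\<lambda>L. second_moment L / L) \<longlonglongrightarrow> v"
  shows "weak_conv_m (\<lambda>n. distr M borel (\<lambda>\<omega>. Y n \<omega> / sqrt n))
           (density lborel (normal_density 0 (sqrt v)))"
proof (rule levy_continuity)
  show "real_distribution (distr M borel (\<lambda>\<omega>. Y n \<omega> / sqrt n))" for n
    by (rule real_distribution_distr) measurable
  show "real_distribution (density lborel (normal_density 0 (sqrt v)))"
    using v(1) by (simp add: real_distribution_def real_distribution_axioms_def prob_space_normal_density)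
  fix t
  let ?z = "complex_of_real (exp (- (t\<^sup>2 * v) / 2))"
  have z: "char (density lborel (normal_density 0 (sqrt v))) t = ?z"
    using char_normal_distribution[of "sqrt v" t] v(1) by simp
  \<comment> \<open>The short blocks take up a vanishing proportion of the indices.\<close>
  have ratio: "(\<lambda>L. real L / (L + m)) \<longlonglongrightarrow> 1"
    by real_asymp
  have "(\<lambda>L. second_moment L / L * (real L / (L + m))) \<longlonglongrightarrow> v * 1"
    by (intro tendsto_mult v(2) ratio)
  moreover have "eventually (\<lambda>L. second_moment L / L * (real L / (L + m)) = second_moment L / (L + m)) sequentially"
    using eventually_gt_at_top[of 0] by eventually_elim simp
  ultimately have "(\<lambda>L. second_moment L / (L + m)) \<longlonglongrightarrow> v * 1"
    by (rule Lim_transform_eventually)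
  then have var: "(\<lambda>L. second_moment L / (L + m)) \<longlonglongrightarrow> v" by (simp only: mult_1_right)
  have gap: "(\<lambda>L. m * c / sqrt (L + m)) \<longlonglongrightarrow> 0"
    by real_asymp
  have lim: "(\<lambda>L. \<bar>t\<bar> * (m * c / sqrt (L + m)) +
        cmod (complex_of_real (exp (- (t\<^sup>2 * (second_moment L / (L + m))) / 2)) - ?z)) \<longlonglongrightarrow>
      \<bar>t\<bar> * 0 + cmod (?z - ?z)"
    by (intro tendsto_intros var gap) simp
  show "(\<lambda>n. char (distr M borel (\<lambda>\<omega>. Y n \<omega> / sqrt n)) t) \<longlonglongrightarrow>
      char (density lborel (normal_density 0 (sqrt v))) t"
    unfolding z tendsto_iff dist_norm
  proof (intro allI impI)
    fix \<epsilon> :: real assume "0 < \<epsilon>"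
    then have "eventually (\<lambda>L. \<bar>t\<bar> * (m * c / sqrt (L + m)) +
        cmod (complex_of_real (exp (- (t\<^sup>2 * (second_moment L / (L + m))) / 2)) - ?z) < \<epsilon>) sequentially"
      using order_tendstoD(2)[OF lim, of \<epsilon>] by simp
    moreover have "eventually (\<lambda>L. 0 < second_moment L / L) sequentially"
      by (rule order_tendstoD(1)[OF v(2,1)])
    ultimately have "eventually (\<lambda>L. m \<le> L \<and> 0 < L \<and> 0 < second_moment L \<and>
        \<bar>t\<bar> * (m * c / sqrt (L + m)) +
        cmod (complex_of_real (exp (- (t\<^sup>2 * (second_moment L / (L + m))) / 2)) - ?z) < \<epsilon>) sequentially"
      using eventually_ge_at_top[of m] eventually_gt_at_top[of 0]
      by eventually_elim (simp add: zero_less_divide_iff)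
    then obtain L where L: "m \<le> L" "0 < L" "0 < second_moment L"
      "\<bar>t\<bar> * (m * c / sqrt (L + m)) +
        cmod (complex_of_real (exp (- (t\<^sup>2 * (second_moment L / (L + m))) / 2)) - ?z) < \<epsilon>"
      using eventually_happens'[OF sequentially_bot] by blast
    show "eventually (\<lambda>n. cmod (char (distr M borel (\<lambda>\<omega>. Y n \<omega> / sqrt n)) t - ?z) < \<epsilon>) sequentially"
      by (rule char_near_block_limit[OF assms(1) Y L])
  qed
qed

text \<open>Indices in one residue class modulo \<open>m + 1\<close> are pairwise more than \<open>m\<close> apart, so Hoeffding's inequality
  applies to the corresponding variables.\<close>

lemma prob_residue_class_sum_ge:
  assumes "0 < q" "0 \<le> \<delta>"
  shows "prob {\<omega> \<in> space M. \<delta> * real q \<le> \<bar>\<Sum>j<q. Z (j * Suc m + r) \<omega>\<bar>} \<le>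
           2 * exp (- (\<delta>\<^sup>2 / (2 * c\<^sup>2)) * real q)"
proof -
  have "indep_vars (\<lambda>_. borel) (\<lambda>j \<omega>. \<Sum>k\<in>{j * Suc m + r}. Z k \<omega>) UNIV"
  proof (rule indep_blocks)
    fix i j a b assume "i < j" "a \<in> {i * Suc m + r}" "b \<in> {j * Suc m + r}"
    then show "a + m < b"
      by (intro block_gap[of i j a "Suc m" r 1 b]) (simp_all del: mult_Suc_right)
  qed simp
  then have "indep_vars (\<lambda>_. borel) (\<lambda>j. Z (j * Suc m + r)) UNIV"
    by (simp del: mult_Suc_right)
  then have indep: "indep_vars (\<lambda>_. borel) (\<lambda>j. Z (j * Suc m + r)) {..<q}"
    by (rule indep_vars_subset) simp
  have mean: "(\<Sum>j<q. expectation (Z (j * Suc m + r))) = 0" by (simp only: Z_mean sum.neutral_const)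
  interpret H: Hoeffding_ineq M "{..<q}" "\<lambda>j. Z (j * Suc m + r)" "\<lambda>_. - c" "\<lambda>_. c"
    "\<Sum>j<q. expectation (Z (j * Suc m + r))"
  proof unfold_locales
    show "AE \<omega> in M. Z (j * Suc m + r) \<omega> \<in> {- c..c}" for j
    proof (rule AE_I2)
      fix \<omega> assume "\<omega> \<in> space M"
      from Z_bound[OF this, of "j * Suc m + r"] show "Z (j * Suc m + r) \<omega> \<in> {- c..c}"
        unfolding abs_le_iff atLeastAtMost_iff by linarith
    qed
  qed (use indep in simp_all)
  have "prob {\<omega> \<in> space M. \<delta> * real q \<le> \<bar>(\<Sum>j<q. Z (j * Suc m + r) \<omega>) - (\<Sum>j<q. expectation (Z (j * Suc m + r)))\<bar>} \<le>
      2 * exp (- 2 * (\<delta> * real q)\<^sup>2 / (\<Sum>j<q. (c - - c)\<^sup>2))"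
    by (rule H.Hoeffding_ineq_abs_ge) (use assms c_pos in simp_all)
  also have "- 2 * (\<delta> * real q)\<^sup>2 / (\<Sum>j<q. (c - - c)\<^sup>2) = - (\<delta>\<^sup>2 / (2 * c\<^sup>2)) * real q"
    using assms c_pos by (simp add: field_simps power2_eq_square)
  finally show ?thesis unfolding mean by simp
qed

lemma block_sum_residue_classes:
  "block_sum {..<n} \<omega> =
     (\<Sum>r<Suc m. \<Sum>j<n div Suc m. Z (j * Suc m + r) \<omega>) + block_sum {n div Suc m * Suc m..<n} \<omega>"
proof -
  let ?D = "Suc m"
  have "block_sum {..<n} \<omega> =
      (\<Sum>j<n div ?D. block_sum {j * ?D..<j * ?D + ?D} \<omega>) + block_sum {n div ?D * ?D..<n} \<omega>"
    using block_sum_split[of ?D ?D 0 n \<omega>] by (simp add: block_sum_def)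
  also have "(\<Sum>j<n div ?D. block_sum {j * ?D..<j * ?D + ?D} \<omega>) =
      (\<Sum>j<n div ?D. \<Sum>r<?D. Z (j * ?D + r) \<omega>)"
    by (simp only: block_sum_shift)
  also have "\<dots> = (\<Sum>r<?D. \<Sum>j<n div ?D. Z (j * ?D + r) \<omega>)" by (rule sum.swap)
  finally show ?thesis .
qed

text \<open>If the whole sum deviates by \<open>\<eta> * n\<close>, then for large \<open>n\<close> one of the \<open>m + 1\<close> residue classes deviates by
  at least \<open>\<eta> / 2\<close> per term; the other half of \<open>\<eta>\<close> absorbs the perturbation and the incomplete rest.\<close>

lemma summable_prob_deviation:
  fixes Y :: "nat \<Rightarrow> 'a \<Rightarrow> real"
  assumes [measurable]: "\<And>n. Y n \<in> borel_measurable M"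
    and Y: "\<And>n \<omega>. \<omega> \<in> space M \<Longrightarrow> \<bar>Y n \<omega> - block_sum {..<n} \<omega>\<bar> \<le> B"
    and \<eta>: "0 < \<eta>"
  shows "summable (\<lambda>n. prob {\<omega> \<in> space M. \<eta> * real n \<le> \<bar>Y n \<omega>\<bar>})"
proof -
  let ?D = "Suc m"
  \<comment> \<open>The rate in Hoeffding's bound for a residue class that deviates by \<open>\<eta> / 2\<close> per term.\<close>
  define \<kappa> where "\<kappa> = (\<eta> / 2)\<^sup>2 / (2 * c\<^sup>2)"
  have \<kappa>: "0 < \<kappa>" using \<eta> c_pos by (simp add: \<kappa>_def)
  define C where "C = real ?D * (2 * exp \<kappa>)"
  have bound: "prob {\<omega> \<in> space M. \<eta> * real n \<le> \<bar>Y n \<omega>\<bar>} \<le> C * exp (- \<kappa> / ?D) ^ n"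
    if n: "?D \<le> n" and large: "B + ?D * c \<le> \<eta> / 2 * n" for n
  proof -
    define q where "q = n div ?D"
    have q: "0 < q" using n by (simp add: q_def div_greater_zero_iff)
    have qD: "q * ?D \<le> n" unfolding q_def by (rule div_times_less_eq_dividend)
    have n_less: "n < q * ?D + ?D"
      unfolding q_def using div_mult_mod_eq[of n ?D] mod_less_divisor[of ?D n] by linarith
    let ?E = "\<lambda>r. {\<omega> \<in> space M. \<eta> / 2 * real q \<le> \<bar>\<Sum>j<q. Z (j * ?D + r) \<omega>\<bar>}"
    have "{\<omega> \<in> space M. \<eta> * real n \<le> \<bar>Y n \<omega>\<bar>} \<subseteq> (\<Union>r<?D. ?E r)"
    proof (rule subsetI, rule ccontr)
      fix \<omega> assume \<omega>: "\<omega> \<in> {\<omega> \<in> space M. \<eta> * real n \<le> \<bar>Y n \<omega>\<bar>}" and "\<omega> \<notin> (\<Union>r<?D. ?E r)"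
      then have small: "\<bar>\<Sum>j<q. Z (j * ?D + r) \<omega>\<bar> < \<eta> / 2 * real q" if "r < ?D" for r
        using that by (force simp: not_le)
      let ?R = "block_sum {q * ?D..<n} \<omega>"
      have "\<bar>?R\<bar> \<le> real (card {q * ?D..<n}) * c"
        by (rule block_sum_bound) (use \<omega> in simp)
      also have "\<dots> \<le> ?D * c"
        using n_less c_pos by (intro mult_right_mono) simp_all
      finally have R: "\<bar>?R\<bar> \<le> ?D * c" .
      have "\<bar>\<Sum>r<?D. \<Sum>j<q. Z (j * ?D + r) \<omega>\<bar> \<le> (\<Sum>r<?D. \<bar>\<Sum>j<q. Z (j * ?D + r) \<omega>\<bar>)"
        by (rule sum_abs)
      also have "\<dots> < (\<Sum>r<?D. \<eta> / 2 * real q)"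
        by (rule sum_strict_mono) (use small in auto)
      also have "\<dots> = \<eta> / 2 * real (q * ?D)" by (simp add: algebra_simps)
      also have "\<dots> \<le> \<eta> / 2 * real n"
        by (rule mult_left_mono[OF of_nat_mono[OF qD]]) (use \<eta> in simp)
      finally have "\<bar>block_sum {..<n} \<omega>\<bar> < \<eta> / 2 * real n + ?D * c"
        using R unfolding block_sum_residue_classes[of n \<omega>, folded q_def] by linarith
      moreover have "\<bar>Y n \<omega> - block_sum {..<n} \<omega>\<bar> \<le> B" using Y \<omega> by blast
      ultimately have "\<bar>Y n \<omega>\<bar> < \<eta> / 2 * real n + ?D * c + B" by linarith
      also have "\<dots> \<le> \<eta> * real n" using large by (simp add: field_simps)
      finally show False using \<omega> by simp
    qed
    then have "prob {\<omega> \<in> space M. \<eta> * real n \<le> \<bar>Y n \<omega>\<bar>} \<le> prob (\<Union>r<?D. ?E r)"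
      by (rule finite_measure_mono) measurable
    also have "\<dots> \<le> (\<Sum>r<?D. prob (?E r))"
      by (rule finite_measure_subadditive_finite) auto
    also have "\<dots> \<le> (\<Sum>r<?D. 2 * exp (- \<kappa> * real q))"
      unfolding \<kappa>_def by (intro sum_mono prob_residue_class_sum_ge) (use q \<eta> in simp_all)
    also have "\<dots> = real ?D * (2 * exp (- \<kappa> * real q))" by simp
    also have "exp (- \<kappa> * real q) \<le> exp (\<kappa> + - \<kappa> / ?D * n)"
    proof -
      have "real n \<le> real (q * ?D + ?D)" using n_less by (simp only: of_nat_le_iff less_imp_le)
      then have "real n / ?D \<le> real q + 1" by (simp add: field_simps)
      then have "\<kappa> * (real n / ?D) \<le> \<kappa> * (real q + 1)" using \<kappa> by (intro mult_left_mono) simp_all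
      then show ?thesis by (simp add: algebra_simps)
    qed
    also have "exp (\<kappa> + - \<kappa> / ?D * n) = exp \<kappa> * exp (- \<kappa> / ?D) ^ n"
      by (simp only: exp_add exp_of_nat2_mult)
    finally show ?thesis by (simp add: C_def mult.assoc)
  qed
  have "eventually (\<lambda>n. B + ?D * c \<le> \<eta> / 2 * real n) sequentially"
    using \<eta> by real_asymp
  then have "eventually (\<lambda>n. norm (prob {\<omega> \<in> space M. \<eta> * real n \<le> \<bar>Y n \<omega>\<bar>}) \<le> C * exp (- \<kappa> / ?D) ^ n) sequentially"
    using eventually_ge_at_top[of ?D] by eventually_elim (use bound in simp)
  then show ?thesis
    by (rule summable_comparison_test_ev) (use \<kappa> in \<open>simp add: summable_mult summable_geometric\<close>)
qed

text \<open>Adding one variable brings in its variance and twice its covariances with the preceding \<open>m\<close> variables.\<close>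

lemma second_moment_growth:
  assumes \<gamma>: "\<And>k h. h \<le> m \<Longrightarrow> expectation (\<lambda>\<omega>. Z k \<omega> * Z (k + h) \<omega>) = \<gamma> h" and L: "m \<le> L"
  shows "second_moment (Suc L) = second_moment L + (\<gamma> 0 + 2 * (\<Sum>h\<in>{1..m}. \<gamma> h))"
proof -
  have ZZ: "integrable M (\<lambda>\<omega>. Z k \<omega> * Z l \<omega>)" for k l
  proof (rule integrable_bounded)
    fix \<omega> assume "\<omega> \<in> space M"
    then show "\<bar>Z k \<omega> * Z l \<omega>\<bar> \<le> c * c"
      unfolding abs_mult using Z_bound c_pos by (intro mult_mono) auto
  qed measurable
  have far: "expectation (\<lambda>\<omega>. Z k \<omega> * Z L \<omega>) = 0" if "k + m < L" for k
  proof -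
    define K where "K j = {j * (L - k) + k}" for j :: nat
    have "expectation (\<lambda>\<omega>. block_sum (K 0) \<omega> * block_sum (K 1) \<omega>) = 0"
    proof (rule block_sum_uncorrelated)
      fix i j a b :: nat assume "i < j" "a \<in> K i" "b \<in> K j"
      then show "a + m < b"
        using that by (intro block_gap[of i j a "L - k" k 1 b]) (simp_all add: K_def)
    qed (simp_all add: K_def)
    then show ?thesis using that by (simp add: block_sum_def K_def)
  qed
  have square: "integrable M (\<lambda>\<omega>. (block_sum {..<L} \<omega>)\<^sup>2)"
    unfolding block_sum_def power2_eq_square sum_product
    by (intro Bochner_Integration.integrable_sum ZZ)
  have "(block_sum {..<Suc L} \<omega>)\<^sup>2 =
      (block_sum {..<L} \<omega>)\<^sup>2 + (Z L \<omega> * Z L \<omega> + 2 * (\<Sum>k<L. Z k \<omega> * Z L \<omega>))" for \<omega>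
    by (simp add: block_sum_def power2_sum sum_distrib_right mult.assoc flip: power2_eq_square)
  then have "second_moment (Suc L) = second_moment L +
      (expectation (\<lambda>\<omega>. Z L \<omega> * Z L \<omega>) + 2 * (\<Sum>k<L. expectation (\<lambda>\<omega>. Z k \<omega> * Z L \<omega>)))"
    unfolding second_moment_def using square ZZ by simp
  also have "expectation (\<lambda>\<omega>. Z L \<omega> * Z L \<omega>) = \<gamma> 0" using \<gamma>[of 0 L] by simp
  also have "(\<Sum>k<L. expectation (\<lambda>\<omega>. Z k \<omega> * Z L \<omega>)) = (\<Sum>k\<in>{L - m..<L}. expectation (\<lambda>\<omega>. Z k \<omega> * Z L \<omega>))"
    by (rule sum.mono_neutral_right) (use far in auto)
  also have "\<dots> = (\<Sum>h\<in>{1..m}. \<gamma> h)"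
  proof (rule sum.reindex_bij_witness[where i = "\<lambda>h. L - h" and j = "\<lambda>k. L - k"])
    fix k assume "k \<in> {L - m..<L}"
    then show "\<gamma> (L - k) = expectation (\<lambda>\<omega>. Z k \<omega> * Z L \<omega>)"
      using \<gamma>[of "L - k" k] L by (simp add: le_diff_conv)
  qed (use L in auto)
  finally show ?thesis .
qed

lemma second_moment_asymptotics:
  assumes \<gamma>: "\<And>k h. h \<le> m \<Longrightarrow> expectation (\<lambda>\<omega>. Z k \<omega> * Z (k + h) \<omega>) = \<gamma> h"
  defines "v \<equiv> \<gamma> 0 + 2 * (\<Sum>h\<in>{1..m}. \<gamma> h)"
  shows "(\<lambda>L. second_moment L / L) \<longlonglongrightarrow> v"
proof -
  have linear: "second_moment (m + l) = second_moment m + real l * v" for l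
  proof (induction l)
    case (Suc l)
    with second_moment_growth[OF \<gamma>, of "m + l"] show ?case by (simp add: v_def algebra_simps)
  qed simp
  have "(\<lambda>l. (second_moment m + real l * v) / (real m + real l)) \<longlonglongrightarrow> v"
  proof -
    have "(\<lambda>l. 1 / (real m + real l)) \<longlonglongrightarrow> 0" by real_asymp
    then have "(\<lambda>l. v + (second_moment m - real m * v) * (1 / (real m + real l)))
        \<longlonglongrightarrow> v + (second_moment m - real m * v) * 0"
      by (intro tendsto_intros)
    moreover have "eventually (\<lambda>l. v + (second_moment m - real m * v) * (1 / (real m + real l)) =
        (second_moment m + real l * v) / (real m + real l)) sequentially"
      using eventually_gt_at_top[of 0] by eventually_elim (simp add: field_simps)
    ultimately have "(\<lambda>l. (second_moment m + real l * v) / (real m + real l))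
        \<longlonglongrightarrow> v + (second_moment m - real m * v) * 0"
      by (rule Lim_transform_eventually)
    then show ?thesis by simp
  qed
  then have "(\<lambda>l. second_moment (l + m) / real (l + m)) \<longlonglongrightarrow> v"
    using linear by (simp add: add.commute)
  then show ?thesis by (rule LIMSEQ_offset)
qed

end

section \<open>Moments of the valley indicators\<close>

definition run_ind :: "nat \<Rightarrow> nat \<Rightarrow> (nat \<Rightarrow> real) \<Rightarrow> real" where
  "run_ind k r x = of_bool (\<forall>i\<in>{k..<k + r}. x i < x (Suc i))"

lemma run_ind_cong:
  assumes "\<And>i. i \<in> {k..k + r} \<Longrightarrow> x i = y i"
  shows "run_ind k r x = run_ind k r y"
proof -
  have "(\<forall>i\<in>{k..<k + r}. x i < x (Suc i)) \<longleftrightarrow> (\<forall>i\<in>{k..<k + r}. y i < y (Suc i))"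
    using assms by (intro ball_cong refl) auto
  then show ?thesis by (simp only: run_ind_def)
qed

lemma run_ind_measurable:
  assumes "{k..k + r} \<subseteq> A"
  shows "run_ind k r \<in> borel_measurable (PiM A (\<lambda>_. borel))"
proof -
  have "Measurable.pred (PiM A (\<lambda>_. borel :: real measure)) (\<lambda>x. \<forall>i\<in>{k..<k + r}. x i < x (Suc i))"
  proof (rule pred_intros_finite(3))
    fix i assume "i \<in> {k..<k + r}"
    then have "i \<in> A" "Suc i \<in> A" using assms by auto
    then show "Measurable.pred (PiM A (\<lambda>_. borel)) (\<lambda>x. x i < (x (Suc i) :: real))"
      by measurable
  qed simp
  then have "(\<lambda>x :: nat \<Rightarrow> real. if \<forall>i\<in>{k..<k + r}. x i < x (Suc i) then 1 else 0 :: real)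
      \<in> borel_measurable (PiM A (\<lambda>_. borel))"
    by (intro measurable_If borel_measurable_const) (simp add: pred_def)
  then show ?thesis by (simp add: run_ind_def[abs_def] of_bool_def)
qed

lemma run_ind_append: "run_ind k r x * run_ind (k + r) s x = run_ind k (r + s) x"
proof -
  have "{k..<k + (r + s)} = {k..<k + r} \<union> {k + r..<k + r + s}" by auto
  then show ?thesis by (auto simp: run_ind_def)
qed

text \<open>If the values are read as spacings, this marks a rank \<open>k + 2\<close> in \<open>popular_ranks\<close> that is away from the two
  ends.  The factor \<open>1 - run_ind k 1\<close> makes products of such indicators expand into products of
  indicators of ascending runs, whose expectations are reciprocal factorials.\<close>

definition valley_ind :: "nat \<Rightarrow> (nat \<Rightarrow> real) \<Rightarrow> real" where
  "valley_ind k x = (1 - run_ind k 1 x) * run_ind (k + 2) 1 x"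

lemma valley_ind_cong:
  assumes "\<And>i. i \<in> {k..k + 3} \<Longrightarrow> x i = y i"
  shows "valley_ind k x = valley_ind k y"
proof -
  have "run_ind k 1 x = run_ind k 1 y" "run_ind (k + 2) 1 x = run_ind (k + 2) 1 y"
    by (rule run_ind_cong, rule assms, simp)+
  then show ?thesis by (simp only: valley_ind_def)
qed

lemma valley_ind_measurable:
  assumes "{k..k + 3} \<subseteq> A"
  shows "valley_ind k \<in> borel_measurable (PiM A (\<lambda>_. borel))"
proof -
  have [measurable]: "run_ind k 1 \<in> borel_measurable (PiM A (\<lambda>_. borel))"
    "run_ind (k + 2) 1 \<in> borel_measurable (PiM A (\<lambda>_. borel))"
    by (rule run_ind_measurable, use assms in force)+
  show ?thesis unfolding valley_ind_def[abs_def] by measurable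
qed

lemma valley_ind_eq_of_bool:
  "valley_ind k x = of_bool (\<not> x k < x (Suc k) \<and> x (k + 2) < x (Suc (k + 2)))"
  by (simp add: valley_ind_def run_ind_def)

lemma valley_ind_products:
  "valley_ind k x * valley_ind k x = valley_ind k x"
  "valley_ind k x * valley_ind (k + 1) x =
     run_ind (k + 2) 2 x - run_ind k 1 x * run_ind (k + 2) 2 x - run_ind (k + 1) 3 x + run_ind k 4 x"
  "valley_ind k x * valley_ind (k + 2) x = 0"
  "valley_ind k x * valley_ind (k + 3) x =
     run_ind (k + 2) 1 x * run_ind (k + 5) 1 x - run_ind k 1 x * run_ind (k + 2) 1 x * run_ind (k + 5) 1 x
     - run_ind (k + 2) 2 x * run_ind (k + 5) 1 x + run_ind k 1 x * run_ind (k + 2) 2 x * run_ind (k + 5) 1 x"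
proof -
  define a where "a i = run_ind (k + i) 1 x" for i
  have runs: "run_ind (k + 2) 2 x = a 2 * a 3" "run_ind (k + 1) 3 x = a 1 * a 2 * a 3"
    "run_ind k 4 x = a 0 * a 1 * a 2 * a 3" "run_ind k 1 x = a 0"
    using run_ind_append[of "k + 2" 1 x 1] run_ind_append[of "k + 1" 1 x 1] run_ind_append[of "k + 1" 2 x 1]
      run_ind_append[of k 1 x 1] run_ind_append[of k 2 x 1] run_ind_append[of k 3 x 1]
    by (simp_all add: a_def eval_nat_numeral)
  have v: "valley_ind (k + i) x = (1 - a i) * a (i + 2)" for i
    by (simp add: valley_ind_def a_def add.assoc)
  note v0 = v[of 0, simplified]
  show "valley_ind k x * valley_ind k x = valley_ind k x"
    by (simp add: valley_ind_eq_of_bool)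
  show "valley_ind k x * valley_ind (k + 1) x =
     run_ind (k + 2) 2 x - run_ind k 1 x * run_ind (k + 2) 2 x - run_ind (k + 1) 3 x + run_ind k 4 x"
    unfolding v0 v runs by (simp add: algebra_simps eval_nat_numeral)
  show "valley_ind k x * valley_ind (k + 2) x = 0"
    by (auto simp: valley_ind_eq_of_bool)
  have "run_ind (k + 5) 1 x = a 5" "run_ind (k + 2) 1 x = a 2" by (simp_all add: a_def)
  then show "valley_ind k x * valley_ind (k + 3) x =
     run_ind (k + 2) 1 x * run_ind (k + 5) 1 x - run_ind k 1 x * run_ind (k + 2) 1 x * run_ind (k + 5) 1 x
     - run_ind (k + 2) 2 x * run_ind (k + 5) 1 x + run_ind k 1 x * run_ind (k + 2) 2 x * run_ind (k + 5) 1 x"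
    unfolding v0 v runs by (simp add: algebra_simps eval_nat_numeral)
qed

text \<open>Away from the ends, rank \<open>k + 2\<close> corresponds to the valley at \<open>k\<close>.  Ranks \<open>2\<close> and \<open>n\<close> have no
  counterpart, and neither have at most four valleys that reach beyond index \<open>n\<close>.\<close>

lemma card_popular_ranks_valleys:
  "\<bar>real (card (popular_ranks n d)) - (\<Sum>i<Suc n. valley_ind (Suc i) d)\<bar> \<le> 4"
proof -
  define Q where "Q = {i \<in> {1..Suc n}. \<not> d i < d (Suc i) \<and> d (i + 2) < d (Suc (i + 2))}"
  let ?P = "popular_ranks n d"
  have finP: "finite ?P" by (simp add: popular_ranks_def)
  have finQ: "finite Q" by (simp add: Q_def)
  have "(\<Sum>i<Suc n. valley_ind (Suc i) d) = (\<Sum>i\<in>{1..Suc n}. valley_ind i d)"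
    by (rule sum.reindex_bij_witness[where i = "\<lambda>i. i - 1" and j = Suc]) auto
  also have "\<dots> = real (card Q)"
    unfolding valley_ind_eq_of_bool Q_def by (rule sum_of_bool_eq_card) simp
  finally have sum: "(\<Sum>i<Suc n. valley_ind (Suc i) d) = real (card Q)" .
  have "?P \<subseteq> (\<lambda>i. i + 2) ` Q \<union> {2, n}"
  proof
    fix k assume k: "k \<in> ?P"
    show "k \<in> (\<lambda>i. i + 2) ` Q \<union> {2, n}"
    proof (cases "k = 2 \<or> k = n")
      case False
      from k have "2 \<le> k" by (simp add: popular_ranks_def)
      from le_Suc_ex[OF this] obtain j where j: "k = j + 2" by (auto simp: add.commute)
      with k False have "j \<in> Q" by (auto simp: popular_ranks_def Q_def)
      with j show ?thesis by blast
    qed auto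
  qed
  then have "card ?P \<le> card ((\<lambda>i. i + 2) ` Q \<union> {2, n})"
    using finQ by (intro card_mono) auto
  also have "\<dots> \<le> card ((\<lambda>i. i + 2) ` Q) + card {2, n}" by (rule card_Un_le)
  also have "\<dots> \<le> card Q + 2"
    using card_image_le[OF finQ, of "\<lambda>i. i + 2"] card_insert_le_m1[of 2 "{n}" 2] by simp
  finally have PQ: "card ?P \<le> card Q + 2" .
  have "Q \<subseteq> (\<lambda>k. k - 2) ` ?P \<union> {n - 2..<n + 2}"
  proof
    fix i assume i: "i \<in> Q"
    show "i \<in> (\<lambda>k. k - 2) ` ?P \<union> {n - 2..<n + 2}"
    proof (cases "i + 3 \<le> n")
      case True
      with i have "i + 2 \<in> ?P" by (auto simp: popular_ranks_def Q_def)
      then show ?thesis by (intro UnI1 image_eqI[of _ _ "i + 2"]) simp_all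
    qed (use i in \<open>auto simp: Q_def\<close>)
  qed
  then have "card Q \<le> card ((\<lambda>k. k - 2) ` ?P \<union> {n - 2..<n + 2})"
    using finP by (intro card_mono) auto
  also have "\<dots> \<le> card ((\<lambda>k. k - 2) ` ?P) + card {n - 2..<n + 2}" by (rule card_Un_le)
  also have "\<dots> \<le> card ?P + 4"
    using card_image_le[OF finP, of "\<lambda>k. k - 2"] by simp
  finally show ?thesis unfolding sum using PQ by linarith
qed

context uniform_locations
begin

lemma run_ind_X_measurable: "1 \<le> k \<Longrightarrow> (\<lambda>\<omega>. run_ind k r (\<lambda>i. X i \<omega>)) \<in> borel_measurable M"
proof -
  assume k: "1 \<le> k"
  have "(\<lambda>\<omega>. \<lambda>i\<in>{k..k + r}. X i \<omega>) \<in> measurable M (PiM {k..k + r} (\<lambda>_. borel))"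
    using k by (intro measurable_restrict X_measurable) auto
  from measurable_compose[OF this run_ind_measurable[OF subset_refl]]
  have "(\<lambda>\<omega>. run_ind k r (\<lambda>i\<in>{k..k + r}. X i \<omega>)) \<in> borel_measurable M" .
  moreover have "run_ind k r (\<lambda>i\<in>{k..k + r}. X i \<omega>) = run_ind k r (\<lambda>i. X i \<omega>)" for \<omega>
    by (rule run_ind_cong) simp
  ultimately show ?thesis by (simp only:)
qed

text \<open>An ascending run prescribes one of the \<open>(r + 1)!\<close> equally likely orders.\<close>

lemma expectation_run:
  assumes k: "1 \<le> k"
  shows "expectation (\<lambda>\<omega>. run_ind k r (\<lambda>i. X i \<omega>)) = 1 / fact (Suc r)"
proof -
  let ?K = "{1..Suc r}"
  let ?Q = "\<lambda>x. sorts id (Suc r) (x :: nat \<Rightarrow> real)"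
  define f where "f i = i + k - 1" for i
  have Q: "Measurable.pred (PiM ?K (\<lambda>_. borel)) ?Q" by (rule pred_sorts) simp
  have f: "inj_on f ?K" "f ` ?K \<subseteq> {1..}" using k by (auto simp: f_def inj_on_def)
  have run: "(\<forall>i\<in>{k..<k + r}. x i < x (Suc i)) \<longleftrightarrow> ?Q (\<lambda>i\<in>?K. x (f i))" for x :: "nat \<Rightarrow> real"
  proof -
    have "{k..<k + r} = f ` {1..<Suc r}"
    proof (intro equalityI subsetI)
      fix i assume "i \<in> {k..<k + r}"
      then show "i \<in> f ` {1..<Suc r}"
        using k by (intro image_eqI[of _ _ "i + 1 - k"]) (auto simp: f_def)
    qed (use k in \<open>auto simp: f_def\<close>)
    then have "(\<forall>i\<in>{k..<k + r}. x i < x (Suc i)) \<longleftrightarrow> (\<forall>j\<in>{1..<Suc r}. x (f j) < x (Suc (f j)))"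
      by simp
    also have "\<dots> \<longleftrightarrow> (\<forall>j\<in>{1..<Suc r}. x (f j) < x (f (Suc j)))"
      using k by (intro ball_cong refl) (simp add: f_def)
    also have "\<dots> \<longleftrightarrow> ?Q (\<lambda>i\<in>?K. x (f i))" by (simp add: sorts_def permutes_id)
    finally show ?thesis .
  qed
  have ne: "?K \<noteq> {}" by simp
  have "expectation (\<lambda>\<omega>. run_ind k r (\<lambda>i. X i \<omega>)) =
      expectation (indicator {\<omega> \<in> space M. ?Q (\<lambda>i\<in>?K. X (f i) \<omega>)})"
  proof (rule Bochner_Integration.integral_cong[OF refl])
    fix \<omega> assume "\<omega> \<in> space M"
    moreover have "run_ind k r (\<lambda>i. X i \<omega>) = of_bool (?Q (\<lambda>i\<in>?K. X (f i) \<omega>))"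
      unfolding run_ind_def by (rule arg_cong[where f = of_bool]) (rule run)
    ultimately show "run_ind k r (\<lambda>i. X i \<omega>) = indicator {\<omega> \<in> space M. ?Q (\<lambda>i\<in>?K. X (f i) \<omega>)} \<omega>"
      by (simp add: indicator_def)
  qed
  also have "\<dots> = prob {\<omega> \<in> space M. ?Q (\<lambda>i\<in>?K. X (f i) \<omega>)}"
    by (simp add: Int_def conj_commute)
  also have "\<dots> = prob {\<omega> \<in> space M. ?Q (\<lambda>i\<in>?K. X i \<omega>)}"
    unfolding prob_window[OF ne f Q] using prob_window[OF ne _ _ Q, of "\<lambda>i. i"] by simp
  also have "\<dots> = prob {\<omega> \<in> space M. ?Q (\<lambda>i. X i \<omega>)}"
  proof -
    have "?Q (\<lambda>i\<in>?K. X i \<omega>) \<longleftrightarrow> ?Q (\<lambda>i. X i \<omega>)" for \<omega> by (rule sorts_cong) simp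
    then show ?thesis by simp
  qed
  also have "\<dots> = 1 / fact (Suc r)" by (rule prob_sorts_locations[OF permutes_id])
  finally show ?thesis .
qed

lemma expectation_separated_runs:
  fixes r :: "nat \<Rightarrow> nat"
  assumes J: "finite J" "\<And>k. k \<in> J \<Longrightarrow> 1 \<le> k"
    and sep: "\<And>k l. k \<in> J \<Longrightarrow> l \<in> J \<Longrightarrow> k < l \<Longrightarrow> k + r k < l"
  shows "integrable M (\<lambda>\<omega>. \<Prod>k\<in>J. run_ind k (r k) (\<lambda>i. X i \<omega>))"
    and "expectation (\<lambda>\<omega>. \<Prod>k\<in>J. run_ind k (r k) (\<lambda>i. X i \<omega>)) = (\<Prod>k\<in>J. 1 / fact (Suc (r k)))"
proof -
  let ?K = "\<lambda>k. {k..k + r k}"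
  have disj: "disjoint_family_on ?K J"
    unfolding disjoint_family_on_def
  proof (intro ballI impI)
    fix k l assume "k \<in> J" "l \<in> J" "k \<noteq> l"
    then show "?K k \<inter> ?K l = {}" using sep[of k l] sep[of l k] by (cases "k < l") auto
  qed
  have sub: "?K k \<subseteq> {1..}" if "k \<in> J" for k using J(2)[OF that] by auto
  have "indep_vars (\<lambda>_. borel) (\<lambda>k \<omega>. run_ind k (r k) (\<lambda>i\<in>?K k. X i \<omega>)) J"
    by (rule indep_windows[OF disj sub]) (simp_all add: run_ind_measurable)
  moreover have "run_ind k (r k) (\<lambda>i\<in>?K k. X i \<omega>) = run_ind k (r k) (\<lambda>i. X i \<omega>)" for k \<omega>
    by (rule run_ind_cong) simp
  ultimately have indep: "indep_vars (\<lambda>_. borel) (\<lambda>k \<omega>. run_ind k (r k) (\<lambda>i. X i \<omega>)) J" by simp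
  have int: "integrable M (\<lambda>\<omega>. run_ind k (r k) (\<lambda>i. X i \<omega>))" if "k \<in> J" for k
    by (rule integrable_bounded[where B = 1])
      (use run_ind_X_measurable[OF J(2)[OF that]] in \<open>auto simp: run_ind_def\<close>)
  show "integrable M (\<lambda>\<omega>. \<Prod>k\<in>J. run_ind k (r k) (\<lambda>i. X i \<omega>))"
    by (rule indep_vars_integrable[OF J(1) indep int])
  have "expectation (\<lambda>\<omega>. \<Prod>k\<in>J. run_ind k (r k) (\<lambda>i. X i \<omega>)) =
      (\<Prod>k\<in>J. expectation (\<lambda>\<omega>. run_ind k (r k) (\<lambda>i. X i \<omega>)))"
    by (rule indep_vars_lebesgue_integral[OF J(1) indep int])
  also have "\<dots> = (\<Prod>k\<in>J. 1 / fact (Suc (r k)))"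
    by (intro prod.cong refl expectation_run J(2))
  finally show "expectation (\<lambda>\<omega>. \<Prod>k\<in>J. run_ind k (r k) (\<lambda>i. X i \<omega>)) = (\<Prod>k\<in>J. 1 / fact (Suc (r k)))" .
qed

end

context uniform_locations
begin

lemma expectation_two_runs:
  assumes "1 \<le> k" "k + r < l"
  shows "integrable M (\<lambda>\<omega>. run_ind k r (\<lambda>i. X i \<omega>) * run_ind l s (\<lambda>i. X i \<omega>))"
    and "expectation (\<lambda>\<omega>. run_ind k r (\<lambda>i. X i \<omega>) * run_ind l s (\<lambda>i. X i \<omega>)) =
           1 / fact (Suc r) * (1 / fact (Suc s))"
proof -
  let ?r = "\<lambda>i. if i = k then r else s"
  have *: "finite {k, l}" "\<And>i. i \<in> {k, l} \<Longrightarrow> 1 \<le> i"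
    "\<And>i j. i \<in> {k, l} \<Longrightarrow> j \<in> {k, l} \<Longrightarrow> i < j \<Longrightarrow> i + ?r i < j"
    using assms by auto
  have "k \<noteq> l" "l \<noteq> k" using assms by auto
  with expectation_separated_runs[OF *]
  show "integrable M (\<lambda>\<omega>. run_ind k r (\<lambda>i. X i \<omega>) * run_ind l s (\<lambda>i. X i \<omega>))"
    "expectation (\<lambda>\<omega>. run_ind k r (\<lambda>i. X i \<omega>) * run_ind l s (\<lambda>i. X i \<omega>)) =
       1 / fact (Suc r) * (1 / fact (Suc s))"
    by (simp_all del: fact_Suc)
qed

lemma expectation_three_runs:
  assumes "1 \<le> k" "k + r < l" "l + s < j"
  shows "integrable M (\<lambda>\<omega>. run_ind k r (\<lambda>i. X i \<omega>) * run_ind l s (\<lambda>i. X i \<omega>) * run_ind j t (\<lambda>i. X i \<omega>))"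
    and "expectation (\<lambda>\<omega>. run_ind k r (\<lambda>i. X i \<omega>) * run_ind l s (\<lambda>i. X i \<omega>) * run_ind j t (\<lambda>i. X i \<omega>)) =
           1 / fact (Suc r) * (1 / fact (Suc s)) * (1 / fact (Suc t))"
proof -
  let ?r = "\<lambda>i. if i = k then r else if i = l then s else t"
  have *: "finite {k, l, j}" "\<And>i. i \<in> {k, l, j} \<Longrightarrow> 1 \<le> i"
    "\<And>i i'. i \<in> {k, l, j} \<Longrightarrow> i' \<in> {k, l, j} \<Longrightarrow> i < i' \<Longrightarrow> i + ?r i < i'"
    using assms by auto
  have "k \<noteq> l" "l \<noteq> k" "k \<noteq> j" "j \<noteq> k" "l \<noteq> j" "j \<noteq> l" using assms by auto
  with expectation_separated_runs[OF *]
  show "integrable M (\<lambda>\<omega>. run_ind k r (\<lambda>i. X i \<omega>) * run_ind l s (\<lambda>i. X i \<omega>) * run_ind j t (\<lambda>i. X i \<omega>))"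
    "expectation (\<lambda>\<omega>. run_ind k r (\<lambda>i. X i \<omega>) * run_ind l s (\<lambda>i. X i \<omega>) * run_ind j t (\<lambda>i. X i \<omega>)) =
       1 / fact (Suc r) * (1 / fact (Suc s)) * (1 / fact (Suc t))"
    by (simp_all del: fact_Suc add: mult.assoc)
qed

lemma integrable_run: "1 \<le> k \<Longrightarrow> integrable M (\<lambda>\<omega>. run_ind k r (\<lambda>i. X i \<omega>))"
  by (rule integrable_bounded[where B = 1]) (simp_all add: run_ind_X_measurable run_ind_def)

lemma expectation_valley:
  assumes "1 \<le> k"
  shows "expectation (\<lambda>\<omega>. valley_ind k (\<lambda>i. X i \<omega>)) = 1 / 4"
proof -
  have "expectation (\<lambda>\<omega>. valley_ind k (\<lambda>i. X i \<omega>)) = expectation (\<lambda>\<omega>. run_ind (k + 2) 1 (\<lambda>i. X i \<omega>) -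
      run_ind k 1 (\<lambda>i. X i \<omega>) * run_ind (k + 2) 1 (\<lambda>i. X i \<omega>))"
    by (simp only: valley_ind_def left_diff_distrib mult_1_left)
  also have "\<dots> = expectation (\<lambda>\<omega>. run_ind (k + 2) 1 (\<lambda>i. X i \<omega>)) -
      expectation (\<lambda>\<omega>. run_ind k 1 (\<lambda>i. X i \<omega>) * run_ind (k + 2) 1 (\<lambda>i. X i \<omega>))"
    by (rule Bochner_Integration.integral_diff) (use assms in \<open>auto intro!: integrable_run expectation_two_runs(1)\<close>)
  also have "\<dots> = 1 / 2 - 1 / 4"
    by (subst expectation_run, use assms in simp, subst expectation_two_runs(2))
      (use assms in \<open>simp_all add: eval_nat_numeral\<close>)
  finally show ?thesis by simp
qed

definition valley_moment :: "nat \<Rightarrow> real" where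
  "valley_moment h = [1 / 4, 1 / 20, 0, 1 / 12] ! h"

lemma expectation_valley_valley:
  assumes k: "1 \<le> k" and h: "h \<le> 3"
  shows "expectation (\<lambda>\<omega>. valley_ind k (\<lambda>i. X i \<omega>) * valley_ind (k + h) (\<lambda>i. X i \<omega>)) = valley_moment h"
proof -
  have "h = 0 \<or> h = 1 \<or> h = 2 \<or> h = 3" using h by auto
  then consider "h = 0" | "h = 1" | "h = 2" | "h = 3" by blast
  then show ?thesis
  proof cases
    case 1
    then show ?thesis
      using expectation_valley[OF k] by (simp add: valley_ind_products(1) valley_moment_def)
  next
    case 2
    let ?a = "\<lambda>\<omega>. run_ind (k + 2) 2 (\<lambda>i. X i \<omega>)"
    let ?b = "\<lambda>\<omega>. run_ind k 1 (\<lambda>i. X i \<omega>) * run_ind (k + 2) 2 (\<lambda>i. X i \<omega>)"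
    let ?c = "\<lambda>\<omega>. run_ind (k + 1) 3 (\<lambda>i. X i \<omega>)"
    let ?d = "\<lambda>\<omega>. run_ind k 4 (\<lambda>i. X i \<omega>)"
    have int: "integrable M ?a" "integrable M ?b" "integrable M ?c" "integrable M ?d"
      using k by (auto intro!: integrable_run expectation_two_runs(1))
    have ex: "expectation ?a = 1 / 6" "expectation ?b = 1 / 12" "expectation ?c = 1 / 24"
      "expectation ?d = 1 / 120"
      using k expectation_run[of "k + 2" 2] expectation_two_runs(2)[of k 1 "k + 2" 2]
        expectation_run[of "k + 1" 3] expectation_run[of k 4]
      by (simp_all add: fact_numeral eval_nat_numeral)
    have "expectation (\<lambda>\<omega>. valley_ind k (\<lambda>i. X i \<omega>) * valley_ind (k + 1) (\<lambda>i. X i \<omega>)) =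
        expectation (\<lambda>\<omega>. ?a \<omega> - ?b \<omega> - ?c \<omega> + ?d \<omega>)"
      by (simp only: valley_ind_products(2))
    also have "\<dots> = expectation ?a - expectation ?b - expectation ?c + expectation ?d"
      using int by simp
    also have "\<dots> = 1 / 20" unfolding ex by simp
    finally show ?thesis using 2 by (simp add: valley_moment_def)
  next
    case 3
    then show ?thesis by (simp only: valley_ind_products(3)) (simp add: valley_moment_def)
  next
    case 4
    let ?a = "\<lambda>\<omega>. run_ind (k + 2) 1 (\<lambda>i. X i \<omega>) * run_ind (k + 5) 1 (\<lambda>i. X i \<omega>)"
    let ?b = "\<lambda>\<omega>. run_ind k 1 (\<lambda>i. X i \<omega>) * run_ind (k + 2) 1 (\<lambda>i. X i \<omega>) * run_ind (k + 5) 1 (\<lambda>i. X i \<omega>)"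
    let ?c = "\<lambda>\<omega>. run_ind (k + 2) 2 (\<lambda>i. X i \<omega>) * run_ind (k + 5) 1 (\<lambda>i. X i \<omega>)"
    let ?d = "\<lambda>\<omega>. run_ind k 1 (\<lambda>i. X i \<omega>) * run_ind (k + 2) 2 (\<lambda>i. X i \<omega>) * run_ind (k + 5) 1 (\<lambda>i. X i \<omega>)"
    have int: "integrable M ?a" "integrable M ?b" "integrable M ?c" "integrable M ?d"
      using k by (auto intro!: expectation_two_runs(1) expectation_three_runs(1))
    have ex: "expectation ?a = 1 / 4" "expectation ?b = 1 / 8" "expectation ?c = 1 / 12"
      "expectation ?d = 1 / 24"
      using k expectation_two_runs(2)[of "k + 2" 1 "k + 5" 1] expectation_two_runs(2)[of "k + 2" 2 "k + 5" 1]
        expectation_three_runs(2)[of k 1 "k + 2" 1 "k + 5" 1] expectation_three_runs(2)[of k 1 "k + 2" 2 "k + 5" 1]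
      by (simp_all add: fact_numeral eval_nat_numeral)
    have "expectation (\<lambda>\<omega>. valley_ind k (\<lambda>i. X i \<omega>) * valley_ind (k + 3) (\<lambda>i. X i \<omega>)) =
        expectation (\<lambda>\<omega>. ?a \<omega> - ?b \<omega> - ?c \<omega> + ?d \<omega>)"
      by (simp only: valley_ind_products(4))
    also have "\<dots> = expectation ?a - expectation ?b - expectation ?c + expectation ?d"
      using int by simp
    also have "\<dots> = 1 / 12" unfolding ex by simp
    finally show ?thesis using 4 by (simp add: valley_moment_def)
  qed
qed

abbreviation centred_valley :: "nat \<Rightarrow> 'a \<Rightarrow> real" where
  "centred_valley k \<omega> \<equiv> valley_ind (Suc k) (\<lambda>i. X i \<omega>) - 1 / 4"

lemma valley_X_measurable: "1 \<le> k \<Longrightarrow> (\<lambda>\<omega>. valley_ind k (\<lambda>i. X i \<omega>)) \<in> borel_measurable M"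
  unfolding valley_ind_def
  by (intro borel_measurable_times borel_measurable_diff borel_measurable_const run_ind_X_measurable) auto

lemma valley_ind_bounds: "0 \<le> valley_ind k x" "valley_ind k x \<le> 1"
  by (simp_all add: valley_ind_eq_of_bool)

lemma integrable_valley: "1 \<le> k \<Longrightarrow> integrable M (\<lambda>\<omega>. valley_ind k (\<lambda>i. X i \<omega>))"
  by (rule integrable_bounded[where B = 1, OF valley_X_measurable])
    (simp_all add: valley_ind_bounds abs_le_iff order_trans[OF _ valley_ind_bounds(1)])

text \<open>The valley at \<open>k\<close> involves the four locations \<open>k, \<dots>, k + 3\<close>, so blocks of indices more than 3 apart
  involve disjoint sets of locations.\<close>

lemma indep_valley_blocks:
  assumes fin: "\<And>j :: nat. finite (K j)"
    and sep: "\<And>i j a b. i < j \<Longrightarrow> a \<in> K i \<Longrightarrow> b \<in> K j \<Longrightarrow> a + 3 < b"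
  shows "indep_vars (\<lambda>_. borel) (\<lambda>j \<omega>. \<Sum>k\<in>K j. centred_valley k \<omega>) UNIV"
proof -
  define A where "A j = (\<Union>k\<in>K j. {Suc k..Suc k + 3})" for j
  define F where "F j x = (\<Sum>k\<in>K j. valley_ind (Suc k) x - 1 / 4)" for j and x :: "nat \<Rightarrow> real"
  have in_A: "{Suc k..Suc k + 3} \<subseteq> A j" if "k \<in> K j" for k j
    using that unfolding A_def by blast
  have "disjoint_family_on A UNIV"
    unfolding disjoint_family_on_def
  proof (intro ballI impI)
    fix i j :: nat assume "i \<noteq> j"
    have disj: "A i \<inter> A j = {}" if "i < j" for i j
    proof (rule ccontr)
      assume "A i \<inter> A j \<noteq> {}"
      then obtain k l c where "k \<in> K i" "l \<in> K j" "c \<in> {Suc k..Suc k + 3}" "c \<in> {Suc l..Suc l + 3}"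
        unfolding A_def by blast
      with sep[OF that, of k l] show False by auto
    qed
    from \<open>i \<noteq> j\<close> disj[of i j] disj[of j i] show "A i \<inter> A j = {}"
      by (cases "i < j") (auto simp: Int_commute)
  qed
  moreover have "A j \<subseteq> {1..}" for j by (auto simp: A_def)
  moreover have "F j \<in> borel_measurable (PiM (A j) (\<lambda>_. borel))" for j
    unfolding F_def[abs_def]
    by (intro borel_measurable_sum borel_measurable_diff borel_measurable_const valley_ind_measurable in_A)
  ultimately have "indep_vars (\<lambda>_. borel) (\<lambda>j \<omega>. F j (\<lambda>i\<in>A j. X i \<omega>)) UNIV"
    by (intro indep_windows)
  moreover have "F j (\<lambda>i\<in>A j. X i \<omega>) = (\<Sum>k\<in>K j. centred_valley k \<omega>)" for j \<omega>
    unfolding F_def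
  proof (intro sum.cong refl arg_cong2[where f = "(-)"] valley_ind_cong)
    fix k i assume "k \<in> K j" "i \<in> {Suc k..Suc k + 3}"
    with in_A[of k j] show "(\<lambda>i\<in>A j. X i \<omega>) i = X i \<omega>" by auto
  qed
  ultimately show ?thesis by (simp only:)
qed

lemma distr_valley_block_shift:
  "distr M borel (\<lambda>\<omega>. \<Sum>k<L. centred_valley (s + k) \<omega>) = distr M borel (\<lambda>\<omega>. \<Sum>k<L. centred_valley k \<omega>)"
proof -
  let ?K = "{1..L + 3}"
  let ?P = "PiM ?K (\<lambda>_. borel :: real measure)"
  define F where "F x = (\<Sum>k<L. valley_ind (Suc k) x - 1 / 4)" for x :: "nat \<Rightarrow> real"
  have F: "F \<in> borel_measurable ?P"
    unfolding F_def[abs_def]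
    by (intro borel_measurable_sum borel_measurable_diff borel_measurable_const valley_ind_measurable) auto
  have shift: "distr M borel (\<lambda>\<omega>. \<Sum>k<L. centred_valley (s + k) \<omega>) =
      distr (PiM ?K (\<lambda>_. uniform_measure lborel {0..1})) borel F" for s
  proof -
    have W: "(\<lambda>\<omega>. \<lambda>i\<in>?K. X (s + i) \<omega>) \<in> measurable M ?P"
      by (intro measurable_restrict X_measurable) auto
    have shift_run: "run_ind (s + k) r x = run_ind k r (\<lambda>i. x (s + i))" for k r and x :: "nat \<Rightarrow> real"
    proof -
      have "(\<forall>i\<in>{s + k..<s + k + r}. x i < x (Suc i)) \<longleftrightarrow>
            (\<forall>i\<in>(\<lambda>i. s + i) ` {k..<k + r}. x i < x (Suc i))"
        by (simp add: ac_simps)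
      also have "\<dots> \<longleftrightarrow> (\<forall>i\<in>{k..<k + r}. x (s + i) < x (Suc (s + i)))"
        by blast
      finally have "(\<forall>i\<in>{s + k..<s + k + r}. x i < x (Suc i)) \<longleftrightarrow>
            (\<forall>i\<in>{k..<k + r}. x (s + i) < x (Suc (s + i)))" .
      then show ?thesis by (simp only: run_ind_def add_Suc_right)
    qed
    have "centred_valley (s + k) \<omega> = valley_ind (Suc k) (\<lambda>i\<in>?K. X (s + i) \<omega>) - 1 / 4" if "k < L" for k \<omega>
    proof -
      have "valley_ind (Suc (s + k)) (\<lambda>i. X i \<omega>) = valley_ind (Suc k) (\<lambda>i. X (s + i) \<omega>)"
        using shift_run[of "Suc k" 1 "\<lambda>i. X i \<omega>"] shift_run[of "Suc k + 2" 1 "\<lambda>i. X i \<omega>"]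
        by (simp add: valley_ind_def)
      also have "\<dots> = valley_ind (Suc k) (\<lambda>i\<in>?K. X (s + i) \<omega>)"
        by (rule valley_ind_cong) (use that in auto)
      finally show ?thesis by simp
    qed
    then have eq: "(\<lambda>\<omega>. \<Sum>k<L. centred_valley (s + k) \<omega>) = (\<lambda>\<omega>. F (\<lambda>i\<in>?K. X (s + i) \<omega>))"
      unfolding F_def by (intro ext sum.cong refl) simp
    have "distr M borel (\<lambda>\<omega>. F (\<lambda>i\<in>?K. X (s + i) \<omega>)) = distr (distr M ?P (\<lambda>\<omega>. \<lambda>i\<in>?K. X (s + i) \<omega>)) borel F"
      using distr_distr[OF F W] by (simp add: comp_def)
    also have "distr M ?P (\<lambda>\<omega>. \<lambda>i\<in>?K. X (s + i) \<omega>) = PiM ?K (\<lambda>_. uniform_measure lborel {0..1})"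
      by (rule distr_window) auto
    finally show ?thesis by (simp only: eq)
  qed
  from shift[of s] shift[of 0] show ?thesis by simp
qed

lemma m_dependent_valleys: "m_dependent M centred_valley 3 1"
proof unfold_locales
  show "centred_valley k \<in> borel_measurable M" for k
    by (intro borel_measurable_diff borel_measurable_const valley_X_measurable) simp
  show "\<bar>centred_valley k \<omega>\<bar> \<le> 1" for k \<omega>
    using valley_ind_bounds[of "Suc k" "\<lambda>i. X i \<omega>"] by linarith
  show "expectation (centred_valley k) = 0" for k
    using integrable_valley[of "Suc k"] expectation_valley[of "Suc k"] by (simp add: prob_space)
  show "indep_vars (\<lambda>_. borel) (\<lambda>j \<omega>. \<Sum>k\<in>K j. centred_valley k \<omega>) UNIV"
    if "\<And>j. finite (K j)" "\<And>i j a b. i < j \<Longrightarrow> a \<in> K i \<Longrightarrow> b \<in> K j \<Longrightarrow> a + 3 < b"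
    for K :: "nat \<Rightarrow> nat set"
    by (rule indep_valley_blocks[OF that])
  show "distr M borel (\<lambda>\<omega>. \<Sum>k<L. centred_valley (s + k) \<omega>) =
      distr M borel (\<lambda>\<omega>. \<Sum>k<L. centred_valley k \<omega>)" for s L
    by (rule distr_valley_block_shift)
qed simp

sublocale valleys: m_dependent M centred_valley 3 1
  by (rule m_dependent_valleys)

text \<open>The covariances are the mixed moments minus \<open>1 / 16\<close>: \<open>3 / 16\<close>, \<open>- 1 / 80\<close>, \<open>- 1 / 16\<close>, \<open>1 / 48\<close>.\<close>

lemma valley_second_moment_asymptotics:
  "(\<lambda>L. valleys.second_moment L / L) \<longlonglongrightarrow> 19 / 240"
proof -
  let ?\<gamma> = "\<lambda>h. valley_moment h - 1 / 16"
  have "expectation (\<lambda>\<omega>. centred_valley k \<omega> * centred_valley (k + h) \<omega>) = ?\<gamma> h" if "h \<le> 3" for k h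
  proof -
    let ?v = "\<lambda>k \<omega>. valley_ind k (\<lambda>i. X i \<omega>)"
    have int: "integrable M (?v (Suc k))" "integrable M (?v (Suc k + h))"
      by (simp_all add: integrable_valley)
    have int2: "integrable M (\<lambda>\<omega>. ?v (Suc k) \<omega> * ?v (Suc k + h) \<omega>)"
    proof (rule integrable_bounded[where B = 1])
      show "(\<lambda>\<omega>. ?v (Suc k) \<omega> * ?v (Suc k + h) \<omega>) \<in> borel_measurable M"
        by (intro borel_measurable_times valley_X_measurable) simp_all
      show "\<bar>?v (Suc k) \<omega> * ?v (Suc k + h) \<omega>\<bar> \<le> 1" for \<omega>
        by (simp add: valley_ind_eq_of_bool)
    qed
    have "expectation (\<lambda>\<omega>. centred_valley k \<omega> * centred_valley (k + h) \<omega>) =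
        expectation (\<lambda>\<omega>. ?v (Suc k) \<omega> * ?v (Suc k + h) \<omega> - (1 / 4) * ?v (Suc k) \<omega>
          - (1 / 4) * ?v (Suc k + h) \<omega> + 1 / 16)"
      by (simp add: algebra_simps)
    also have "\<dots> = expectation (\<lambda>\<omega>. ?v (Suc k) \<omega> * ?v (Suc k + h) \<omega>)
        - (1 / 4) * expectation (?v (Suc k)) - (1 / 4) * expectation (?v (Suc k + h)) + 1 / 16"
      using int int2 by (simp add: prob_space)
    also have "\<dots> = ?\<gamma> h"
      using expectation_valley[of "Suc k"] expectation_valley[of "Suc k + h"]
        expectation_valley_valley[of "Suc k" h] that by simp
    finally show ?thesis .
  qed
  from valleys.second_moment_asymptotics[OF this]
  have "(\<lambda>L. valleys.second_moment L / L) \<longlonglongrightarrow> ?\<gamma> 0 + 2 * (\<Sum>h\<in>{1..3}. ?\<gamma> h)" .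
  also have "?\<gamma> 0 + 2 * (\<Sum>h\<in>{1..3}. ?\<gamma> h) = 19 / 240"
    by (simp add: valley_moment_def eval_nat_numeral)
  finally show ?thesis .
qed

section \<open>The fraction of overloaded servers\<close>

text \<open>The surrogate for the number of overloaded servers, with the locations in place of the spacings.\<close>

definition popular_count :: "nat \<Rightarrow> 'a \<Rightarrow> real" where
  "popular_count N \<omega> = real (card (popular_ranks (N - 1) (\<lambda>i. X i \<omega>)))"

lemma popular_count_measurable [measurable]: "popular_count N \<in> borel_measurable M"
  unfolding popular_count_def[abs_def] by (rule measurable_card_popular_ranks) simp

lemma popular_count_approx:
  "\<bar>popular_count N \<omega> - real N / 4 - valleys.block_sum {..<N} \<omega>\<bar> \<le> 5"
proof (cases N)
  case 0
  then show ?thesis by (simp add: popular_count_def popular_ranks_def valleys.block_sum_def)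
next
  case (Suc n)
  have "valleys.block_sum {..<N} \<omega> = (\<Sum>i<Suc n. valley_ind (Suc i) (\<lambda>i. X i \<omega>)) - real N / 4"
    by (simp add: valleys.block_sum_def sum_subtractf Suc del: sum.lessThan_Suc)
  then show ?thesis
    using card_popular_ranks_valleys[of n "\<lambda>i. X i \<omega>"] by (simp add: popular_count_def Suc)
qed

lemma integrable_popular_count: "integrable M (popular_count N)"
proof (rule integrable_bounded)
  fix \<omega> assume "\<omega> \<in> space M"
  have "card (popular_ranks (N - 1) (\<lambda>i. X i \<omega>)) \<le> card {2..N - 1}"
    by (rule card_mono) (auto simp: popular_ranks_def)
  then show "\<bar>popular_count N \<omega>\<bar> \<le> real N" by (simp add: popular_count_def)
qed measurable

lemma expectation_popular_count_approx: "\<bar>expectation (popular_count N) - real N / 4\<bar> \<le> 5"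
proof -
  have "expectation (popular_count N) - real N / 4 =
      expectation (\<lambda>\<omega>. popular_count N \<omega> - real N / 4 - valleys.block_sum {..<N} \<omega>)"
    using integrable_popular_count valleys.integrable_block_sum valleys.block_sum_mean
    by (simp add: prob_space)
  also have "\<bar>\<dots>\<bar> \<le> expectation (\<lambda>\<omega>. \<bar>popular_count N \<omega> - real N / 4 - valleys.block_sum {..<N} \<omega>\<bar>)"
    by (rule integral_abs_bound)
  also have "\<dots> \<le> expectation (\<lambda>\<omega>. 5)"
    using integrable_popular_count valleys.integrable_block_sum popular_count_approx
    by (intro integral_mono) simp_all
  finally show ?thesis by (simp add: prob_space)
qed

lemma popular_count_clt:
  "weak_conv_m (\<lambda>N. distr M borel (\<lambda>\<omega>. (popular_count N \<omega> - expectation (popular_count N)) / sqrt N))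
     (density lborel (normal_density 0 (sqrt (19 / 240))))"
proof (rule valleys.central_limit_theorem_m_dependent[where B = 10])
  fix N \<omega>
  show "\<bar>popular_count N \<omega> - expectation (popular_count N) - valleys.block_sum {..<N} \<omega>\<bar> \<le> 10"
    using popular_count_approx[of N \<omega>] expectation_popular_count_approx[of N] by linarith
qed (simp_all add: valley_second_moment_asymptotics)

lemma popular_count_deviation:
  assumes "0 < \<epsilon>"
  shows "summable (\<lambda>N. prob {\<omega> \<in> space M. \<epsilon> * real N \<le> \<bar>popular_count N \<omega> - real N / 4\<bar>})"
  by (rule valleys.summable_prob_deviation[OF _ popular_count_approx assms]) measurable

context
  fixes p lam mu :: real and Ov :: "nat \<Rightarrow> 'a \<Rightarrow> real"
  assumes p: "0 \<le> p" "p \<le> 1" and lam: "lam > 0" and mu: "mu > 0"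
    and load: "1 / (1 + p) < lam / mu" "lam / mu \<le> 1"
  defines "Ov \<equiv> \<lambda>N \<omega>. overloaded_fraction lam mu p (\<lambda>i. X i \<omega>) N"
begin

lemma Ov_measurable [measurable]: "Ov N \<in> borel_measurable M"
  unfolding Ov_def by (rule measurable_overloaded_fraction) simp

lemma distr_Ov: "2 \<le> N \<Longrightarrow> distr M borel (Ov N) = distr M borel (\<lambda>\<omega>. popular_count N \<omega> / N)"
  unfolding Ov_def popular_count_def by (rule distr_overloaded_fraction[OF p lam mu load])

lemma overloaded_fraction_clt:
  "weak_conv_m (\<lambda>N. distr M borel (\<lambda>\<omega>. sqrt (real N) * (Ov N \<omega> - expectation (Ov N))))
     (density lborel (normal_density 0 (sqrt (19 / 240))))"
proof -
  have "distr M borel (\<lambda>\<omega>. (popular_count N \<omega> - expectation (popular_count N)) / sqrt N) =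
      distr M borel (\<lambda>\<omega>. sqrt (real N) * (Ov N \<omega> - expectation (Ov N)))" if N: "2 \<le> N" for N
  proof -
    let ?C = "\<lambda>\<omega>. popular_count N \<omega> / N"
    let ?h = "\<lambda>x. sqrt (real N) * (x - expectation (Ov N))"
    have "expectation (Ov N) = (\<integral>x. x \<partial>distr M borel (Ov N))" by (simp add: integral_distr)
    also have "\<dots> = expectation ?C" unfolding distr_Ov[OF N] by (simp add: integral_distr)
    finally have mean: "expectation (Ov N) = expectation (popular_count N) / N" by simp
    have "distr M borel (\<lambda>\<omega>. ?h (Ov N \<omega>)) = distr (distr M borel (Ov N)) borel ?h"
      by (subst distr_distr) (simp_all add: comp_def)
    also have "\<dots> = distr M borel (\<lambda>\<omega>. ?h (?C \<omega>))"
      unfolding distr_Ov[OF N] by (subst distr_distr) (simp_all add: comp_def)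
    also have "(\<lambda>\<omega>. ?h (?C \<omega>)) = (\<lambda>\<omega>. (popular_count N \<omega> - expectation (popular_count N)) / sqrt N)"
    proof
      fix \<omega>
      have "?h (?C \<omega>) = (sqrt N / N) * (popular_count N \<omega> - expectation (popular_count N))"
        unfolding mean by (simp add: diff_divide_distrib[symmetric])
      also have "sqrt N / N = 1 / sqrt N" using N by (simp add: real_div_sqrt field_simps)
      finally show "?h (?C \<omega>) = (popular_count N \<omega> - expectation (popular_count N)) / sqrt N" by simp
    qed
    finally show ?thesis by simp
  qed
  \<comment> \<open>The laws agree from \<open>N = 2\<close> on, which is enough for the limit.\<close>
  then have "eventually (\<lambda>N. distr M borel (\<lambda>\<omega>. (popular_count N \<omega> - expectation (popular_count N)) / sqrt N) =
      distr M borel (\<lambda>\<omega>. sqrt (real N) * (Ov N \<omega> - expectation (Ov N)))) sequentially"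
    by (rule eventually_sequentiallyI)
  then have same: "eventually (\<lambda>N. cdf (distr M borel (\<lambda>\<omega>. (popular_count N \<omega> - expectation (popular_count N)) / sqrt N)) x =
      cdf (distr M borel (\<lambda>\<omega>. sqrt (real N) * (Ov N \<omega> - expectation (Ov N)))) x) sequentially" for x
    by eventually_elim simp
  show ?thesis
    using popular_count_clt Lim_transform_eventually[OF _ same]
    unfolding weak_conv_m_def weak_conv_def by blast
qed

lemma overloaded_fraction_lln: "AE \<omega> in M. (\<lambda>N. Ov N \<omega>) \<longlonglongrightarrow> 1 / 4"
proof -
  have "AE \<omega> in M. (\<lambda>N. Ov N \<omega> - 1 / 4) \<longlonglongrightarrow> 0"
  proof (rule AE_tendsto_0_if_summable)
    fix \<epsilon> :: real assume \<epsilon>: "0 < \<epsilon>"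
    have "prob {\<omega> \<in> space M. \<epsilon> * real N \<le> \<bar>popular_count N \<omega> - real N / 4\<bar>} =
        prob {\<omega> \<in> space M. \<epsilon> \<le> \<bar>Ov N \<omega> - 1 / 4\<bar>}" if N: "2 \<le> N" for N
    proof -
      let ?S = "{x :: real. \<epsilon> \<le> \<bar>x - 1 / 4\<bar>}"
      have S: "?S \<in> sets borel" by measurable
      have scale: "\<epsilon> * real N \<le> \<bar>c - real N / 4\<bar> \<longleftrightarrow> \<epsilon> \<le> \<bar>c / N - 1 / 4\<bar>" for c
      proof -
        have "c - real N / 4 = (c / N - 1 / 4) * real N" using N by (simp add: field_simps)
        then have "\<bar>c - real N / 4\<bar> = \<bar>c / N - 1 / 4\<bar> * real N" by (simp add: abs_mult)
        then show ?thesis using N by simp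
      qed
      have "prob {\<omega> \<in> space M. \<epsilon> \<le> \<bar>Ov N \<omega> - 1 / 4\<bar>} = measure (distr M borel (Ov N)) ?S"
        using S by (subst measure_distr) (auto intro!: arg_cong[of _ _ prob])
      also have "\<dots> = prob {\<omega> \<in> space M. \<epsilon> \<le> \<bar>popular_count N \<omega> / N - 1 / 4\<bar>}"
        unfolding distr_Ov[OF N] using S
        by (subst measure_distr) (auto intro!: arg_cong[of _ _ prob])
      finally show ?thesis by (simp only: scale)
    qed
    then have "eventually (\<lambda>N. prob {\<omega> \<in> space M. \<epsilon> * real N \<le> \<bar>popular_count N \<omega> - real N / 4\<bar>} =
        prob {\<omega> \<in> space M. \<epsilon> \<le> \<bar>Ov N \<omega> - 1 / 4\<bar>}) sequentially"
      by (rule eventually_sequentiallyI)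
    from summable_cong[OF this] popular_count_deviation[OF \<epsilon>]
    show "summable (\<lambda>N. prob {\<omega> \<in> space M. \<epsilon> \<le> \<bar>Ov N \<omega> - 1 / 4\<bar>})" by blast
  qed measurable
  then show ?thesis by eventually_elim (simp add: LIM_zero_iff)
qed

end

end

theorem corollary2p1:
  fixes M :: "'a measure" and X :: "nat \<Rightarrow> 'a \<Rightarrow> real"
    and p lam mu :: real
    and Ov :: "nat \<Rightarrow> 'a \<Rightarrow> real"
  assumes "prob_space M"
    and "prob_space.indep_vars M (\<lambda>_. borel) X {1..}"
    and "\<And>i. i \<ge> 1 \<Longrightarrow> distr M borel (X i) = uniform_measure lborel {0..1}"
    and "0 \<le> p" and "p \<le> 1" and "lam > 0" and "mu > 0"
  defines "Ov \<equiv> \<lambda>N \<omega>. overloaded_fraction lam mu p (\<lambda>i. X i \<omega>) N"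
  shows "(1 / (1 + p) < lam / mu \<and> lam / mu \<le> 1 \<longrightarrow>
            (AE \<omega> in M. (\<lambda>N. Ov N \<omega>) \<longlonglongrightarrow> 1 / 4) \<and>
            weak_conv_m
              (\<lambda>N. distr M borel (\<lambda>\<omega>. sqrt (real N) * (Ov N \<omega> - integral\<^sup>L M (Ov N))))
              (density lborel (normal_density 0 (sqrt (19 / 240))))) \<and>
         (lam / mu \<le> 1 / (1 + p) \<longrightarrow> (AE \<omega> in M. \<forall>N\<ge>2. Ov N \<omega> = 0))"
proof -
  interpret uniform_locations M X
    using assms(1-3) by (simp add: uniform_locations_def uniform_locations_axioms_def)
  note params = assms(4-7)
  show ?thesis
  proof (intro conjI impI)
    assume load: "1 / (1 + p) < lam / mu \<and> lam / mu \<le> 1"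
    show "AE \<omega> in M. (\<lambda>N. Ov N \<omega>) \<longlonglongrightarrow> 1 / 4"
      unfolding Ov_def using overloaded_fraction_lln[OF params] load by blast
    show "weak_conv_m
        (\<lambda>N. distr M borel (\<lambda>\<omega>. sqrt (real N) * (Ov N \<omega> - integral\<^sup>L M (Ov N))))
        (density lborel (normal_density 0 (sqrt (19 / 240))))"
      unfolding Ov_def using overloaded_fraction_clt[OF params] load by blast
  next
    assume load: "lam / mu \<le> 1 / (1 + p)"
    show "AE \<omega> in M. \<forall>N\<ge>2. Ov N \<omega> = 0"
      using AE_generic
    proof eventually_elim
      case (elim \<omega>)
      show ?case
        unfolding Ov_def
        by (intro allI impI overloaded_fraction_eq_0[OF params load] generic_inj_on[OF elim])
    qed
  qed
qed

end
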